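(* Let $1<\gamma<3$, let $k>0$ be the heating parameter, and let $U_1$ be a constant initial state with $u_1>0$. Under the double CRPs frame (see context): (i) if $k(\gamma^2-1)\ge 1$, the solution of the Riemann problem with initial state $U_1$ and heating parameter $k$ is unique (any two such solutions coincide); (ii) if $k(\gamma^2-1)<1$, the solution of the Riemann problem with initial state $U_1$ and heating parameter $k$ is unique under the assumption that the root of $Y$ is not greater than $M_{**}$, i.e. every $M$ with $Y(M)=0$ satisfies $M\le M_{**}$.
   Context: Gas. A state is given by density $\rho>0$, velocity $u$, pressure $p>0$; $p=(\gamma-1)\rho e$, $E=\rho e+\frac12\rho u^2$, enthalpy $h=\frac{\gamma p}{(\gamma-1)\rho}$, sound speed $a=\sqrt{\gamma p/\rho}$, Mach number $M=u/a$. Riemann problem. $\partial_t U+\partial_x F=S$, $U=(\rho,\rho u,E)^T$, $F=(\rho u,\rho u^2+p,(E+p)u)^T$, $S=(0,0,Q\delta(x))^T$, $Q>0$, with $U(x,0)\equiv U_1$, $u_1>0$. The heating parameter is $k=Q/\big(\rho_-u_-(\frac12u_-^2+h_-)\big)$, where $-$ and $+$ denote the limits at $x=0-$ and $x=0+$; $k$ is treated as a given constant $k>0$. Double CRPs frame. CRP means the classical Riemann problem for the homogeneous Euler equations, solved by its self-similar entropy solution. A solution in the double CRPs frame is a function $U(x,t)$ such that $U_\pm=U(0\pm,t)$ are constant in $t$ with $u_\pm\ne0$ (indeed $u_->0$ since $k,Q>0$); in $x<0$, $U$ is the left half of the CRP solution with left state $U_1$ and right state $U_-$ (all waves of speed $\le0$);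 in $x>0$, $U$ is the right half of the CRP solution with left state $U_+$ and right state $U_1$ (all waves of speed $\ge0$); and across $x=0$: $\rho_-u_-=\rho_+u_+$, $\rho_-u_-^2+p_-=\rho_+u_+^2+p_+$, $(\frac12u_-^2+h_-)(1+k)=\frac12u_+^2+h_+$, on the physical branch ($M_-<1\Rightarrow M_+\le1$; $M_->1\Rightarrow M_+\ge1$). Functions. Set $I(M)=\sqrt{(\gamma+\frac1{M^2})^2-2(\gamma+1)(\frac1{M^2}+\frac{\gamma-1}2)(1+k)}$, $\phi(M)=\frac1{\gamma+1}(\gamma+\frac1{M^2}-I(M))$, $\psi(M)=\frac{M^2}{\gamma+1}(\gamma+\frac1{M^2}+\gamma I(M))$; $M_*=\sqrt{\frac{k(\gamma+1)+1-(\gamma+1)\sqrt{k(k+1)}}{1-k(\gamma^2-1)}}$ if $k(\gamma^2-1)\ne1$, $M_*=\sqrt{\frac1{2[k(\gamma+1)+1]}}$ if $k(\gamma^2-1)=1$; $M_{**}=\sqrt{\frac{k(\gamma+1)+1+(\gamma+1)\sqrt{k(k+1)}}{1-k(\gamma^2-1)}}$ if $k(\gamma^2-1)<1$, $M_{**}=+\infty$ otherwise. With $y=M_1-M_2$: $f_2(M_1,M_2)=\frac{2\gamma y^2-\gamma+1}{\gamma+1}$, $f_3(M_1,M_2)=\frac{(\gamma-1)y^2+2}{(\gamma+1)y^2}$, $f_4(M_1,M_2)=f_3+\frac{M_2}{M_1}(1-f_3)$, $f_5(M_1,M_2)=\frac{((\gamma-1)M_1+2M_2)y+2}{[2\gamma(\gamma-1)y^4+(6\gamma-\gamma^2-1)y^2-2(\gamma-1)]^{1/2}}$.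 $f_6(M_1,M_4)$ (for $0<M_4\le M_1$) is the unique $M_{SL}$ with $M_4=f_5(M_1,M_{SL})$ and $M_1-M_{SL}\ge1$. With $\beta=2/(\gamma-1)$, $\tau=(\gamma+1)/(\gamma-1)$ and $M_{SL}=f_6(M_1,M_4)$, $$X(M_1,M_4)=M_1\big(f_4(M_1,M_{SL})\phi(M_4)-1\big)-\sqrt{\tfrac{\beta}{\gamma}}\,\frac{f_2(M_1,M_{SL})\psi(M_4)-1}{\sqrt{1+\tau f_2(M_1,M_{SL})\psi(M_4)}},$$ and $Y(M_1)=X(M_1,M_* )$ (defined for $M_1\ge M_*$). *)

theory Defs
  imports "HOL-Analysis.Analysis"
begin

section \<open>Gas states\<close>

text \<open>A state is given by its primitive variables: density, velocity, pressure.\<close>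

type_synonym state = "real \<times> real \<times> real"

definition density :: "state \<Rightarrow> real" where
  "density s = fst s"

definition velocity :: "state \<Rightarrow> real" where
  "velocity s = fst (snd s)"

definition pressure :: "state \<Rightarrow> real" where
  "pressure s = snd (snd s)"

definition is_state :: "state \<Rightarrow> bool" where
  "is_state s \<longleftrightarrow> density s > 0 \<and> pressure s > 0"

definition internal_energy :: "real \<Rightarrow> state \<Rightarrow> real" where
  "internal_energy \<gamma> s = pressure s / ((\<gamma> - 1) * density s)"

definition total_energy :: "real \<Rightarrow> state \<Rightarrow> real" where
  "total_energy \<gamma> s = density s * internal_energy \<gamma> s + 1/2 * density s * (velocity s)\<^sup>2"

definition enthalpy :: "real \<Rightarrow> state \<Rightarrow> real" where
  "enthalpy \<gamma> s = \<gamma> * pressure s / ((\<gamma> - 1) * density s)"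

definition sound_speed :: "real \<Rightarrow> state \<Rightarrow> real" where
  "sound_speed \<gamma> s = sqrt (\<gamma> * pressure s / density s)"

definition mach :: "real \<Rightarrow> state \<Rightarrow> real" where
  "mach \<gamma> s = velocity s / sound_speed \<gamma> s"

text \<open>The thermodynamic entropy per unit mass, up to a positive factor and an additive constant.\<close>

definition specific_entropy :: "real \<Rightarrow> state \<Rightarrow> real" where
  "specific_entropy \<gamma> s = ln (pressure s / density s powr \<gamma>)"

definition conserved :: "real \<Rightarrow> state \<Rightarrow> real \<times> real \<times> real" where
  "conserved \<gamma> s = (density s, density s * velocity s, total_energy \<gamma> s)"

definition flux :: "real \<Rightarrow> state \<Rightarrow> real \<times> real \<times> real" where
  "flux \<gamma> s = (density s * velocity s,
               density s * (velocity s)\<^sup>2 + pressure s,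
               (total_energy \<gamma> s + pressure s) * velocity s)"


section \<open>The classical Riemann problem (CRP)\<close>

definition euler_classical_at :: "real \<Rightarrow> (real \<Rightarrow> real \<Rightarrow> state) \<Rightarrow> real \<Rightarrow> real \<Rightarrow> bool" where
  "euler_classical_at \<gamma> W x t \<longleftrightarrow>
     (\<exists>Ut Fx. ((\<lambda>\<tau>. conserved \<gamma> (W x \<tau>)) has_vector_derivative Ut) (at t) \<and>
              ((\<lambda>y. flux \<gamma> (W y t)) has_vector_derivative Fx) (at x) \<and>
              Ut + Fx = 0)"

text \<open>A jump of speed \<open>\<sigma>\<close> between \<open>L\<close> (on the left) and \<open>R\<close> (on the right): the Rankine-Hugoniot
  relations, and the jump form of the entropy inequality
  \<open>\<partial>\<^sub>t (\<rho> s) + \<partial>\<^sub>x (\<rho> u s) \<ge> 0\<close>. The trivial jump \<open>L = R\<close> is included, so that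
  the edges of rarefaction fans may be listed among the exceptional speeds below.\<close>

definition admissible_jump :: "real \<Rightarrow> real \<Rightarrow> state \<Rightarrow> state \<Rightarrow> bool" where
  "admissible_jump \<gamma> \<sigma> L R \<longleftrightarrow>
     flux \<gamma> R - flux \<gamma> L = \<sigma> *\<^sub>R (conserved \<gamma> R - conserved \<gamma> L) \<and>
     density R * velocity R * specific_entropy \<gamma> R
         - density L * velocity L * specific_entropy \<gamma> L
       \<ge> \<sigma> * (density R * specific_entropy \<gamma> R - density L * specific_entropy \<gamma> L)"

text \<open>\<open>V\<close>, a function of \<open>\<xi> = x / t\<close>, is a self-similar (piecewise smooth) entropy solution of the
  Riemann problem for the homogeneous Euler equations with left state \<open>UL\<close> and right state \<open>UR\<close>.
  The values of \<open>V\<close> at the finitely many exceptional speeds are irrelevant.\<close>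

definition crp_solution :: "real \<Rightarrow> state \<Rightarrow> state \<Rightarrow> (real \<Rightarrow> state) \<Rightarrow> bool" where
  "crp_solution \<gamma> UL UR V \<longleftrightarrow>
     (V \<longlongrightarrow> UL) at_bot \<and> (V \<longlongrightarrow> UR) at_top \<and>
     (\<exists>D. finite D \<and>
        (\<forall>\<xi>. \<xi> \<notin> D \<longrightarrow> is_state (V \<xi>)) \<and>
        V C1_differentiable_on (- D) \<and>
        (\<forall>x t. t > 0 \<longrightarrow> x / t \<notin> D \<longrightarrow> euler_classical_at \<gamma> (\<lambda>x t. V (x / t)) x t) \<and>
        (\<forall>\<sigma>\<in>D. \<exists>L R. is_state L \<and> is_state R \<and>
            (V \<longlongrightarrow> L) (at_left \<sigma>) \<and> (V \<longlongrightarrow> R) (at_right \<sigma>) \<and>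
            admissible_jump \<gamma> \<sigma> L R))"


section \<open>The double CRPs frame\<close>

text \<open>The relations across the heat source at \<open>x = 0\<close>, including the physical branch.\<close>

definition heating_jump :: "real \<Rightarrow> real \<Rightarrow> state \<Rightarrow> state \<Rightarrow> bool" where
  "heating_jump \<gamma> k Um Up \<longleftrightarrow>
     density Um * velocity Um = density Up * velocity Up \<and>
     density Um * (velocity Um)\<^sup>2 + pressure Um = density Up * (velocity Up)\<^sup>2 + pressure Up \<and>
     (1/2 * (velocity Um)\<^sup>2 + enthalpy \<gamma> Um) * (1 + k) = 1/2 * (velocity Up)\<^sup>2 + enthalpy \<gamma> Up \<and>
     (mach \<gamma> Um < 1 \<longrightarrow> mach \<gamma> Up \<le> 1) \<and>
     (mach \<gamma> Um > 1 \<longrightarrow> mach \<gamma> Up \<ge> 1)"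

text \<open>\<open>U x t\<close> is a solution with initial state \<open>U1\<close> and heating parameter \<open>k\<close>. That all waves of
  the left (right) classical Riemann problem have speed \<open>\<le> 0\<close> (\<open>\<ge> 0\<close>) is expressed by its solution
  being constant for \<open>\<xi> > 0\<close> (\<open>\<xi> < 0\<close>). The value of \<open>U\<close> on the line \<open>x = 0\<close>, \<open>t > 0\<close> is left open.\<close>

definition double_crp_solution ::
    "real \<Rightarrow> real \<Rightarrow> state \<Rightarrow> (real \<Rightarrow> real \<Rightarrow> state) \<Rightarrow> bool" where
  "double_crp_solution \<gamma> k U1 U \<longleftrightarrow>
     (\<forall>x. U x 0 = U1) \<and>
     (\<exists>Um Up. is_state Um \<and> is_state Up \<and> velocity Um \<noteq> 0 \<and> velocity Up \<noteq> 0 \<and>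
        (\<forall>t>0. ((\<lambda>x. U x t) \<longlongrightarrow> Um) (at_left 0) \<and> ((\<lambda>x. U x t) \<longlongrightarrow> Up) (at_right 0)) \<and>
        (\<exists>Q>0. k = Q / (density Um * velocity Um * (1/2 * (velocity Um)\<^sup>2 + enthalpy \<gamma> Um))) \<and>
        heating_jump \<gamma> k Um Up \<and>
        (\<exists>V. crp_solution \<gamma> U1 Um V \<and> (\<forall>\<xi>>0. V \<xi> = Um) \<and>
             (\<forall>t>0. \<forall>x<0. U x t = V (x / t))) \<and>
        (\<exists>V. crp_solution \<gamma> Up U1 V \<and> (\<forall>\<xi><0. V \<xi> = Up) \<and>
             (\<forall>t>0. \<forall>x>0. U x t = V (x / t))))"

text \<open>Any two solutions coincide; since point values on the discontinuities are not prescribed,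
  finitely many points are disregarded at each time.\<close>

definition unique_double_crp_solution :: "real \<Rightarrow> real \<Rightarrow> state \<Rightarrow> bool" where
  "unique_double_crp_solution \<gamma> k U1 \<longleftrightarrow>
     (\<forall>U W. double_crp_solution \<gamma> k U1 U \<longrightarrow> double_crp_solution \<gamma> k U1 W \<longrightarrow>
        (\<forall>t\<ge>0. finite {x. U x t \<noteq> W x t}))"


section \<open>The auxiliary functions\<close>

definition I_fun :: "real \<Rightarrow> real \<Rightarrow> real \<Rightarrow> real" where
  "I_fun \<gamma> k M = sqrt ((\<gamma> + 1 / M\<^sup>2)\<^sup>2 - 2 * (\<gamma> + 1) * (1 / M\<^sup>2 + (\<gamma> - 1) / 2) * (1 + k))"

definition phi_fun :: "real \<Rightarrow> real \<Rightarrow> real \<Rightarrow> real" where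
  "phi_fun \<gamma> k M = 1 / (\<gamma> + 1) * (\<gamma> + 1 / M\<^sup>2 - I_fun \<gamma> k M)"

definition psi_fun :: "real \<Rightarrow> real \<Rightarrow> real \<Rightarrow> real" where
  "psi_fun \<gamma> k M = M\<^sup>2 / (\<gamma> + 1) * (\<gamma> + 1 / M\<^sup>2 + \<gamma> * I_fun \<gamma> k M)"

definition M_star :: "real \<Rightarrow> real \<Rightarrow> real" where
  "M_star \<gamma> k =
     (if k * (\<gamma>\<^sup>2 - 1) \<noteq> 1
      then sqrt ((k * (\<gamma> + 1) + 1 - (\<gamma> + 1) * sqrt (k * (k + 1))) / (1 - k * (\<gamma>\<^sup>2 - 1)))
      else sqrt (1 / (2 * (k * (\<gamma> + 1) + 1))))"

definition M_star_star :: "real \<Rightarrow> real \<Rightarrow> ereal" where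
  "M_star_star \<gamma> k =
     (if k * (\<gamma>\<^sup>2 - 1) < 1
      then ereal (sqrt ((k * (\<gamma> + 1) + 1 + (\<gamma> + 1) * sqrt (k * (k + 1))) / (1 - k * (\<gamma>\<^sup>2 - 1))))
      else \<infinity>)"

definition f2 :: "real \<Rightarrow> real \<Rightarrow> real \<Rightarrow> real" where
  "f2 \<gamma> M1 M2 = (2 * \<gamma> * (M1 - M2)\<^sup>2 - \<gamma> + 1) / (\<gamma> + 1)"

definition f3 :: "real \<Rightarrow> real \<Rightarrow> real \<Rightarrow> real" where
  "f3 \<gamma> M1 M2 = ((\<gamma> - 1) * (M1 - M2)\<^sup>2 + 2) / ((\<gamma> + 1) * (M1 - M2)\<^sup>2)"

definition f4 :: "real \<Rightarrow> real \<Rightarrow> real \<Rightarrow> real" where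
  "f4 \<gamma> M1 M2 = f3 \<gamma> M1 M2 + M2 / M1 * (1 - f3 \<gamma> M1 M2)"

definition f5 :: "real \<Rightarrow> real \<Rightarrow> real \<Rightarrow> real" where
  "f5 \<gamma> M1 M2 =
     (((\<gamma> - 1) * M1 + 2 * M2) * (M1 - M2) + 2) /
     sqrt (2 * \<gamma> * (\<gamma> - 1) * (M1 - M2) ^ 4 + (6 * \<gamma> - \<gamma>\<^sup>2 - 1) * (M1 - M2)\<^sup>2 - 2 * (\<gamma> - 1))"

text \<open>Meaningful for \<open>0 < M4 \<le> M1\<close>.\<close>

definition f6 :: "real \<Rightarrow> real \<Rightarrow> real \<Rightarrow> real" where
  "f6 \<gamma> M1 M4 = (THE MSL. M4 = f5 \<gamma> M1 MSL \<and> M1 - MSL \<ge> 1)"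

definition X_fun :: "real \<Rightarrow> real \<Rightarrow> real \<Rightarrow> real \<Rightarrow> real" where
  "X_fun \<gamma> k M1 M4 =
     (let MSL = f6 \<gamma> M1 M4; \<beta> = 2 / (\<gamma> - 1); \<tau> = (\<gamma> + 1) / (\<gamma> - 1) in
      M1 * (f4 \<gamma> M1 MSL * phi_fun \<gamma> k M4 - 1) -
      sqrt (\<beta> / \<gamma>) * ((f2 \<gamma> M1 MSL * psi_fun \<gamma> k M4 - 1) /
                       sqrt (1 + \<tau> * f2 \<gamma> M1 MSL * psi_fun \<gamma> k M4)))"

text \<open>Meaningful for \<open>M1 \<ge> M_star \<gamma> k\<close>.\<close>

definition Y_fun :: "real \<Rightarrow> real \<Rightarrow> real \<Rightarrow> real" where
  "Y_fun \<gamma> k M1 = X_fun \<gamma> k M1 (M_star \<gamma> k)"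

end

theory Submission
  imports Defs
begin

text \<open>
  A solution consists of a left wave, the heat source, and the waves of a classical Riemann problem
  on the right, and everything rests on the monotonicity of the wave curves. Since \<open>u\<^sub>- > 0\<close>, contacts
  and waves of the third family of the left Riemann problem would move to the right, so in \<open>x < 0\<close>
  there is at most one wave of the first family (\<open>crp_left_half\<close>). Along the curve \<open>wave \<gamma> U1 y\<close>
  of such waves pressure and sound speed increase strictly and the velocity decreases strictly with
  the strength \<open>y\<close>; the waves of the third family are the mirror images.

  Let \<open>z = 1 / M\<^sub>-\<^sup>2\<close>. The velocity ratio \<open>q = u\<^sub>+ / u\<^sub>-\<close> across the source solves the quadratic equation
  \<open>heat_balance\<close>, whose discriminant is, up to a factor, \<open>(z - z\<^sub>*) (z - z\<^sub>*\<^sub>*)\<close> with \<open>z\<^sub>* = 1 / M\<^sub>*\<^sup>2 > 1\<close> and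
  \<open>z\<^sub>*\<^sub>* = 1 / M\<^sub>*\<^sub>*\<^sup>2 < 1\<close> (when \<open>z\<^sub>*\<^sub>* > 0\<close>). Hence \<open>M\<^sub>- \<le> M\<^sub>*\<close> or \<open>M\<^sub>- \<ge> M\<^sub>*\<^sub>*\<close>, and the physical branch
  selects one of the two roots.

  Two solutions with \<open>M\<^sub>- < 1\<close>: a stronger left wave gives a smaller \<open>M\<^sub>-\<close>, hence smaller \<open>q\<close> and
  smaller \<open>u\<^sub>+\<close> but larger \<open>p\<^sub>+\<close> (\<open>subsonic_ratio_strict_antimono\<close>). On the right only a rarefaction of
  the first family, and that only if \<open>M\<^sub>+ = 1\<close>, can precede the contact, and it moves the
  state further in the direction of larger velocity and smaller pressure. So the states at the
  contact would be ordered oppositely in \<open>u\<close> and \<open>p\<close>, whereas they lie on the one curve of waves of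
  the third family that end in \<open>U1\<close>, on which \<open>u\<close> increases with \<open>p\<close>
  (\<open>subsonic_left_waves_not_less\<close>).

  Solutions with \<open>M\<^sub>- > 1\<close> have no left wave, so \<open>U\<^sub>- = U1\<close>, \<open>U\<^sub>+\<close> is determined, and the right half is
  a classical Riemann problem, whose solution is unique (\<open>waves_meet_unique\<close>).

  Finally a solution of each kind might exist for the same data. Then \<open>M\<^sub>1 \<ge> M\<^sub>*\<^sub>*\<close>, which forces
  \<open>k (\<gamma>\<^sup>2 - 1) < 1\<close>. The subsonic solution contains a left shock with negative speed. A standing
  shock takes \<open>M\<^sub>*\<^sub>*\<close> to \<open>M\<^sub>*\<close>, so here \<open>M\<^sub>- < M\<^sub>*\<close>; comparison with the shock that produces exactly \<open>M\<^sub>*\<close> shows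
  \<open>Y M\<^sub>1 > 0\<close>. Since \<open>Y\<close> is continuous and nonpositive for some larger argument, it has a root beyond
  \<open>M\<^sub>1 \<ge> M\<^sub>*\<^sub>*\<close>, which the assumption on the roots of \<open>Y\<close> excludes
  (\<open>subsonic_supersonic_coexistence\<close>).

  The classical Riemann problem is analysed from the differential equation and the jump conditions:
  on each interval of smoothness a self-similar solution is constant or a single rarefaction fan
  (\<open>smooth_self_similar_cases\<close>), each jump is trivial, a contact, or a compressive shock
  (\<open>admissible_jump_cases\<close>), and an induction over the jumps from the left identifies all that
  happens to the left of the contact (\<open>left_structure\<close>). Reflection gives the right part.
\<close>

section \<open>Rarefactions and shocks of the first family\<close>

lemma state_eqI: "density s = density s' \<Longrightarrow> velocity s = velocity s' \<Longrightarrow> pressure s = pressure s' \<Longrightarrow> s = s'"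
  by (simp add: density_def velocity_def pressure_def prod_eq_iff)

text \<open>
  Reflection \<open>x \<mapsto> - x\<close> exchanges the first and the third wave family; everything about the third
  family below is obtained from the first one in this way.
\<close>

definition mirror :: "state \<Rightarrow> state" where
  "mirror s = (density s, - velocity s, pressure s)"

lemma mirror_simps [simp]:
  "density (mirror s) = density s" "velocity (mirror s) = - velocity s"
  "pressure (mirror s) = pressure s" "mirror (mirror s) = s"
  "is_state (mirror s) = is_state s" "sound_speed \<gamma> (mirror s) = sound_speed \<gamma> s"
  "specific_entropy \<gamma> (mirror s) = specific_entropy \<gamma> s"
  by (simp_all add: mirror_def density_def velocity_def pressure_def is_state_def
      sound_speed_def specific_entropy_def)

lemma mirror_eq_iff [simp]: "mirror s = mirror s' \<longleftrightarrow> s = s'"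
  by (metis mirror_simps(4))

abbreviation left_speed :: "real \<Rightarrow> state \<Rightarrow> real" where
  "left_speed \<gamma> s \<equiv> velocity s - sound_speed \<gamma> s"

text \<open>
  The state behind a wave of the first family that runs into \<open>S\<close>. For \<open>y \<le> 1\<close> it is a rarefaction,
  \<open>y\<close> being the ratio of the sound speeds behind and ahead; for \<open>y > 1\<close> it is a shock, \<open>y\<close> being the
  Mach number of \<open>S\<close> relative to the shock. With this choice both branches are explicit and fit
  together at \<open>y = 1\<close>. The functions \<open>f2\<close> and \<open>f3\<close>, which depend on the difference of their last
  two arguments only, are the pressure ratio and the inverse density ratio of the shock.
\<close>

definition wave :: "real \<Rightarrow> state \<Rightarrow> real \<Rightarrow> state" where
  "wave \<gamma> S y =
     (if y \<le> 1
      then (density S * y powr (2 / (\<gamma> - 1)),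
            velocity S + 2 * sound_speed \<gamma> S * (1 - y) / (\<gamma> - 1),
            pressure S * y powr (2 * \<gamma> / (\<gamma> - 1)))
      else (density S / f3 \<gamma> y 0,
            velocity S - sound_speed \<gamma> S * (2 / (\<gamma> + 1)) * (y - 1 / y),
            pressure S * f2 \<gamma> y 0))"

lemma density_wave: "density (wave \<gamma> S y) =
    (if y \<le> 1 then density S * y powr (2 / (\<gamma> - 1)) else density S / f3 \<gamma> y 0)"
  and velocity_wave: "velocity (wave \<gamma> S y) =
    (if y \<le> 1 then velocity S + 2 * sound_speed \<gamma> S * (1 - y) / (\<gamma> - 1)
     else velocity S - sound_speed \<gamma> S * (2 / (\<gamma> + 1)) * (y - 1 / y))"
  and pressure_wave: "pressure (wave \<gamma> S y) =
    (if y \<le> 1 then pressure S * y powr (2 * \<gamma> / (\<gamma> - 1)) else pressure S * f2 \<gamma> y 0)"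
  by (simp_all add: wave_def density_def velocity_def pressure_def)

text \<open>
  The parameter \<open>y\<close> of the state in a rarefaction fan of the first family, running into \<open>S\<close>, at the
  position \<open>\<xi> = u - a\<close>; it follows from this relation and the constancy of \<open>u + 2 a / (\<gamma> - 1)\<close>.
\<close>

definition fan_param :: "real \<Rightarrow> state \<Rightarrow> real \<Rightarrow> real" where
  "fan_param \<gamma> S \<xi> =
     (velocity S + 2 * sound_speed \<gamma> S / (\<gamma> - 1) - \<xi>) * (\<gamma> - 1) / ((\<gamma> + 1) * sound_speed \<gamma> S)"

text \<open>
  A rarefaction has \<open>y \<le> 1\<close>, and \<open>fan_param\<close> decreases in \<open>\<xi>\<close>; clamping it to \<open>[y, 1]\<close> yields the
  state \<open>S\<close> ahead of the fan and the final state behind it without case distinction.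
\<close>

definition wave_profile :: "real \<Rightarrow> state \<Rightarrow> real \<Rightarrow> real \<Rightarrow> state" where
  "wave_profile \<gamma> S y \<xi> =
     (if y \<le> 1 then wave \<gamma> S (max y (min 1 (fan_param \<gamma> S \<xi>)))
      else if \<xi> < velocity S - sound_speed \<gamma> S * y then S else wave \<gamma> S y)"

context
  fixes \<gamma> :: real
  assumes \<gamma>: "1 < \<gamma>"
begin

lemma sound_speed_pos: "is_state s \<Longrightarrow> 0 < sound_speed \<gamma> s"
  using \<gamma> by (simp add: sound_speed_def is_state_def)

lemma sound_speed_squared: "is_state s \<Longrightarrow> (sound_speed \<gamma> s)\<^sup>2 = \<gamma> * pressure s / density s"
  using \<gamma> by (simp add: sound_speed_def is_state_def)

lemma f2_strict_mono: "0 < x \<Longrightarrow> x < y \<Longrightarrow> f2 \<gamma> x 0 < f2 \<gamma> y 0"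
  using \<gamma> power_strict_mono[of x y 2] by (simp add: f2_def divide_strict_right_mono)

lemma f2_1 [simp]: "f2 \<gamma> 1 0 = 1" and f3_1 [simp]: "f3 \<gamma> 1 0 = 1"
  using \<gamma> by (simp_all add: f2_def f3_def field_simps)

lemma f2_gt_1: "1 < y \<Longrightarrow> 1 < f2 \<gamma> y 0"
  using f2_strict_mono[of 1 y] by simp

lemma f3_pos: "0 < y \<Longrightarrow> 0 < f3 \<gamma> y 0"
  using \<gamma> by (simp add: f3_def add_nonneg_pos)

text \<open>
  The ratio of the temperatures, and so of the squared sound speeds, across a shock. Written as a sum
  of terms monotone in \<open>y\<close>.
\<close>

lemma f2_f3: "0 < y \<Longrightarrow> f2 \<gamma> y 0 * f3 \<gamma> y 0 =
    (2 * \<gamma> * (\<gamma> - 1) * y\<^sup>2 + (6 * \<gamma> - \<gamma>\<^sup>2 - 1) - 2 * (\<gamma> - 1) / y\<^sup>2) / (\<gamma> + 1)\<^sup>2"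
  using \<gamma> by (simp add: f2_def f3_def divide_simps power2_eq_square) (simp add: algebra_simps)

lemma f2_f3_strict_mono: assumes "1 \<le> x" "x < y"
  shows "f2 \<gamma> x 0 * f3 \<gamma> x 0 < f2 \<gamma> y 0 * f3 \<gamma> y 0"
proof -
  have sq: "x\<^sup>2 < y\<^sup>2" "0 < x\<^sup>2" using assms by (simp_all add: power_strict_mono)
  have "1 / y\<^sup>2 < 1 / x\<^sup>2" using sq by (simp add: frac_less2)
  hence "2 * (\<gamma> - 1) * (1 / y\<^sup>2) < 2 * (\<gamma> - 1) * (1 / x\<^sup>2)" using \<gamma> by (intro mult_strict_left_mono) auto
  moreover have "2 * \<gamma> * (\<gamma> - 1) * x\<^sup>2 < 2 * \<gamma> * (\<gamma> - 1) * y\<^sup>2" using sq \<gamma> by simp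
  ultimately have "2 * \<gamma> * (\<gamma> - 1) * x\<^sup>2 + (6 * \<gamma> - \<gamma>\<^sup>2 - 1) - 2 * (\<gamma> - 1) / x\<^sup>2 <
     2 * \<gamma> * (\<gamma> - 1) * y\<^sup>2 + (6 * \<gamma> - \<gamma>\<^sup>2 - 1) - 2 * (\<gamma> - 1) / y\<^sup>2" by simp
  thus ?thesis using assms \<gamma> by (simp add: f2_f3 divide_strict_right_mono)
qed

lemma is_state_wave: assumes "is_state S" "0 < y" shows "is_state (wave \<gamma> S y)"
  using assms f3_pos[of y] f2_gt_1[of y]
  by (auto simp: is_state_def density_wave pressure_wave)

lemma wave_1 [simp]: "wave \<gamma> S 1 = S"
  by (rule state_eqI) (simp_all add: density_wave velocity_wave pressure_wave)

lemma sound_speed_wave: assumes "is_state S" "0 < y"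
  shows "sound_speed \<gamma> (wave \<gamma> S y) =
    sound_speed \<gamma> S * (if y \<le> 1 then y else sqrt (f2 \<gamma> y 0 * f3 \<gamma> y 0))"
proof (cases "y \<le> 1")
  case True
  have "2 * \<gamma> / (\<gamma> - 1) = 2 / (\<gamma> - 1) + 2" using \<gamma> by (simp add: field_simps)
  hence "y powr (2 * \<gamma> / (\<gamma> - 1)) = y powr (2 / (\<gamma> - 1)) * y\<^sup>2"
    using assms by (simp add: powr_add)
  moreover have "0 < y powr (2 / (\<gamma> - 1))" using assms by simp
  ultimately have "\<gamma> * pressure (wave \<gamma> S y) / density (wave \<gamma> S y) = \<gamma> * pressure S / density S * y\<^sup>2"
    using True by (simp add: density_wave pressure_wave)
  hence "sound_speed \<gamma> (wave \<gamma> S y) = sqrt (\<gamma> * pressure S / density S) * sqrt (y\<^sup>2)"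
    by (simp only: sound_speed_def real_sqrt_mult)
  thus ?thesis using True assms by (simp add: sound_speed_def)
next
  case False
  thus ?thesis using assms f3_pos[of y]
    by (simp add: sound_speed_def density_wave pressure_wave real_sqrt_mult[symmetric])
qed

text \<open>
  For functions given by one formula on rarefactions and another one on shocks.
\<close>

lemma strict_mono_glue:
  fixes f g :: "real \<Rightarrow> real"
  assumes "\<And>x y. 0 < x \<Longrightarrow> x < y \<Longrightarrow> y \<le> 1 \<Longrightarrow> f x < f y"
    and "\<And>x y. 1 \<le> x \<Longrightarrow> x < y \<Longrightarrow> g x < g y" and "f 1 = g 1" and "0 < x" and "x < y"
  shows "(if x \<le> 1 then f x else g x) < (if y \<le> 1 then f y else g y)"
proof -
  have "f x < g y" if "x \<le> 1" "1 < y"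
  proof (cases "x = 1")
    case False
    hence "f x < f 1" using that assms(4) by (intro assms(1)) auto
    also have "f 1 < g y" unfolding assms(3) using that by (intro assms(2)) auto
    finally show ?thesis .
  qed (use assms that in auto)
  thus ?thesis using assms by auto
qed

lemma pressure_wave_strict_mono:
  assumes "is_state S" "0 < x" "x < y"
  shows "pressure (wave \<gamma> S x) < pressure (wave \<gamma> S y)"
  unfolding pressure_wave
proof (rule strict_mono_glue)
  show "pressure S * x powr (2 * \<gamma> / (\<gamma> - 1)) < pressure S * y powr (2 * \<gamma> / (\<gamma> - 1))"
    if "0 < x" "x < y" for x y
    using that assms(1) \<gamma> by (simp add: is_state_def powr_less_mono2)
qed (use assms f2_strict_mono in \<open>auto simp: is_state_def\<close>)

lemma velocity_wave_strict_antimono: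
  assumes "is_state S" "0 < x" "x < y"
  shows "velocity (wave \<gamma> S y) < velocity (wave \<gamma> S x)"
proof -
  note a = sound_speed_pos[OF assms(1)]
  have "- velocity (wave \<gamma> S x) < - velocity (wave \<gamma> S y)"
    unfolding velocity_wave if_distrib[of uminus]
  proof (rule strict_mono_glue)
    show "- (velocity S + 2 * sound_speed \<gamma> S * (1 - x) / (\<gamma> - 1)) <
        - (velocity S + 2 * sound_speed \<gamma> S * (1 - y) / (\<gamma> - 1))" if "x < y" for x y
      using that a \<gamma> by (simp add: divide_strict_right_mono)
    show "- (velocity S - sound_speed \<gamma> S * (2 / (\<gamma> + 1)) * (x - 1 / x)) <
        - (velocity S - sound_speed \<gamma> S * (2 / (\<gamma> + 1)) * (y - 1 / y))" if "1 \<le> x" "x < y" for x y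
    proof -
      have "1 / y < 1 / x" using that by (simp add: frac_less2)
      hence "x - 1 / x < y - 1 / y" using that by simp
      hence "sound_speed \<gamma> S * (2 / (\<gamma> + 1)) * (x - 1 / x) < sound_speed \<gamma> S * (2 / (\<gamma> + 1)) * (y - 1 / y)"
        using a \<gamma> by (intro mult_strict_left_mono) auto
      thus ?thesis by linarith
    qed
  qed (use assms in auto)
  thus ?thesis by simp
qed

lemma sound_speed_wave_strict_mono:
  assumes "is_state S" "0 < x" "x < y"
  shows "sound_speed \<gamma> (wave \<gamma> S x) < sound_speed \<gamma> (wave \<gamma> S y)"
proof -
  have "(if x \<le> 1 then x else sqrt (f2 \<gamma> x 0 * f3 \<gamma> x 0)) <
      (if y \<le> 1 then y else sqrt (f2 \<gamma> y 0 * f3 \<gamma> y 0))"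
    by (rule strict_mono_glue[where f = "\<lambda>x. x"]) (use assms f2_f3_strict_mono in auto)
  thus ?thesis using assms sound_speed_pos[OF assms(1)] by (simp add: sound_speed_wave)
qed

lemma wave_inject:
  assumes "is_state S" "0 < x" "0 < y" "wave \<gamma> S x = wave \<gamma> S y" shows "x = y"
  using pressure_wave_strict_mono[OF assms(1), of x y] pressure_wave_strict_mono[OF assms(1), of y x] assms
  by (cases x y rule: linorder_cases) auto

text \<open>
  The velocity relative to the shock is reduced by the factor \<open>f3\<close>, by conservation of mass.
\<close>

lemma shock_velocity: assumes "0 < y"
  shows "y - 2 / (\<gamma> + 1) * (y - 1 / y) = y * f3 \<gamma> y 0"
  using assms \<gamma> by (simp add: f3_def divide_simps power2_eq_square) (simp add: algebra_simps)

text \<open>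
  The Lax inequalities, together with the fact that the gas behind the shock is faster than the shock:
  no further wave of the first family can follow a shock of that family.
\<close>

lemma shock_lax:
  assumes "is_state S" "1 < y"
  shows "left_speed \<gamma> (wave \<gamma> S y) < velocity S - sound_speed \<gamma> S * y"
    and "velocity S - sound_speed \<gamma> S * y < velocity (wave \<gamma> S y)"
    and "velocity S - sound_speed \<gamma> S * y < left_speed \<gamma> S"
proof -
  note a = sound_speed_pos[OF assms(1)]
  have eq: "velocity (wave \<gamma> S y) - (velocity S - sound_speed \<gamma> S * y) = sound_speed \<gamma> S * (y * f3 \<gamma> y 0)"
    using assms by (simp add: velocity_wave shock_velocity[symmetric]) (simp add: algebra_simps)
  show "velocity S - sound_speed \<gamma> S * y < velocity (wave \<gamma> S y)"
    using eq a assms f3_pos[of y] by (smt (verit) mult_pos_pos)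
  have "(y\<^sup>2) * f3 \<gamma> y 0 < f2 \<gamma> y 0"
  proof -
    have "1 < y\<^sup>2" using assms by (simp add: one_less_power)
    hence "0 < (\<gamma> + 1) * (y\<^sup>2 - 1)" using \<gamma> by simp
    hence "(\<gamma> - 1) * y\<^sup>2 + 2 < 2 * \<gamma> * y\<^sup>2 - \<gamma> + 1" by (simp add: algebra_simps)
    moreover have "y\<^sup>2 * f3 \<gamma> y 0 = ((\<gamma> - 1) * y\<^sup>2 + 2) / (\<gamma> + 1)"
      using assms by (simp add: f3_def)
    ultimately show ?thesis using \<gamma> by (simp add: f2_def divide_strict_right_mono)
  qed
  hence "y\<^sup>2 * f3 \<gamma> y 0 * f3 \<gamma> y 0 < f2 \<gamma> y 0 * f3 \<gamma> y 0" using f3_pos[of y] assms by simp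
  hence "(y * f3 \<gamma> y 0)\<^sup>2 < f2 \<gamma> y 0 * f3 \<gamma> y 0" by (simp add: power2_eq_square mult_ac)
  hence "y * f3 \<gamma> y 0 < sqrt (f2 \<gamma> y 0 * f3 \<gamma> y 0)" by (rule real_less_rsqrt)
  hence "sound_speed \<gamma> S * (y * f3 \<gamma> y 0) < sound_speed \<gamma> (wave \<gamma> S y)"
    using a assms by (simp add: sound_speed_wave)
  thus "left_speed \<gamma> (wave \<gamma> S y) < velocity S - sound_speed \<gamma> S * y"
    using eq by simp
  show "velocity S - sound_speed \<gamma> S * y < left_speed \<gamma> S"
    using a assms by simp
qed

text \<open>
  The two Riemann invariants \<open>u + 2 a / (\<gamma> - 1)\<close> and \<open>p / \<rho>\<^sup>\<gamma>\<close> together with the sound speed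
  determine a state.
\<close>

lemma isentropic_eq_wave:
  assumes S: "is_state S" "is_state T"
    and inv: "velocity T + 2 * sound_speed \<gamma> T / (\<gamma> - 1) = velocity S + 2 * sound_speed \<gamma> S / (\<gamma> - 1)"
    and ent: "pressure T / density T powr \<gamma> = pressure S / density S powr \<gamma>"
    and le: "sound_speed \<gamma> T \<le> sound_speed \<gamma> S"
  shows "T = wave \<gamma> S (sound_speed \<gamma> T / sound_speed \<gamma> S)"
proof (rule state_eqI)
  let ?y = "sound_speed \<gamma> T / sound_speed \<gamma> S"
  note a = sound_speed_pos[OF S(1)] sound_speed_pos[OF S(2)]
  have y: "0 < ?y" "?y \<le> 1" using a le by simp_all
  have pos: "0 < density S" "0 < density T" "0 < pressure S" "0 < pressure T"
    using S by (auto simp: is_state_def)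
  have "velocity S + 2 * sound_speed \<gamma> S * (1 - ?y) / (\<gamma> - 1) =
     velocity S + 2 * sound_speed \<gamma> S / (\<gamma> - 1) - 2 * sound_speed \<gamma> T / (\<gamma> - 1)"
  proof -
    have "sound_speed \<gamma> S * (1 - ?y) = sound_speed \<gamma> S - sound_speed \<gamma> T"
      using a by (simp add: field_simps)
    thus ?thesis using a by (simp add: diff_divide_distrib mult.assoc right_diff_distrib)
  qed
  thus "velocity T = velocity (wave \<gamma> S ?y)" using y inv by (simp add: velocity_wave)
  \<comment> \<open>Taking logarithms gives a linear system for the logarithms of density and pressure.\<close>
  have l1: "2 * ln ?y = (ln (pressure T) - ln (density T)) - (ln (pressure S) - ln (density S))"
  proof -
    have "?y\<^sup>2 = (pressure T / density T) / (pressure S / density S)"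
      using \<gamma> by (simp add: power_divide sound_speed_squared S)
    hence "ln (?y\<^sup>2) = ln ((pressure T / density T) / (pressure S / density S))" by simp
    thus ?thesis using pos y(1) by (simp add: ln_div ln_realpow ln_mult)
  qed
  have l2: "ln (pressure T) - \<gamma> * ln (density T) = ln (pressure S) - \<gamma> * ln (density S)"
    using arg_cong[OF ent, of ln] pos by (simp add: ln_div ln_powr)
  have "ln (density T) = ln (density S) + 2 / (\<gamma> - 1) * ln ?y"
    using l1 l2 \<gamma> by (simp add: field_simps)
  hence d: "ln (density T) = ln (density S * ?y powr (2 / (\<gamma> - 1)))"
    using pos y(1) a by (simp add: ln_mult ln_powr)
  thus "density T = density (wave \<gamma> S ?y)" using y pos a by (simp add: density_wave)
  have "ln (pressure T) = ln (pressure S) + 2 * \<gamma> / (\<gamma> - 1) * ln ?y"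
    using l1 l2 \<gamma> by (simp add: field_simps) algebra
  hence "ln (pressure T) = ln (pressure S * ?y powr (2 * \<gamma> / (\<gamma> - 1)))"
    using pos y(1) a by (simp add: ln_mult ln_powr)
  thus "pressure T = pressure (wave \<gamma> S ?y)" using y pos a by (simp add: pressure_wave)
qed

lemma fan_param_char_speed:
  assumes "is_state S" "0 < y" "y \<le> 1"
  shows "fan_param \<gamma> S (left_speed \<gamma> (wave \<gamma> S y)) = y"
  using assms sound_speed_pos[OF assms(1)] \<gamma>
  by (simp add: fan_param_def velocity_wave sound_speed_wave divide_simps) (simp add: algebra_simps)

lemma fan_param_less_iff [simp]:
  assumes "is_state S" shows "fan_param \<gamma> S \<xi> < fan_param \<gamma> S \<eta> \<longleftrightarrow> \<eta> < \<xi>"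
proof -
  have "0 < (\<gamma> + 1) * sound_speed \<gamma> S" using sound_speed_pos[OF assms] \<gamma> by simp
  thus ?thesis using \<gamma> by (auto simp add: fan_param_def divide_less_cancel)
qed

end

section \<open>Jump conditions\<close>

context
  fixes \<gamma> :: real
  assumes \<gamma>: "1 < \<gamma>"
begin

text \<open>
  The entropy jump as a function of \<open>Y = y\<^sup>2\<close> vanishes at \<open>Y = 1\<close> and has a derivative proportional to
  \<open>(Y - 1)\<^sup>2\<close>; so for \<open>y < 1\<close> the Rankine-Hugoniot relations describe an expansion shock, which
  loses entropy.
\<close>

lemma shock_entropy_neg:
  assumes y: "0 < y" "y < 1" and pos: "0 < f2 \<gamma> y 0"
  shows "ln (f2 \<gamma> y 0) + \<gamma> * ln (f3 \<gamma> y 0) < 0"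
proof -
  define A where "A = (\<lambda>Y. (2 * \<gamma> * Y - \<gamma> + 1) / (\<gamma> + 1))"
  define B where "B = (\<lambda>Y. ((\<gamma> - 1) * Y + 2) / ((\<gamma> + 1) * Y))"
  define h where "h = (\<lambda>Y. ln (A Y) + \<gamma> * ln (B Y))"
  define h' where "h' = (\<lambda>Y. 2 * \<gamma> * (\<gamma> - 1) * (Y - 1)\<^sup>2 / ((2 * \<gamma> * Y - \<gamma> + 1) * Y * ((\<gamma> - 1) * Y + 2)))"
  have y2: "0 < y\<^sup>2" "y\<^sup>2 < 1" using y by (simp_all add: power_less_one_iff)
  have num: "0 < 2 * \<gamma> * y\<^sup>2 - \<gamma> + 1" using pos \<gamma> by (simp add: f2_def zero_less_divide_iff)
  have der: "(h has_real_derivative h' Y) (at Y)" if "y\<^sup>2 \<le> Y" for Y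
  proof -
    have Y: "0 < Y" using that y2 by linarith
    have "2 * \<gamma> * y\<^sup>2 \<le> 2 * \<gamma> * Y" using that \<gamma> by simp
    hence n: "0 < 2 * \<gamma> * Y - \<gamma> + 1" using num by linarith
    have b: "0 < (\<gamma> - 1) * Y + 2" using Y \<gamma> by (simp add: add_nonneg_pos)
    have AB: "0 < A Y" "0 < B Y" using n b Y \<gamma> by (simp_all add: A_def B_def)
    have dA: "(A has_real_derivative 2 * \<gamma> / (\<gamma> + 1)) (at Y)"
      unfolding A_def using \<gamma> by (auto intro!: derivative_eq_intros)
    have dB: "(B has_real_derivative - 2 / ((\<gamma> + 1) * Y\<^sup>2)) (at Y)"
      unfolding B_def using \<gamma> Y
      by (auto intro!: derivative_eq_intros simp: divide_simps power2_eq_square) (simp add: algebra_simps)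
    have "(h has_real_derivative (2 * \<gamma> / (\<gamma> + 1)) / A Y + \<gamma> * ((- 2 / ((\<gamma> + 1) * Y\<^sup>2)) / B Y)) (at Y)"
      unfolding h_def using AB by (auto intro!: derivative_eq_intros dA dB simp: divide_inverse)
    also have "(2 * \<gamma> / (\<gamma> + 1)) / A Y = 2 * \<gamma> / (2 * \<gamma> * Y - \<gamma> + 1)"
      using \<gamma> by (simp add: A_def)
    also have "(- 2 / ((\<gamma> + 1) * Y\<^sup>2)) / B Y = - 2 / (Y * ((\<gamma> - 1) * Y + 2))"
      using \<gamma> Y by (simp add: B_def power2_eq_square)
    also have "2 * \<gamma> / (2 * \<gamma> * Y - \<gamma> + 1) + \<gamma> * (- 2 / (Y * ((\<gamma> - 1) * Y + 2))) = h' Y"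
    proof -
      have "2 * \<gamma> / N + \<gamma> * (- 2 / (Y * M)) = 2 * \<gamma> * (Y * M - N) / (N * Y * M)" if "N > 0" "M > 0" for N M
        using that Y by (simp add: field_simps)
      from this[OF n b] show ?thesis unfolding h'_def
        by (simp add: power2_eq_square algebra_simps)
    qed
    finally show ?thesis .
  qed
  obtain z where z: "y\<^sup>2 < z" "z < 1" "h 1 - h (y\<^sup>2) = (1 - y\<^sup>2) * h' z"
    using MVT2[of "y\<^sup>2" 1 h h'] y2 der by (metis less_eq_real_def)
  have "2 * \<gamma> * y\<^sup>2 \<le> 2 * \<gamma> * z" using z \<gamma> by simp
  hence "0 < 2 * \<gamma> * z - \<gamma> + 1" using num by linarith
  moreover have "0 < z" using z y2 by linarith
  moreover from this have "0 < (\<gamma> - 1) * z + 2" using \<gamma> by (simp add: add_nonneg_pos)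
  ultimately
  have "0 < h' z" unfolding h'_def using z \<gamma> by (auto intro!: divide_pos_pos mult_pos_pos)
  hence "h (y\<^sup>2) < h 1" using z y2 by (smt (verit) mult_pos_pos)
  moreover have "h 1 = 0" using \<gamma> by (simp add: h_def A_def B_def add.commute)
  ultimately show ?thesis by (simp add: h_def A_def B_def f2_def f3_def)
qed

lemma admissible_jumpD:
  assumes "admissible_jump \<gamma> \<sigma> L R"
  shows "density R * (velocity R - \<sigma>) = density L * (velocity L - \<sigma>)"
    and "density R * velocity R * (velocity R - \<sigma>) + pressure R = density L * velocity L * (velocity L - \<sigma>) + pressure L"
    and "total_energy \<gamma> R * (velocity R - \<sigma>) + pressure R * velocity R = total_energy \<gamma> L * (velocity L - \<sigma>) + pressure L * velocity L"
    and "density L * (velocity L - \<sigma>) * specific_entropy \<gamma> L \<le> density R * (velocity R - \<sigma>) * specific_entropy \<gamma> R"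
  using assms unfolding admissible_jump_def flux_def conserved_def
  by (simp_all add: power2_eq_square algebra_simps)

lemma total_energy_eq: "is_state s \<Longrightarrow> total_energy \<gamma> s = pressure s / (\<gamma> - 1) + 1/2 * density s * (velocity s)\<^sup>2"
  by (simp add: total_energy_def internal_energy_def is_state_def)

lemma specific_entropy_eq: "is_state s \<Longrightarrow> specific_entropy \<gamma> s = ln (pressure s) - \<gamma> * ln (density s)"
  by (simp add: specific_entropy_def is_state_def ln_div ln_powr)

text \<open>
  If gas crosses the jump from left to right, the Rankine-Hugoniot relations in the frame of the jump,
  written in \<open>r = (u\<^sub>R - \<sigma>) / (u\<^sub>L - \<sigma>)\<close> and the relative Mach number \<open>y\<close> of \<open>L\<close>, contain the factor
  \<open>1 - r\<close> (no jump); the cofactor gives \<open>r = f3\<close>. The entropy condition then leaves only \<open>y \<ge> 1\<close>.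
\<close>

lemma admissible_jump_forward:
  assumes S: "is_state L" "is_state R" and jump: "admissible_jump \<gamma> \<sigma> L R" and "\<sigma> < velocity L"
  shows "R = L \<or> (\<exists>y>1. \<sigma> = velocity L - sound_speed \<gamma> L * y \<and> R = wave \<gamma> L y)"
proof -
  note D = admissible_jumpD[OF jump]
  define w v where "w = velocity L - \<sigma>" and "v = velocity R - \<sigma>"
  define r y where "r = v / w" and "y = w / sound_speed \<gamma> L"
  note a = sound_speed_pos[OF \<gamma> S(1)]
  have pos: "0 < density L" "0 < density R" "0 < pressure L" "0 < pressure R"
    using S by (auto simp: is_state_def)
  have w: "0 < w" using assms by (simp add: w_def)
  have mass: "density R * v = density L * w" using D(1) by (simp add: w_def v_def)
  hence v: "0 < v" using w pos by (metis zero_less_mult_pos mult_pos_pos)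
  have r: "0 < r" "v = r * w" and y: "0 < y" "w = y * sound_speed \<gamma> L"
    using w v a by (simp_all add: r_def y_def)
  have dR: "density R = density L / r"
    using mass r w by (simp add: field_simps)
  have u: "velocity L = w + \<sigma>" "velocity R = v + \<sigma>" by (simp_all add: w_def v_def)
  have mom: "pressure R = pressure L + density L * w * (w - v)"
    using D(2) mass unfolding u by (simp add: algebra_simps)
  have gy: "density L * w\<^sup>2 = \<gamma> * y\<^sup>2 * pressure L"
    using pos by (simp add: y(2) power_mult_distrib sound_speed_squared[OF \<gamma> S(1)])
  have pR: "pressure R = pressure L * (1 + \<gamma> * y\<^sup>2 * (1 - r))"
    using mom gy unfolding r(2) by algebra
  have g1: "\<gamma> - 1 \<noteq> 0" using \<gamma> by simp
  have "(\<gamma> - 1) * total_energy \<gamma> R = pressure R + (\<gamma> - 1) / 2 * density R * (velocity R)\<^sup>2"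
    "(\<gamma> - 1) * total_energy \<gamma> L = pressure L + (\<gamma> - 1) / 2 * density L * (velocity L)\<^sup>2"
    using g1 by (simp_all add: total_energy_eq S distrib_left)
  hence "(pressure R + (\<gamma> - 1) / 2 * density R * (velocity R)\<^sup>2) * v + (\<gamma> - 1) * pressure R * velocity R
     = (pressure L + (\<gamma> - 1) / 2 * density L * (velocity L)\<^sup>2) * w + (\<gamma> - 1) * pressure L * velocity L"
    using arg_cong[OF D(3), of "\<lambda>t. (\<gamma> - 1) * t"] unfolding w_def[symmetric] v_def[symmetric]
    by algebra
  hence "\<gamma> * pressure R * v + (\<gamma> - 1) / 2 * (density R * v) * v\<^sup>2
      = \<gamma> * pressure L * w + (\<gamma> - 1) / 2 * (density L * w) * w\<^sup>2"
    using mass mom unfolding u by algebra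
  hence "w * (\<gamma> * pressure R * r + (\<gamma> - 1) / 2 * (density L * w\<^sup>2) * r\<^sup>2)
      = w * (\<gamma> * pressure L + (\<gamma> - 1) / 2 * (density L * w\<^sup>2))"
    unfolding mass unfolding r(2) by algebra
  hence "\<gamma> * pressure R * r + (\<gamma> - 1) / 2 * (density L * w\<^sup>2) * r\<^sup>2
      = \<gamma> * pressure L + (\<gamma> - 1) / 2 * (density L * w\<^sup>2)" using w by simp
  hence eq: "\<gamma> * (pressure L * (1 + \<gamma> * y\<^sup>2 * (1 - r))) * r + (\<gamma> - 1) / 2 * (\<gamma> * y\<^sup>2 * pressure L) * r\<^sup>2
      = \<gamma> * pressure L + (\<gamma> - 1) / 2 * (\<gamma> * y\<^sup>2 * pressure L)"
    unfolding gy pR .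
  have key: "(\<gamma> * P) * (1 - r) * (2 * \<gamma> * Y * r - 2 - (\<gamma> - 1) * Y * (1 + r)) =
      2 * ((\<gamma> * (P * (1 + \<gamma> * Y * (1 - r))) * r + (\<gamma> - 1) / 2 * (\<gamma> * Y * P) * r\<^sup>2)
      - (\<gamma> * P + (\<gamma> - 1) / 2 * (\<gamma> * Y * P)))" for P Y
    by (simp add: field_simps power2_eq_square)
  have "(\<gamma> * pressure L) * (1 - r) * (2 * \<gamma> * y\<^sup>2 * r - 2 - (\<gamma> - 1) * y\<^sup>2 * (1 + r)) = 0"
    unfolding key eq by simp
  hence "r = 1 \<or> 2 * \<gamma> * y\<^sup>2 * r - 2 - (\<gamma> - 1) * y\<^sup>2 * (1 + r) = 0"
    using pos \<gamma> by simp
  thus ?thesis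
  proof
    assume "r = 1"
    hence "R = L" using dR pR r(2) u by (intro state_eqI) simp_all
    thus ?thesis ..
  next
    assume "2 * \<gamma> * y\<^sup>2 * r - 2 - (\<gamma> - 1) * y\<^sup>2 * (1 + r) = 0"
    hence "r * ((\<gamma> + 1) * y\<^sup>2) = (\<gamma> - 1) * y\<^sup>2 + 2" by (simp add: algebra_simps)
    moreover have ne: "(\<gamma> + 1) * y\<^sup>2 \<noteq> 0" using y \<gamma> by simp
    ultimately have r3: "r = f3 \<gamma> y 0" by (simp add: f3_def eq_divide_eq)
    have "1 + \<gamma> * y\<^sup>2 * (1 - r) = f2 \<gamma> y 0"
      unfolding r3 f2_def f3_def using ne y \<gamma> by (simp add: field_simps)
    hence p2: "pressure R = pressure L * f2 \<gamma> y 0" using pR by simp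
    have f2: "0 < f2 \<gamma> y 0" using p2 pos by (simp add: zero_less_mult_iff)
    have "specific_entropy \<gamma> L \<le> specific_entropy \<gamma> R"
      using D(4) w pos unfolding w_def[symmetric] v_def[symmetric] mass by simp
    hence "ln (pressure L) - \<gamma> * ln (density L) \<le> ln (pressure L * f2 \<gamma> y 0) - \<gamma> * ln (density L / r)"
      unfolding specific_entropy_eq[OF S(1)] specific_entropy_eq[OF S(2)] p2 dR .
    hence "0 \<le> ln (f2 \<gamma> y 0) + \<gamma> * ln (f3 \<gamma> y 0)"
      using pos f2 r(1) by (simp add: ln_mult ln_div r3 algebra_simps)
    hence "1 \<le> y" using shock_entropy_neg[of y] y f2 by fastforce
    show ?thesis
    proof (cases "y = 1")
      case True
      hence "R = L" using dR p2 r u r3 f3_1[OF \<gamma>] f2_1[OF \<gamma>] by (intro state_eqI) simp_all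
      thus ?thesis ..
    next
      case False
      hence "1 < y" using \<open>1 \<le> y\<close> by simp
      have vel: "velocity R = velocity L - sound_speed \<gamma> L * (2 / (\<gamma> + 1)) * (y - 1 / y)"
      proof -
        have "velocity R = velocity L - w + r * w" using u r(2) by simp
        also have "\<dots> = velocity L - sound_speed \<gamma> L * (y - y * f3 \<gamma> y 0)"
          unfolding r3 y(2) by (simp add: algebra_simps)
        also have "y - y * f3 \<gamma> y 0 = 2 / (\<gamma> + 1) * (y - 1 / y)"
          using shock_velocity[OF \<gamma> y(1)] by simp
        finally show ?thesis by (simp add: mult.assoc)
      qed
      have "R = wave \<gamma> L y"
        using \<open>1 < y\<close> vel p2 dR r3
        by (intro state_eqI) (simp_all add: density_wave velocity_wave pressure_wave)
      moreover have "\<sigma> = velocity L - sound_speed \<gamma> L * y" using y(2) u by (simp add: mult.commute)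
      ultimately show ?thesis using \<open>1 < y\<close> by blast
    qed
  qed
qed

lemma admissible_jump_mirror:
  assumes "admissible_jump \<gamma> \<sigma> L R"
  shows "admissible_jump \<gamma> (- \<sigma>) (mirror R) (mirror L)"
proof -
  have "total_energy \<gamma> (mirror s) = total_energy \<gamma> s" for s
    by (simp add: total_energy_def internal_energy_def)
  thus ?thesis using assms unfolding admissible_jump_def flux_def conserved_def
    by (simp add: algebra_simps)
qed

lemma admissible_jump_cases:
  assumes S: "is_state L" "is_state R" and jump: "admissible_jump \<gamma> \<sigma> L R"
  obtains (trivial) "R = L"
    | (contact) "velocity L = \<sigma>" "velocity R = \<sigma>" "pressure R = pressure L"
    | (left) y where "1 < y" "\<sigma> = velocity L - sound_speed \<gamma> L * y" "R = wave \<gamma> L y"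
    | (right) y where "1 < y" "- \<sigma> = velocity (mirror R) - sound_speed \<gamma> (mirror R) * y"
        "mirror L = wave \<gamma> (mirror R) y"
proof (cases "velocity L" \<sigma> rule: linorder_cases)
  case greater
  thus ?thesis using admissible_jump_forward[OF S jump] trivial left by blast
next
  case equal
  note D = admissible_jumpD[OF jump]
  have "velocity R = \<sigma>" using D(1) S(2) equal by (simp add: is_state_def)
  thus ?thesis using contact equal D(2) by simp
next
  case less
  have m: "density R * (velocity R - \<sigma>) = density L * (velocity L - \<sigma>)" using admissible_jumpD(1)[OF jump] .
  also have "\<dots> < 0" using less S(1) by (simp add: is_state_def mult_pos_neg)
  finally have "velocity R < \<sigma>" using S(2) by (simp add: is_state_def mult_less_0_iff)
  hence "mirror L = mirror R \<or> (\<exists>y>1. - \<sigma> = velocity (mirror R) - sound_speed \<gamma> (mirror R) * y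
      \<and> mirror L = wave \<gamma> (mirror R) y)"
    by (intro admissible_jump_forward admissible_jump_mirror jump) (simp_all add: S)
  thus ?thesis using trivial right by auto
qed

end

section \<open>Smooth parts of self-similar solutions\<close>

text \<open>
  A rarefaction of the first family, characterised by the position and the Riemann invariants. Equality
  of invariants is transitive, which makes it easy to continue a fan across a trivial jump.
\<close>

definition fan_on :: "real \<Rightarrow> (real \<Rightarrow> state) \<Rightarrow> real set \<Rightarrow> bool" where
  "fan_on \<gamma> V J \<longleftrightarrow> (\<exists>c d. \<forall>\<xi>\<in>J.
     left_speed \<gamma> (V \<xi>) = \<xi> \<and>
     velocity (V \<xi>) + 2 * sound_speed \<gamma> (V \<xi>) / (\<gamma> - 1) = c \<and>
     pressure (V \<xi>) / density (V \<xi>) powr \<gamma> = d)"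

text \<open>
  What remains of \<open>crp_solution\<close> after the analysis of the smooth parts. The notion is invariant under
  reflection: the third alternative is a fan of the reflected function.
\<close>

definition wave_pattern :: "real \<Rightarrow> real set \<Rightarrow> (real \<Rightarrow> state) \<Rightarrow> bool" where
  "wave_pattern \<gamma> D V \<longleftrightarrow> finite D \<and> (\<forall>\<xi>. \<xi> \<notin> D \<longrightarrow> is_state (V \<xi>) \<and> isCont V \<xi>) \<and>
     (\<forall>J. open J \<longrightarrow> connected J \<longrightarrow> J \<inter> D = {} \<longrightarrow>
        V constant_on J \<or> fan_on \<gamma> V J \<or>
        fan_on \<gamma> (\<lambda>\<xi>. mirror (V (- \<xi>))) (uminus ` J)) \<and>
     (\<forall>\<sigma>\<in>D. \<exists>L R. is_state L \<and> is_state R \<and>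
        (V \<longlongrightarrow> L) (at_left \<sigma>) \<and> (V \<longlongrightarrow> R) (at_right \<sigma>) \<and> admissible_jump \<gamma> \<sigma> L R)"

lemma has_vector_derivative_components:
  fixes f :: "real \<Rightarrow> real \<times> real \<times> real"
  assumes "(f has_vector_derivative d) F"
  shows "((\<lambda>x. fst (f x)) has_vector_derivative fst d) F"
    and "((\<lambda>x. fst (snd (f x))) has_vector_derivative fst (snd d)) F"
    and "((\<lambda>x. snd (snd (f x))) has_vector_derivative snd (snd d)) F"
proof -
  show "((\<lambda>x. fst (f x)) has_vector_derivative fst d) F"
    by (rule bounded_linear.has_vector_derivative[OF bounded_linear_fst assms])
  note s = bounded_linear.has_vector_derivative[OF bounded_linear_snd assms]
  show "((\<lambda>x. fst (snd (f x))) has_vector_derivative fst (snd d)) F"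
    by (rule bounded_linear.has_vector_derivative[OF bounded_linear_fst s])
  show "((\<lambda>x. snd (snd (f x))) has_vector_derivative snd (snd d)) F"
    by (rule bounded_linear.has_vector_derivative[OF bounded_linear_snd s])
qed

context
  fixes \<gamma> :: real
  assumes \<gamma>: "1 < \<gamma>"
begin

text \<open>
  The Euler equations in primitive form for functions of \<open>\<xi> = x / t\<close>, derived at \<open>t = 1\<close>, where the
  time derivative at \<open>x = \<xi>\<close> is \<open>- \<xi>\<close> times the space derivative.
\<close>

lemma self_similar_euler:
  assumes V: "is_state (V \<xi>)" and E: "euler_classical_at \<gamma> (\<lambda>x t. V (x / t)) \<xi> 1"
    and dr: "((\<lambda>y. density (V y)) has_real_derivative r') (at \<xi>)"
    and du: "((\<lambda>y. velocity (V y)) has_real_derivative u') (at \<xi>)"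
    and dp: "((\<lambda>y. pressure (V y)) has_real_derivative p') (at \<xi>)"
  shows "(velocity (V \<xi>) - \<xi>) * r' + density (V \<xi>) * u' = 0"
    and "density (V \<xi>) * (velocity (V \<xi>) - \<xi>) * u' + p' = 0"
    and "(velocity (V \<xi>) - \<xi>) * p' + \<gamma> * pressure (V \<xi>) * u' = 0"
proof -
  let ?r = "density (V \<xi>)" and ?u = "velocity (V \<xi>)" and ?p = "pressure (V \<xi>)"
  let ?e = "total_energy \<gamma> (V \<xi>)"
  define e' where "e' = p' / (\<gamma> - 1) + 1/2 * r' * ?u\<^sup>2 + ?r * ?u * u'"
  have r0: "?r \<noteq> 0" "\<gamma> - 1 \<noteq> 0" using V \<gamma> by (auto simp: is_state_def)
  have e: "?e = ?p / (\<gamma> - 1) + 1/2 * ?r * ?u\<^sup>2" using total_energy_eq[OF \<gamma> V] .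
  have de: "((\<lambda>y. total_energy \<gamma> (V y)) has_real_derivative e') (at \<xi>)"
    unfolding total_energy_def internal_energy_def
  proof (rule DERIV_cong)
    have nz: "(\<gamma> - 1) * ?r \<noteq> 0" using r0 by simp
    show "((\<lambda>y. density (V y) * (pressure (V y) / ((\<gamma> - 1) * density (V y))) +
        1 / 2 * density (V y) * (velocity (V y))\<^sup>2) has_real_derivative
        (r' * (?p / ((\<gamma> - 1) * ?r)) +
          (p' * ((\<gamma> - 1) * ?r) - ?p * ((\<gamma> - 1) * r')) / ((\<gamma> - 1) * ?r * ((\<gamma> - 1) * ?r)) * ?r) +
        (1/2 * r' * ?u\<^sup>2 + 2 * (u' * ?u) * (1 / 2 * ?r))) (at \<xi>)"
      using DERIV_add[OF DERIV_mult[OF dr DERIV_divide[OF dp DERIV_cmult[OF dr, of "\<gamma> - 1"] nz]]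
        DERIV_mult[OF DERIV_cmult[OF dr, of "1/2"] DERIV_power[OF du, of 2]]] by simp
  next
    have "?p / ((\<gamma> - 1) * ?r) * r' + (p' * ((\<gamma> - 1) * ?r) - ?p * ((\<gamma> - 1) * r')) / ((\<gamma> - 1) * ?r * ((\<gamma> - 1) * ?r)) * ?r
        = p' / (\<gamma> - 1)"
    proof -
      have "P / (g * r) * r' + (p' * (g * r) - P * (g * r')) / (g * r * (g * r)) * r = p' / g"
        if "g \<noteq> 0" "r \<noteq> 0" for g r P
        using that by (simp add: field_simps)
      from this[OF r0(2,1)] show ?thesis .
    qed
    thus "(r' * (?p / ((\<gamma> - 1) * ?r)) +
          (p' * ((\<gamma> - 1) * ?r) - ?p * ((\<gamma> - 1) * r')) / ((\<gamma> - 1) * ?r * ((\<gamma> - 1) * ?r)) * ?r) +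
        (1/2 * r' * ?u\<^sup>2 + 2 * (u' * ?u) * (1 / 2 * ?r)) = e'"
      unfolding e'_def by (simp add: mult_ac)
  qed
  have dru: "((\<lambda>y. density (V y) * velocity (V y)) has_real_derivative r' * ?u + ?r * u') (at \<xi>)"
    by (auto intro!: derivative_eq_intros dr du)
  from E obtain Ut Fx where
    U: "((\<lambda>t. conserved \<gamma> (V (\<xi> / t))) has_vector_derivative Ut) (at 1)" and
    F: "((\<lambda>y. flux \<gamma> (V y)) has_vector_derivative Fx) (at \<xi>)" and 0: "Ut + Fx = 0"
    unfolding euler_classical_at_def by auto
  have chain: "((\<lambda>t. f (\<xi> / t)) has_real_derivative - \<xi> * f') (at 1)"
    if "(f has_real_derivative f') (at \<xi>)" for f f'
  proof -
    have "((\<lambda>t. \<xi> / t) has_real_derivative - \<xi>) (at 1)"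
      by (auto intro!: derivative_eq_intros)
    moreover have "(f has_real_derivative f') (at (\<xi> / 1))" using that by simp
    ultimately show ?thesis using DERIV_chain2[of f f' "\<lambda>t. \<xi> / t" 1 "- \<xi>" UNIV] by (simp add: mult.commute)
  qed
  note Uc = has_vector_derivative_components[OF U, folded has_real_derivative_iff_has_vector_derivative,
      unfolded conserved_def fst_conv snd_conv]
  note Fc = has_vector_derivative_components[OF F, folded has_real_derivative_iff_has_vector_derivative,
      unfolded flux_def fst_conv snd_conv]
  have U1: "fst Ut = - \<xi> * r'" using DERIV_unique[OF Uc(1) chain[OF dr]] .
  have U2: "fst (snd Ut) = - \<xi> * (r' * ?u + ?r * u')" using DERIV_unique[OF Uc(2) chain[OF dru]] .
  have U3: "snd (snd Ut) = - \<xi> * e'" using DERIV_unique[OF Uc(3) chain[OF de]] .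
  have F1: "fst Fx = r' * ?u + ?r * u'" using DERIV_unique[OF Fc(1) dru] .
  have F2: "fst (snd Fx) = r' * ?u\<^sup>2 + 2 * ?r * ?u * u' + p'"
    by (rule DERIV_unique[OF Fc(2)]) (auto intro!: derivative_eq_intros dr du dp simp: power2_eq_square)
  have F3: "snd (snd Fx) = (e' + p') * ?u + (?e + ?p) * u'"
    by (rule DERIV_unique[OF Fc(3)]) (auto intro!: derivative_eq_intros de du dp)
  have s: "fst Ut + fst Fx = 0" "fst (snd Ut) + fst (snd Fx) = 0" "snd (snd Ut) + snd (snd Fx) = 0"
    using 0 by (simp_all flip: fst_add snd_add)
  show mass: "(?u - \<xi>) * r' + ?r * u' = 0" using s(1) U1 F1 by (simp add: algebra_simps)
  show mom: "?r * (?u - \<xi>) * u' + p' = 0"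
    using s(2) mass unfolding U2 F2 by algebra
  have e1: "(\<gamma> - 1) * e' = p' + (\<gamma> - 1) * (1/2 * r' * ?u\<^sup>2 + ?r * ?u * u')"
    using r0 by (simp add: e'_def distrib_left)
  have e2: "(\<gamma> - 1) * ?e = ?p + (\<gamma> - 1) * (1/2 * ?r * ?u\<^sup>2)"
    using r0 unfolding e by (simp add: distrib_left)
  have "(\<gamma> - 1) * (- \<xi> * e') + (\<gamma> - 1) * ((e' + p') * ?u + (?e + ?p) * u') = 0"
    using s(3) unfolding U3 F3 by algebra
  hence "(p' + (\<gamma> - 1) * (1/2 * r' * ?u\<^sup>2 + ?r * ?u * u')) * (?u - \<xi>) + (\<gamma> - 1) * p' * ?u
    + (\<gamma> * ?p + (\<gamma> - 1) * (1/2 * ?r * ?u\<^sup>2)) * u' = 0"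
    using e1 e2 by algebra
  thus "(?u - \<xi>) * p' + \<gamma> * ?p * u' = 0" using mass mom by algebra
qed

text \<open>
  Where \<open>u' \<noteq> 0\<close> the equations force \<open>(u - \<xi>)\<^sup>2 = a\<^sup>2\<close>, and differentiating this relation gives
  \<open>u' = 2 / (\<gamma> + 1)\<close>. So the continuous function \<open>u'\<close> takes at most two values and is constant
  on an interval: the interval carries either no wave or one complete fan.
\<close>

lemma smooth_self_similar_cases:
  assumes J: "open J" "connected J" and V: "\<And>\<xi>. \<xi> \<in> J \<Longrightarrow> is_state (V \<xi>)"
    and E: "\<And>\<xi>. \<xi> \<in> J \<Longrightarrow> euler_classical_at \<gamma> (\<lambda>x t. V (x / t)) \<xi> 1"
    and C: "V C1_differentiable_on J"
  shows "V constant_on J \<or> fan_on \<gamma> V J \<or> fan_on \<gamma> (\<lambda>\<xi>. mirror (V (- \<xi>))) (uminus ` J)"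
proof -
  obtain V' where V': "\<And>\<xi>. \<xi> \<in> J \<Longrightarrow> (V has_vector_derivative V' \<xi>) (at \<xi>)" "continuous_on J V'"
    using C unfolding C1_differentiable_on_def by blast
  define r u p w where "r = (\<lambda>\<xi>. density (V \<xi>))" and "u = (\<lambda>\<xi>. velocity (V \<xi>))"
    and "p = (\<lambda>\<xi>. pressure (V \<xi>))" and "w = (\<lambda>\<xi>. u \<xi> - \<xi>)"
  define r' u' p' where "r' = (\<lambda>\<xi>. fst (V' \<xi>))" and "u' = (\<lambda>\<xi>. fst (snd (V' \<xi>)))"
    and "p' = (\<lambda>\<xi>. snd (snd (V' \<xi>)))"
  have d: "(r has_real_derivative r' \<xi>) (at \<xi>)" "(u has_real_derivative u' \<xi>) (at \<xi>)"
    "(p has_real_derivative p' \<xi>) (at \<xi>)" if "\<xi> \<in> J" for \<xi>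
    using has_vector_derivative_components[OF V'(1)[OF that]]
    unfolding r_def u_def p_def r'_def u'_def p'_def density_def velocity_def pressure_def
      has_real_derivative_iff_has_vector_derivative by auto
  have dw: "(w has_real_derivative u' \<xi> - 1) (at \<xi>)" if "\<xi> \<in> J" for \<xi>
    unfolding w_def using d[OF that] by (auto intro!: derivative_eq_intros)
  have pos: "0 < r \<xi>" "0 < p \<xi>" if "\<xi> \<in> J" for \<xi>
    using V[OF that] by (simp_all add: r_def p_def is_state_def)
  have ode: "w \<xi> * r' \<xi> + r \<xi> * u' \<xi> = 0" "r \<xi> * w \<xi> * u' \<xi> + p' \<xi> = 0"
    "w \<xi> * p' \<xi> + \<gamma> * p \<xi> * u' \<xi> = 0" if "\<xi> \<in> J" for \<xi>
    using self_similar_euler[OF V[OF that] E[OF that], folded r_def u_def p_def, OF d[OF that]]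
    by (simp_all add: w_def r_def u_def p_def)
  have char: "(w \<xi>)\<^sup>2 * r \<xi> = \<gamma> * p \<xi>" if "\<xi> \<in> J" "u' \<xi> \<noteq> 0" for \<xi>
  proof -
    have "u' \<xi> * ((w \<xi>)\<^sup>2 * r \<xi> - \<gamma> * p \<xi>) = 0" using ode[OF that(1)] by algebra
    thus ?thesis using that by simp
  qed
  have cont: "continuous_on J r" "continuous_on J u" "continuous_on J p" "continuous_on J w"
    using d dw by (meson DERIV_isCont continuous_at_imp_continuous_on)+
  have cu': "continuous_on J u'" unfolding u'_def using V'(2) by (intro continuous_intros)
  have slope: "u' \<xi> = 0 \<or> u' \<xi> = 2 / (\<gamma> + 1)" if \<xi>: "\<xi> \<in> J" for \<xi>
  proof (rule disjCI)
    assume ne: "\<not> u' \<xi> = 2 / (\<gamma> + 1)"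
    show "u' \<xi> = 0"
    proof (rule ccontr)
      assume n0: "u' \<xi> \<noteq> 0"
      let ?N = "J \<inter> u' -` (- {0})"
      have N: "open ?N" using continuous_open_preimage[OF cu' J(1), of "- {0}"] by auto
      have "((\<lambda>\<eta>. (w \<eta>)\<^sup>2 * r \<eta>) has_real_derivative \<gamma> * p' \<xi>) (at \<xi>)"
      proof (rule has_field_derivative_transform_within_open[OF _ N])
        show "((\<lambda>\<eta>. \<gamma> * p \<eta>) has_real_derivative \<gamma> * p' \<xi>) (at \<xi>)"
          by (auto intro!: derivative_eq_intros d \<xi>)
      qed (use \<xi> n0 char in auto)
      moreover have "((\<lambda>\<eta>. (w \<eta>)\<^sup>2 * r \<eta>) has_real_derivative
          2 * w \<xi> * (u' \<xi> - 1) * r \<xi> + (w \<xi>)\<^sup>2 * r' \<xi>) (at \<xi>)"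
        by (auto intro!: derivative_eq_intros d dw \<xi>)
      ultimately have "2 * w \<xi> * (u' \<xi> - 1) * r \<xi> + (w \<xi>)\<^sup>2 * r' \<xi> = \<gamma> * p' \<xi>"
        using DERIV_unique by blast
      hence "w \<xi> * r \<xi> * ((\<gamma> + 1) * u' \<xi> - 2) = 0" using ode(1,2)[OF \<xi>] by algebra
      moreover have "w \<xi> \<noteq> 0" "r \<xi> \<noteq> 0" using char[OF \<xi> n0] pos[OF \<xi>] \<gamma> by auto
      ultimately have "(\<gamma> + 1) * u' \<xi> = 2" by simp
      thus False using ne \<gamma> by (simp add: field_simps)
    qed
  qed
  have const: "\<exists>c. \<forall>\<xi>\<in>J. f \<xi> = c"
    if "continuous_on J f" "finite K" "\<And>\<xi>. \<xi> \<in> J \<Longrightarrow> \<xi> \<notin> K \<Longrightarrow> (f has_real_derivative 0) (at \<xi>)" for f K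
    using DERIV_zero_connected_constant_on[OF J(2,1) that(2,1)] that(3) unfolding constant_on_def by blast
  have "u' ` J \<subseteq> {0, 2 / (\<gamma> + 1)}" using slope by blast
  hence "finite (u' ` J)" by (rule finite_subset) simp
  then obtain m where m: "\<And>\<xi>. \<xi> \<in> J \<Longrightarrow> u' \<xi> = m"
    using continuous_finite_range_constant[OF J(2) cu'] unfolding constant_on_def by blast
  show ?thesis
  proof (cases "m = 0")
    case True
    have p'0: "p' \<xi> = 0" if "\<xi> \<in> J" for \<xi> using ode(2)[OF that] m[OF that] True by simp
    obtain cu where cu: "\<And>\<xi>. \<xi> \<in> J \<Longrightarrow> u \<xi> = cu"
      using const[OF cont(2) finite.emptyI] d(2) m True by auto
    obtain cp where cp: "\<And>\<xi>. \<xi> \<in> J \<Longrightarrow> p \<xi> = cp"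
      using const[OF cont(3) finite.emptyI] d(3) p'0 by auto
    \<comment> \<open>The velocity is constant, so only at one point can the density gradient be nonzero.\<close>
    have "(r has_real_derivative 0) (at \<xi>)" if "\<xi> \<in> J" "\<xi> \<notin> {cu}" for \<xi>
      using ode(1)[OF that(1)] that m[OF that(1)] True cu[OF that(1)] d(1)[OF that(1)] by (auto simp: w_def)
    then obtain cr where cr: "\<And>\<xi>. \<xi> \<in> J \<Longrightarrow> r \<xi> = cr"
      using const[OF cont(1), of "{cu}"] by auto
    have "V \<xi> = (cr, cu, cp)" if "\<xi> \<in> J" for \<xi>
      using cu[OF that] cp[OF that] cr[OF that]
      by (simp add: r_def u_def p_def density_def velocity_def pressure_def prod_eq_iff)
    thus ?thesis unfolding constant_on_def by blast
  next
    case False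
    have m2: "m = 2 / (\<gamma> + 1)" if "J \<noteq> {}" using slope m False that by (metis all_not_in_conv)
    have char': "(w \<xi>)\<^sup>2 * r \<xi> = \<gamma> * p \<xi>" if "\<xi> \<in> J" for \<xi> using char[OF that] m[OF that] False by simp
    have w0: "w \<xi> \<noteq> 0" if "\<xi> \<in> J" for \<xi> using char'[OF that] pos[OF that] \<gamma> by auto
    have int: "is_interval (w ` J)"
      using connected_continuous_image[OF cont(4) J(2)] by (simp add: is_interval_connected_1)
    have sgn: "(\<forall>\<xi>\<in>J. w \<xi> > 0) \<or> (\<forall>\<xi>\<in>J. w \<xi> < 0)"
    proof (rule ccontr)
      assume "\<not> ?thesis"
      then obtain x y where xy: "x \<in> J" "y \<in> J" "w x \<le> 0" "0 \<le> w y" by (auto simp: not_less)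
      hence "0 \<in> w ` J" using int unfolding is_interval_1 by blast
      thus False using w0 by auto
    qed
    have a: "sound_speed \<gamma> (V \<xi>) = \<bar>w \<xi>\<bar>" if "\<xi> \<in> J" for \<xi>
    proof -
      have "\<gamma> * p \<xi> / r \<xi> = (w \<xi>)\<^sup>2" using char'[OF that] pos[OF that] by (simp add: field_simps)
      thus ?thesis by (simp add: sound_speed_def r_def p_def)
    qed
    have "((\<lambda>\<xi>. u \<xi> + 2 * w \<xi> / (\<gamma> - 1)) has_real_derivative 0) (at \<xi>)" if "\<xi> \<in> J" for \<xi>
    proof -
      have "((\<lambda>\<xi>. u \<xi> + 2 * w \<xi> / (\<gamma> - 1)) has_real_derivative m + 2 * (m - 1) / (\<gamma> - 1)) (at \<xi>)"
        using d(2)[OF that] dw[OF that] \<gamma> m[OF that] by (auto intro!: derivative_eq_intros)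
      moreover have "m + 2 * (m - 1) / (\<gamma> - 1) = 0" using m2 that \<gamma> by (auto simp: field_simps)
      ultimately show ?thesis by simp
    qed
    moreover have "continuous_on J (\<lambda>\<xi>. u \<xi> + 2 * w \<xi> / (\<gamma> - 1))"
      using cont \<gamma> by (intro continuous_intros) auto
    ultimately have "\<exists>c. \<forall>\<xi>\<in>J. u \<xi> + 2 * w \<xi> / (\<gamma> - 1) = c" by (intro const[of _ "{}"]) auto
    then obtain c where c: "\<And>\<xi>. \<xi> \<in> J \<Longrightarrow> u \<xi> + 2 * w \<xi> / (\<gamma> - 1) = c" by blast
    have "((\<lambda>\<xi>. ln (p \<xi>) - \<gamma> * ln (r \<xi>)) has_real_derivative 0) (at \<xi>)" if "\<xi> \<in> J" for \<xi>
    proof -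
      have "((\<lambda>\<xi>. ln (p \<xi>) - \<gamma> * ln (r \<xi>)) has_real_derivative p' \<xi> / p \<xi> - \<gamma> * (r' \<xi> / r \<xi>)) (at \<xi>)"
        using d[OF that] pos[OF that] by (auto intro!: derivative_eq_intros simp: divide_inverse)
      moreover have "w \<xi> * (r \<xi> * p' \<xi> - \<gamma> * (p \<xi> * r' \<xi>)) = 0"
        using ode[OF that] char'[OF that] by algebra
      hence "p' \<xi> / p \<xi> - \<gamma> * (r' \<xi> / r \<xi>) = 0"
        using w0[OF that] pos[OF that] by (simp add: field_simps)
      ultimately show ?thesis by simp
    qed
    moreover have "continuous_on J (\<lambda>\<xi>. ln (p \<xi>) - \<gamma> * ln (r \<xi>))"
      using cont pos by (intro continuous_intros) force+
    ultimately have "\<exists>c. \<forall>\<xi>\<in>J. ln (p \<xi>) - \<gamma> * ln (r \<xi>) = c" by (intro const[of _ "{}"]) auto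
    then obtain e where e: "\<And>\<xi>. \<xi> \<in> J \<Longrightarrow> ln (p \<xi>) - \<gamma> * ln (r \<xi>) = e" by blast
    have ent: "p \<xi> / r \<xi> powr \<gamma> = exp e" if "\<xi> \<in> J" for \<xi>
      using pos[OF that] by (simp add: e[OF that, symmetric] exp_diff powr_def)
    from sgn show ?thesis
    proof
      assume s: "\<forall>\<xi>\<in>J. w \<xi> > 0"
      have "fan_on \<gamma> V J" unfolding fan_on_def
      proof (intro exI ballI conjI)
        fix \<xi> assume \<xi>: "\<xi> \<in> J"
        hence "sound_speed \<gamma> (V \<xi>) = w \<xi>" using a s by (auto simp: abs_of_pos)
        thus "left_speed \<gamma> (V \<xi>) = \<xi>"
          "velocity (V \<xi>) + 2 * sound_speed \<gamma> (V \<xi>) / (\<gamma> - 1) = c"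
          "pressure (V \<xi>) / density (V \<xi>) powr \<gamma> = exp e"
          using c[OF \<xi>] ent[OF \<xi>] by (simp_all add: w_def u_def r_def p_def)
      qed
      thus ?thesis by blast
    next
      assume s: "\<forall>\<xi>\<in>J. w \<xi> < 0"
      have "fan_on \<gamma> (\<lambda>\<xi>. mirror (V (- \<xi>))) (uminus ` J)" unfolding fan_on_def
      proof (intro exI ballI conjI)
        fix \<zeta> assume "\<zeta> \<in> uminus ` J"
        then obtain \<xi> where \<xi>: "\<xi> \<in> J" "\<zeta> = - \<xi>" by auto
        hence "sound_speed \<gamma> (V \<xi>) = - w \<xi>" using a s by (auto simp: abs_of_neg)
        moreover from this have "- u \<xi> + 2 * sound_speed \<gamma> (V \<xi>) / (\<gamma> - 1) = - c"
          by (simp add: c[OF \<xi>(1), symmetric])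
        ultimately show "left_speed \<gamma> (mirror (V (- \<zeta>))) = \<zeta>"
          "velocity (mirror (V (- \<zeta>))) + 2 * sound_speed \<gamma> (mirror (V (- \<zeta>))) / (\<gamma> - 1) = - c"
          "pressure (mirror (V (- \<zeta>))) / density (mirror (V (- \<zeta>))) powr \<gamma> = exp e"
          using ent[OF \<xi>(1)] unfolding \<xi>(2) by (simp_all add: w_def u_def r_def p_def)
      qed
      thus ?thesis by blast
    qed
  qed
qed

lemma crp_solution_wave_pattern:
  assumes "crp_solution \<gamma> UL UR V"
  obtains D where "wave_pattern \<gamma> D V" "(V \<longlongrightarrow> UL) at_bot" "(V \<longlongrightarrow> UR) at_top"
proof -
  from assms obtain D where D: "finite D" "\<And>\<xi>. \<xi> \<notin> D \<Longrightarrow> is_state (V \<xi>)" "V C1_differentiable_on (- D)"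
    "\<And>x t. t > 0 \<Longrightarrow> x / t \<notin> D \<Longrightarrow> euler_classical_at \<gamma> (\<lambda>x t. V (x / t)) x t"
    "\<forall>\<sigma>\<in>D. \<exists>L R. is_state L \<and> is_state R \<and>
            (V \<longlongrightarrow> L) (at_left \<sigma>) \<and> (V \<longlongrightarrow> R) (at_right \<sigma>) \<and> admissible_jump \<gamma> \<sigma> L R"
    and lim: "(V \<longlongrightarrow> UL) at_bot" "(V \<longlongrightarrow> UR) at_top"
    unfolding crp_solution_def by blast
  have "isCont V \<xi>" if "\<xi> \<notin> D" for \<xi>
  proof -
    obtain V' where "(V has_vector_derivative V') (at \<xi>)"
      using D(3) \<open>\<xi> \<notin> D\<close> unfolding C1_differentiable_on_def by (metis ComplI)
    thus ?thesis by (rule has_vector_derivative_continuous)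
  qed
  moreover have "V constant_on J \<or> fan_on \<gamma> V J \<or> fan_on \<gamma> (\<lambda>\<xi>. mirror (V (- \<xi>))) (uminus ` J)"
    if "open J" "connected J" "J \<inter> D = {}" for J
  proof (rule smooth_self_similar_cases[OF that(1,2)])
    show "V C1_differentiable_on J" using D(3) by (rule C1_differentiable_on_subset) (use that in auto)
    show "euler_classical_at \<gamma> (\<lambda>x t. V (x / t)) \<xi> 1" if "\<xi> \<in> J" for \<xi>
      by (rule D(4)) (use that \<open>J \<inter> D = {}\<close> in auto)
  qed (use that D(2) in blast)
  ultimately have "wave_pattern \<gamma> D V" unfolding wave_pattern_def using D(1,2,5) by blast
  thus ?thesis using that lim by blast
qed

end

section \<open>Waves to the left of the contact\<close>

text \<open>
  Equality of the Riemann invariants that are constant across rarefactions of the first family.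
\<close>

definition same_fan :: "real \<Rightarrow> state \<Rightarrow> state \<Rightarrow> bool" where
  "same_fan \<gamma> S T \<longleftrightarrow>
     velocity S + 2 * sound_speed \<gamma> S / (\<gamma> - 1) = velocity T + 2 * sound_speed \<gamma> T / (\<gamma> - 1) \<and>
     pressure S / density S powr \<gamma> = pressure T / density T powr \<gamma>"

lemma same_fan_trans: "same_fan \<gamma> S T \<Longrightarrow> same_fan \<gamma> T U \<Longrightarrow> same_fan \<gamma> S U"
  by (simp add: same_fan_def)

text \<open>
  The wave of strength \<open>y\<close> running into \<open>S\<close> lies to the left of the position \<open>s\<close>. The inequality for
  shocks is strict, so that the limit from the left at \<open>s\<close> is already the state behind the wave.
\<close>

definition left_wave_before :: "real \<Rightarrow> state \<Rightarrow> real \<Rightarrow> real \<Rightarrow> bool" where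
  "left_wave_before \<gamma> S y s \<longleftrightarrow>
     y = 1 \<or> (y < 1 \<and> left_speed \<gamma> (wave \<gamma> S y) \<le> s) \<or>
     (1 < y \<and> velocity S - sound_speed \<gamma> S * y < s)"

lemma left_wave_before_mono: "left_wave_before \<gamma> S y s \<Longrightarrow> s \<le> t \<Longrightarrow> left_wave_before \<gamma> S y t"
  by (auto simp: left_wave_before_def)

text \<open>
  Points of continuity are treated as trivial jumps.
\<close>

lemma wave_pattern_limits:
  assumes "wave_pattern \<gamma> D V"
  obtains L R where "is_state L" "is_state R" "(V \<longlongrightarrow> L) (at_left s)" "(V \<longlongrightarrow> R) (at_right s)"
    "admissible_jump \<gamma> s L R" "s \<notin> D \<Longrightarrow> L = V s"
proof (cases "s \<in> D")
  case False
  hence "is_state (V s)" "(V \<longlongrightarrow> V s) (at s)"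
    using assms unfolding wave_pattern_def isCont_def by auto
  moreover have "admissible_jump \<gamma> s (V s) (V s)" by (simp add: admissible_jump_def)
  ultimately show ?thesis using that[of "V s" "V s"] by (simp add: filterlim_at_split)
next
  case True
  hence "\<exists>L R. is_state L \<and> is_state R \<and> (V \<longlongrightarrow> L) (at_left s) \<and> (V \<longlongrightarrow> R) (at_right s) \<and>
      admissible_jump \<gamma> s L R"
    using assms unfolding wave_pattern_def by blast
  then obtain L R where LR: "is_state L" "is_state R" "(V \<longlongrightarrow> L) (at_left s)" "(V \<longlongrightarrow> R) (at_right s)"
      "admissible_jump \<gamma> s L R" by (elim exE conjE)
  show ?thesis by (rule that[OF LR]) (use True in simp)
qed

lemma wave_pattern_interval:
  assumes "wave_pattern \<gamma> D V" "open J" "connected J" "J \<inter> D = {}"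
  shows "V constant_on J \<or> fan_on \<gamma> V J \<or> fan_on \<gamma> (\<lambda>\<xi>. mirror (V (- \<xi>))) (uminus ` J)"
  using assms unfolding wave_pattern_def by blast

lemma continuous_mirror: "continuous_on UNIV mirror"
  unfolding mirror_def density_def velocity_def pressure_def by (intro continuous_intros)

lemma tendsto_mirror: "(V \<longlongrightarrow> L) F \<Longrightarrow> ((\<lambda>x. mirror (V x)) \<longlongrightarrow> mirror L) F"
  by (rule continuous_on_tendsto_compose[OF continuous_mirror]) auto

lemma wave_pattern_mirror:
  assumes \<gamma>: "1 < \<gamma>" and "wave_pattern \<gamma> D V"
  shows "wave_pattern \<gamma> (uminus ` D) (\<lambda>\<xi>. mirror (V (- \<xi>)))"
proof -
  have pat: "finite D" "\<And>\<xi>. \<xi> \<notin> D \<Longrightarrow> is_state (V \<xi>)" "\<And>\<xi>. \<xi> \<notin> D \<Longrightarrow> isCont V \<xi>"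
    "\<And>J. open J \<Longrightarrow> connected J \<Longrightarrow> J \<inter> D = {} \<Longrightarrow>
        V constant_on J \<or> fan_on \<gamma> V J \<or> fan_on \<gamma> (\<lambda>\<xi>. mirror (V (- \<xi>))) (uminus ` J)"
    "\<forall>\<sigma>\<in>D. \<exists>L R. is_state L \<and> is_state R \<and>
        (V \<longlongrightarrow> L) (at_left \<sigma>) \<and> (V \<longlongrightarrow> R) (at_right \<sigma>) \<and> admissible_jump \<gamma> \<sigma> L R"
    using assms(2) unfolding wave_pattern_def by simp_all
  show ?thesis
    unfolding wave_pattern_def
  proof (intro conjI allI impI ballI)
    show "finite (uminus ` D)" using pat(1) by simp
    fix \<xi> assume "\<xi> \<notin> uminus ` D"
    hence \<xi>: "- \<xi> \<notin> D" by (metis imageI minus_minus)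
    show "is_state (mirror (V (- \<xi>)))" using pat(2)[OF \<xi>] by simp
    have "isCont (\<lambda>\<xi>. V (- \<xi>)) \<xi>"
      by (rule continuous_at_compose[where f = uminus and g = V, unfolded o_def]) (use pat(3)[OF \<xi>] in \<open>auto intro!: continuous_intros\<close>)
    thus "isCont (\<lambda>\<xi>. mirror (V (- \<xi>))) \<xi>" unfolding isCont_def by (rule tendsto_mirror)
  next
    fix J :: "real set" assume J: "open J" "connected J" "J \<inter> uminus ` D = {}"
    have "- x \<notin> D" if "x \<in> J" for x
      using J(3) that image_eqI[of x uminus "- x" D] by auto
    hence "uminus ` J \<inter> D = {}" by auto
    moreover have "open (uminus ` J)" "connected (uminus ` J)"
      using J by (auto simp: open_negations intro!: connected_continuous_image continuous_intros)
    moreover have "uminus ` uminus ` J = J" by (simp add: image_image)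
    ultimately have "V constant_on uminus ` J \<or> fan_on \<gamma> V (uminus ` J) \<or> fan_on \<gamma> (\<lambda>\<xi>. mirror (V (- \<xi>))) J"
      using pat(4)[of "uminus ` J"] by simp
    moreover have "(\<lambda>\<xi>. mirror (V (- \<xi>))) constant_on J" if const: "V constant_on uminus ` J"
    proof -
      obtain c where "\<And>\<xi>. \<xi> \<in> uminus ` J \<Longrightarrow> V \<xi> = c" using const unfolding constant_on_def by blast
      hence "\<forall>\<xi>\<in>J. mirror (V (- \<xi>)) = mirror c" by simp
      thus ?thesis unfolding constant_on_def by blast
    qed
    ultimately show "(\<lambda>\<xi>. mirror (V (- \<xi>))) constant_on J \<or> fan_on \<gamma> (\<lambda>\<xi>. mirror (V (- \<xi>))) J \<or>
        fan_on \<gamma> (\<lambda>\<xi>. mirror (mirror (V (- (- \<xi>))))) (uminus ` J)" by auto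
  next
    fix \<sigma>' assume "\<sigma>' \<in> uminus ` D"
    then obtain \<sigma> where \<sigma>: "\<sigma> \<in> D" "\<sigma>' = - \<sigma>" by auto
    then obtain L R where LR: "is_state L" "is_state R" "(V \<longlongrightarrow> L) (at_left \<sigma>)" "(V \<longlongrightarrow> R) (at_right \<sigma>)"
      "admissible_jump \<gamma> \<sigma> L R" using pat(5) by blast
    have "((\<lambda>\<xi>. mirror (V (- \<xi>))) \<longlongrightarrow> mirror R) (at_left \<sigma>')"
      "((\<lambda>\<xi>. mirror (V (- \<xi>))) \<longlongrightarrow> mirror L) (at_right \<sigma>')"
      unfolding \<sigma>(2) at_left_minus[of "- \<sigma>"] at_right_minus[of "- \<sigma>"] filterlim_filtermap minus_minus
      using LR by (auto intro: tendsto_mirror)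
    moreover have "admissible_jump \<gamma> \<sigma>' (mirror R) (mirror L)"
      unfolding \<sigma>(2) by (rule admissible_jump_mirror[OF \<gamma> LR(5)])
    ultimately show "\<exists>L R. is_state L \<and> is_state R \<and> ((\<lambda>\<xi>. mirror (V (- \<xi>))) \<longlongrightarrow> L) (at_left \<sigma>') \<and>
        ((\<lambda>\<xi>. mirror (V (- \<xi>))) \<longlongrightarrow> R) (at_right \<sigma>') \<and> admissible_jump \<gamma> \<sigma>' L R"
      using LR(1,2) by (intro exI[of _ "mirror R"] exI[of _ "mirror L"]) simp
  qed
qed

lemma state_tendsto:
  assumes "(V \<longlongrightarrow> L) F" "is_state L"
  shows "((\<lambda>\<xi>. velocity (V \<xi>)) \<longlongrightarrow> velocity L) F"
    and "((\<lambda>\<xi>. sound_speed \<gamma> (V \<xi>)) \<longlongrightarrow> sound_speed \<gamma> L) F"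
    and "((\<lambda>\<xi>. pressure (V \<xi>) / density (V \<xi>) powr \<gamma>) \<longlongrightarrow> pressure L / density L powr \<gamma>) F"
proof -
  have c: "((\<lambda>\<xi>. density (V \<xi>)) \<longlongrightarrow> density L) F" "((\<lambda>\<xi>. pressure (V \<xi>)) \<longlongrightarrow> pressure L) F"
    unfolding density_def pressure_def by (intro tendsto_intros assms(1))+
  show "((\<lambda>\<xi>. velocity (V \<xi>)) \<longlongrightarrow> velocity L) F"
    unfolding velocity_def by (intro tendsto_intros assms(1))
  have d: "density L \<noteq> 0" "0 < density L" using assms(2) by (auto simp: is_state_def)
  show "((\<lambda>\<xi>. sound_speed \<gamma> (V \<xi>)) \<longlongrightarrow> sound_speed \<gamma> L) F"
    unfolding sound_speed_def using d by (intro tendsto_intros c) auto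
  show "((\<lambda>\<xi>. pressure (V \<xi>) / density (V \<xi>) powr \<gamma>) \<longlongrightarrow> pressure L / density L powr \<gamma>) F"
    using d by (intro tendsto_intros c) auto
qed

lemma fan_on_tendsto:
  assumes fan: "fan_on \<gamma> V J" and ev: "\<forall>\<^sub>F \<xi> in F. \<xi> \<in> J" and F: "F \<noteq> bot" "(V \<longlongrightarrow> L) F" "is_state L"
    and s: "((\<lambda>\<xi>. \<xi>) \<longlongrightarrow> s) F"
  shows "left_speed \<gamma> L = s" and "\<xi> \<in> J \<Longrightarrow> same_fan \<gamma> L (V \<xi>)"
proof -
  obtain c d where f: "\<And>\<xi>. \<xi> \<in> J \<Longrightarrow> left_speed \<gamma> (V \<xi>) = \<xi>"
     "\<And>\<xi>. \<xi> \<in> J \<Longrightarrow> velocity (V \<xi>) + 2 * sound_speed \<gamma> (V \<xi>) / (\<gamma> - 1) = c"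
     "\<And>\<xi>. \<xi> \<in> J \<Longrightarrow> pressure (V \<xi>) / density (V \<xi>) powr \<gamma> = d"
    using fan unfolding fan_on_def by blast
  note t = state_tendsto[OF F(2,3)]
  have "((\<lambda>\<xi>. left_speed \<gamma> (V \<xi>)) \<longlongrightarrow> s) F"
    by (rule Lim_transform_eventually[OF s]) (use ev f(1) in \<open>auto elim: eventually_mono\<close>)
  thus "left_speed \<gamma> L = s" using tendsto_unique[OF F(1) tendsto_diff[OF t(1,2)]] by blast
  have "((\<lambda>\<xi>. velocity (V \<xi>) + 2 * sound_speed \<gamma> (V \<xi>) / (\<gamma> - 1)) \<longlongrightarrow> c) F"
    by (rule Lim_transform_eventually[OF tendsto_const]) (use ev f(2) in \<open>auto elim: eventually_mono\<close>)
  moreover have "((\<lambda>\<xi>. velocity (V \<xi>) + 2 * sound_speed \<gamma> (V \<xi>) * inverse (\<gamma> - 1)) \<longlongrightarrow>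
      velocity L + 2 * sound_speed \<gamma> L * inverse (\<gamma> - 1)) F" by (intro tendsto_intros t)
  ultimately have c: "velocity L + 2 * sound_speed \<gamma> L / (\<gamma> - 1) = c"
    using tendsto_unique[OF F(1)] by (simp add: divide_inverse)
  have "((\<lambda>\<xi>. pressure (V \<xi>) / density (V \<xi>) powr \<gamma>) \<longlongrightarrow> d) F"
    by (rule Lim_transform_eventually[OF tendsto_const]) (use ev f(3) in \<open>auto elim: eventually_mono\<close>)
  hence d: "pressure L / density L powr \<gamma> = d" using tendsto_unique[OF F(1) t(3)] by blast
  show "same_fan \<gamma> L (V \<xi>)" if "\<xi> \<in> J" using f(2,3)[OF that] c d by (simp add: same_fan_def)
qed

lemma gap_cases:
  assumes pat: "wave_pattern \<gamma> D V" and gap: "d < s" "{d<..<s} \<inter> D = {}"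
    and R: "is_state R" "(V \<longlongrightarrow> R) (at_right d)" and L: "is_state L" "(V \<longlongrightarrow> L) (at_left s)"
  obtains (const) "R = L" "\<And>\<xi>. d < \<xi> \<Longrightarrow> \<xi> < s \<Longrightarrow> V \<xi> = L"
    | (fan) "left_speed \<gamma> R = d" "left_speed \<gamma> L = s" "same_fan \<gamma> R L"
        "\<And>\<xi>. d < \<xi> \<Longrightarrow> \<xi> < s \<Longrightarrow> left_speed \<gamma> (V \<xi>) = \<xi> \<and> same_fan \<gamma> R (V \<xi>)"
    | (right_fan) "velocity L + sound_speed \<gamma> L = s"
proof -
  let ?J = "{d<..<s}"
  have evR: "\<forall>\<^sub>F \<xi> in at_right d. \<xi> \<in> ?J" using gap(1) by (auto simp: eventually_at_right_field)
  have evL: "\<forall>\<^sub>F \<xi> in at_left s. \<xi> \<in> ?J" using gap(1) by (auto simp: eventually_at_left_field)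
  have id: "((\<lambda>\<xi>. \<xi>) \<longlongrightarrow> s) (at_left s)" "((\<lambda>\<xi>. \<xi>) \<longlongrightarrow> d) (at_right d)"
    by (auto intro: tendsto_intros)
  have "V constant_on ?J \<or> fan_on \<gamma> V ?J \<or> fan_on \<gamma> (\<lambda>\<xi>. mirror (V (- \<xi>))) (uminus ` ?J)"
    by (rule wave_pattern_interval[OF pat]) (use gap(2) in auto)
  then consider (1) "V constant_on ?J" | (2) "fan_on \<gamma> V ?J"
    | (3) "fan_on \<gamma> (\<lambda>\<xi>. mirror (V (- \<xi>))) (uminus ` ?J)" by blast
  thus ?thesis
  proof cases
    case 1
    then obtain S where S: "\<And>\<xi>. \<xi> \<in> ?J \<Longrightarrow> V \<xi> = S" unfolding constant_on_def by blast
    have "(V \<longlongrightarrow> S) (at_right d)"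
      by (rule Lim_transform_eventually[OF tendsto_const]) (use evR S in \<open>auto elim: eventually_mono\<close>)
    hence "S = R" using R(2) by (rule tendsto_unique[OF trivial_limit_at_right_real])
    moreover have "(V \<longlongrightarrow> S) (at_left s)"
      by (rule Lim_transform_eventually[OF tendsto_const]) (use evL S in \<open>auto elim: eventually_mono\<close>)
    hence "S = L" using L(2) by (rule tendsto_unique[OF trivial_limit_at_left_real])
    ultimately have "S = R" "S = L" by simp_all
    thus ?thesis using const S by auto
  next
    case 2
    note r = fan_on_tendsto[OF 2 evR _ R(2,1) id(2)] and l = fan_on_tendsto[OF 2 evL _ L(2,1) id(1)]
    have m: "(d + s) / 2 \<in> ?J" using gap(1) by simp
    have "same_fan \<gamma> R L" using r(2)[OF _ m] l(2)[OF _ m] by (simp add: same_fan_def)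
    moreover have "left_speed \<gamma> (V \<xi>) = \<xi>" if "\<xi> \<in> ?J" for \<xi>
      using 2 that unfolding fan_on_def by blast
    ultimately show ?thesis using fan r l by simp
  next
    case 3
    have "left_speed \<gamma> (mirror L) = - s"
    proof (rule fan_on_tendsto[OF 3])
      show "\<forall>\<^sub>F \<xi> in at_right (- s). \<xi> \<in> uminus ` {d<..<s}"
        unfolding at_right_minus[of "- s"] minus_minus eventually_filtermap
        by (rule eventually_mono[OF evL]) auto
      show "((\<lambda>\<xi>. mirror (V (- \<xi>))) \<longlongrightarrow> mirror L) (at_right (- s))"
        unfolding at_right_minus[of "- s"] filterlim_filtermap minus_minus
        by (rule tendsto_mirror[OF L(2)])
    qed (use L in \<open>auto intro: tendsto_intros\<close>)
    thus ?thesis using right_fan by simp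
  qed
qed

context
  fixes \<gamma> :: real
  assumes \<gamma>: "1 < \<gamma>"
begin

lemma same_fan_wave:
  assumes "is_state S" "0 < y" "y \<le> 1" shows "same_fan \<gamma> S (wave \<gamma> S y)"
proof -
  have "(y powr (2 / (\<gamma> - 1))) powr \<gamma> = y powr (2 * \<gamma> / (\<gamma> - 1))" by (simp add: powr_powr)
  thus ?thesis using assms \<gamma>
    by (simp add: same_fan_def velocity_wave pressure_wave density_wave sound_speed_wave powr_mult is_state_def
       add_divide_distrib[symmetric]) (simp add: field_simps)
qed

lemma same_fan_param:
  assumes "is_state S" "same_fan \<gamma> S T" "left_speed \<gamma> T = \<xi>"
  shows "fan_param \<gamma> S \<xi> = sound_speed \<gamma> T / sound_speed \<gamma> S"
proof -
  have "(velocity S + 2 * sound_speed \<gamma> S / (\<gamma> - 1) - \<xi>) * (\<gamma> - 1) = (\<gamma> + 1) * sound_speed \<gamma> T"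
    using assms(2,3) \<gamma> unfolding same_fan_def by (auto simp: field_simps)
  thus ?thesis using \<gamma> sound_speed_pos[OF \<gamma> assms(1)] by (simp add: fan_param_def)
qed

lemma same_fan_eq_wave:
  assumes "is_state S" "is_state T" "same_fan \<gamma> S T" "left_speed \<gamma> T = \<xi>"
    and "fan_param \<gamma> S \<xi> \<le> 1"
  shows "0 < fan_param \<gamma> S \<xi>" "T = wave \<gamma> S (fan_param \<gamma> S \<xi>)"
proof -
  note a = sound_speed_pos[OF \<gamma> assms(1)] sound_speed_pos[OF \<gamma> assms(2)]
  note p = same_fan_param[OF assms(1,3,4)]
  show "0 < fan_param \<gamma> S \<xi>" using p a by simp
  have "sound_speed \<gamma> T \<le> sound_speed \<gamma> S" using assms(5) p a by simp
  thus "T = wave \<gamma> S (fan_param \<gamma> S \<xi>)" unfolding p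
    using isentropic_eq_wave[OF \<gamma> assms(1,2)] assms(3) by (simp add: same_fan_def)
qed

lemma wave_profile_1 [simp]: "wave_profile \<gamma> S 1 \<xi> = S"
  by (simp add: wave_profile_def wave_1[OF \<gamma>])

lemma wave_profile_after:
  assumes "is_state S" "0 < y" "left_wave_before \<gamma> S y s" "s \<le> \<xi>"
  shows "wave_profile \<gamma> S y \<xi> = wave \<gamma> S y"
proof -
  consider "y = 1" | "y < 1" "left_speed \<gamma> (wave \<gamma> S y) \<le> \<xi>"
    | "1 < y" "velocity S - sound_speed \<gamma> S * y < \<xi>"
    using assms(3,4) unfolding left_wave_before_def by linarith
  thus ?thesis
  proof cases
    case 2
    hence "fan_param \<gamma> S \<xi> \<le> y"
      using fan_param_char_speed[OF \<gamma> assms(1,2)] fan_param_less_iff[OF \<gamma> assms(1)] by (metis leD leI less_imp_le)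
    thus ?thesis using 2 by (simp add: wave_profile_def max_absorb1 min_le_iff_disj)
  qed (auto simp: wave_profile_def wave_1[OF \<gamma>])
qed

text \<open>
  In a fan \<open>u \<plusminus> a = \<xi>\<close> is unbounded on an infinite interval, whereas \<open>u\<close> and \<open>a\<close> converge
  at \<open>- \<infinity>\<close>.
\<close>

lemma at_bot_gap_constant:
  assumes pat: "wave_pattern \<gamma> D V" and lim: "(V \<longlongrightarrow> S) at_bot" and S: "is_state S" and gap: "{..<s} \<inter> D = {}"
    and \<xi>: "\<xi> < s"
  shows "V \<xi> = S"
proof -
  let ?J = "{..<s}"
  have "V constant_on ?J \<or> fan_on \<gamma> V ?J \<or> fan_on \<gamma> (\<lambda>\<xi>. mirror (V (- \<xi>))) (uminus ` ?J)"
    by (rule wave_pattern_interval[OF pat]) (use gap in auto)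
  moreover have False if "fan_on \<gamma> V ?J"
  proof -
    let ?c = "left_speed \<gamma> S"
    have "((\<lambda>\<xi>. left_speed \<gamma> (V \<xi>)) \<longlongrightarrow> ?c) at_bot"
      by (intro tendsto_intros state_tendsto[OF lim S])
    hence "\<forall>\<^sub>F \<xi> in at_bot. ?c - 1 < left_speed \<gamma> (V \<xi>)"
      by (rule order_tendstoD) simp
    moreover have "\<forall>\<^sub>F \<xi> in at_bot. \<xi> < min s (?c - 1)" by (rule eventually_gt_at_bot)
    ultimately have "\<forall>\<^sub>F \<xi> in at_bot::real filter. False"
    proof eventually_elim
      case (elim \<xi>)
      thus ?case using that unfolding fan_on_def by force
    qed
    thus False by simp
  qed
  moreover have False if "fan_on \<gamma> (\<lambda>\<xi>. mirror (V (- \<xi>))) (uminus ` ?J)"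
  proof -
    let ?c = "velocity S + sound_speed \<gamma> S"
    have "((\<lambda>\<xi>. velocity (V \<xi>) + sound_speed \<gamma> (V \<xi>)) \<longlongrightarrow> ?c) at_bot"
      by (intro tendsto_intros state_tendsto[OF lim S])
    hence "\<forall>\<^sub>F \<xi> in at_bot. ?c - 1 < velocity (V \<xi>) + sound_speed \<gamma> (V \<xi>)"
      by (rule order_tendstoD) simp
    moreover have "\<forall>\<^sub>F \<xi> in at_bot. \<xi> < min s (?c - 1)" by (rule eventually_gt_at_bot)
    ultimately have "\<forall>\<^sub>F \<xi> in at_bot::real filter. False"
    proof eventually_elim
      case (elim \<xi>)
      have "left_speed \<gamma> (mirror (V (- \<zeta>))) = \<zeta>"
        if "\<zeta> \<in> uminus ` {..<s}" for \<zeta>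
        using \<open>fan_on \<gamma> _ (uminus ` {..<s})\<close> that unfolding fan_on_def by blast
      from this[of "- \<xi>"] elim have "- velocity (V \<xi>) - sound_speed \<gamma> (V \<xi>) = - \<xi>" by simp
      thus ?case using elim by linarith
    qed
    thus False by simp
  qed
  ultimately obtain T where T: "\<And>\<xi>. \<xi> < s \<Longrightarrow> V \<xi> = T" unfolding constant_on_def by blast
  have "(V \<longlongrightarrow> T) at_bot"
    by (rule Lim_transform_eventually[OF tendsto_const], rule eventually_mono[OF eventually_gt_at_bot[of s]])
      (simp add: T)
  hence "T = S" using lim by (rule tendsto_unique[OF trivial_limit_at_bot_linorder])
  thus ?thesis using T \<xi> by simp
qed

text \<open>
  As long as the gas is faster than the position, \<open>s < u\<close>, neither a contact nor a wave of the third
  family can have occurred. Induction over the number of jumps to the left of \<open>s\<close>: a shock can only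
  start from \<open>S\<close> itself, and a fan can only start from \<open>S\<close> or continue an earlier fan, because after a
  fan or a shock the characteristic speed \<open>u - a\<close> is not larger than the position.
\<close>

lemma left_structure:
  assumes pat: "wave_pattern \<gamma> D V" and lim: "(V \<longlongrightarrow> S) at_bot" and S: "is_state S"
    and L: "is_state L" "(V \<longlongrightarrow> L) (at_left s)" "s < velocity L"
  shows "\<exists>y>0. L = wave \<gamma> S y \<and> left_wave_before \<gamma> S y s \<and>
    (\<forall>\<xi><s. \<xi> \<notin> D \<longrightarrow> V \<xi> = wave_profile \<gamma> S y \<xi>)"
  using L
proof (induction "card (D \<inter> {..<s})" arbitrary: s L rule: less_induct)
  case less
  note L = less.prems
  have fin: "finite (D \<inter> {..<s})" using pat by (simp add: wave_pattern_def)
  show ?case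
  proof (cases "D \<inter> {..<s} = {}")
    case True
    hence V: "V \<xi> = S" if "\<xi> < s" for \<xi> using at_bot_gap_constant[OF pat lim S _ that] by (simp add: Int_commute)
    have "(V \<longlongrightarrow> S) (at_left s)"
      by (rule Lim_transform_eventually[OF tendsto_const])
        (use V in \<open>auto simp: eventually_at_left_field intro: lt_ex\<close>)
    hence "L = S" by (rule tendsto_unique[OF trivial_limit_at_left_real L(2)])
    thus ?thesis using V by (intro exI[of _ 1]) (simp add: left_wave_before_def wave_1[OF \<gamma>])
  next
    case False
    define d where "d = Max (D \<inter> {..<s})"
    have d: "d \<in> D" "d < s" using Max_in[OF fin False] by (auto simp: d_def)
    have gap: "{d<..<s} \<inter> D = {}" using Max_ge[OF fin] unfolding d_def by fastforce
    obtain L' R where LR: "is_state L'" "is_state R" "(V \<longlongrightarrow> L') (at_left d)" "(V \<longlongrightarrow> R) (at_right d)"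
      "admissible_jump \<gamma> d L' R" using wave_pattern_limits[OF pat] by metis
    note a = sound_speed_pos[OF \<gamma> L(1)] sound_speed_pos[OF \<gamma> LR(2)]
    note gapE = gap_cases[OF pat d(2) gap LR(2,4) L(1,2)]
    have dR: "d < velocity R"
      by (rule gapE) (use d(2) L(3) a in auto)
    have jump: "R = L' \<or> (\<exists>y>1. d = velocity L' - sound_speed \<gamma> L' * y \<and> R = wave \<gamma> L' y)"
    proof (rule admissible_jump_cases[OF \<gamma> LR(1,2,5)])
      fix y assume right: "1 < y" "- d = velocity (mirror R) - sound_speed \<gamma> (mirror R) * y"
      have "velocity R + sound_speed \<gamma> R * y = d" using right(2) by simp
      moreover have "0 < sound_speed \<gamma> R * y" using a(2) right(1) by simp
      ultimately show ?thesis using dR by linarith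
    qed (use dR in auto)
    have dL: "d < velocity L'"
    proof (cases "R = L'")
      case False
      then obtain y where "1 < y" "d = velocity L' - sound_speed \<gamma> L' * y" using jump by blast
      thus ?thesis using sound_speed_pos[OF \<gamma> LR(1)] by simp
    qed (use dR in simp)
    have "card (D \<inter> {..<d}) < card (D \<inter> {..<s})"
      by (rule psubset_card_mono[OF fin]) (use d in auto)
    from less.hyps[OF this LR(1,3) dL] obtain y0 where y0: "0 < y0" "L' = wave \<gamma> S y0"
      "left_wave_before \<gamma> S y0 d" "\<And>\<xi>. \<xi> < d \<Longrightarrow> \<xi> \<notin> D \<Longrightarrow> V \<xi> = wave_profile \<gamma> S y0 \<xi>" by blast
    have y0_gt: "left_speed \<gamma> L' < d" if "1 < y0"
      using shock_lax(1)[OF \<gamma> S that] y0(2,3) that by (auto simp: left_wave_before_def)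
    have split: "\<xi> < d \<or> (d < \<xi> \<and> \<xi> < s)" if "\<xi> < s" "\<xi> \<notin> D" for \<xi> using that d(1) by (metis linorder_neqE)
    show ?thesis
    proof (cases "R = L'")
      case True
      show ?thesis
      proof (rule gapE)
        assume c: "R = L" "\<And>\<xi>. d < \<xi> \<Longrightarrow> \<xi> < s \<Longrightarrow> V \<xi> = L"
        have "V \<xi> = wave_profile \<gamma> S y0 \<xi>" if "\<xi> < s" "\<xi> \<notin> D" for \<xi>
          using split[OF that] y0(2,4) that c True wave_profile_after[OF S y0(1,3), of \<xi>] by auto
        thus ?thesis using y0 c True left_wave_before_mono[OF y0(3), of s] d(2) by auto
      next
        assume f: "left_speed \<gamma> R = d" "left_speed \<gamma> L = s" "same_fan \<gamma> R L"
          "\<And>\<xi>. d < \<xi> \<Longrightarrow> \<xi> < s \<Longrightarrow> left_speed \<gamma> (V \<xi>) = \<xi> \<and> same_fan \<gamma> R (V \<xi>)"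
        have y01: "y0 \<le> 1" using f(1) y0_gt True by (meson less_irrefl not_le)
        have sf: "same_fan \<gamma> S R" using same_fan_wave[OF S y0(1) y01] y0(2) True by simp
        have pd: "fan_param \<gamma> S d = y0"
          using fan_param_char_speed[OF \<gamma> S y0(1) y01] f(1) y0(2) True by simp
        have lt: "fan_param \<gamma> S \<xi> < y0" if "d < \<xi>" for \<xi>
          using fan_param_less_iff[OF \<gamma> S, of \<xi> d] that pd by simp
        define y where "y = fan_param \<gamma> S s"
        have y: "0 < y" "L = wave \<gamma> S y" "y < y0"
          using same_fan_eq_wave[OF S L(1) same_fan_trans[OF sf f(3)] f(2)] lt[OF d(2)] y01
          unfolding y_def by auto
        have "V \<xi> = wave_profile \<gamma> S y \<xi>" if \<xi>: "\<xi> < s" "\<xi> \<notin> D" for \<xi>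
          using split[OF \<xi>]
        proof
          assume "\<xi> < d"
          hence "y0 < fan_param \<gamma> S \<xi>" using fan_param_less_iff[OF \<gamma> S, of d \<xi>] pd by simp
          hence "max y0 (min 1 (fan_param \<gamma> S \<xi>)) = max y (min 1 (fan_param \<gamma> S \<xi>))"
            using y y01 by auto
          thus ?thesis using y0(4)[OF \<open>\<xi> < d\<close> \<xi>(2)] y(3) y01 by (simp add: wave_profile_def)
        next
          assume g: "d < \<xi> \<and> \<xi> < s"
          have st: "is_state (V \<xi>)" using pat \<xi> by (simp add: wave_pattern_def)
          have "fan_param \<gamma> S \<xi> < 1" using lt g y01 by force
          moreover have "y < fan_param \<gamma> S \<xi>" using fan_param_less_iff[OF \<gamma> S, of s \<xi>] g y_def by simp
          moreover have "V \<xi> = wave \<gamma> S (fan_param \<gamma> S \<xi>)"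
            using same_fan_eq_wave(2)[OF S st same_fan_trans[OF sf]] f(4) g calculation(1) by simp
          ultimately show ?thesis by (simp add: wave_profile_def)
        qed
        moreover have "left_wave_before \<gamma> S y s" using y y01 f(2) by (simp add: left_wave_before_def)
        ultimately show ?thesis using y by blast
      next
        assume "velocity L + sound_speed \<gamma> L = s"
        thus ?thesis using L(3) a by simp
      qed
    next
      case False
      then obtain y where y: "1 < y" "d = velocity L' - sound_speed \<gamma> L' * y" "R = wave \<gamma> L' y"
        using jump by blast
      have "d < left_speed \<gamma> L'" using shock_lax(3)[OF \<gamma> LR(1) y(1)] y(2) by simp
      hence "y0 = 1" using y0_gt y0(2,3) by (auto simp: left_wave_before_def)
      hence L': "L' = S" using y0(2) by (simp add: wave_1[OF \<gamma>])
      show ?thesis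
      proof (rule gapE)
        assume c: "R = L" "\<And>\<xi>. d < \<xi> \<Longrightarrow> \<xi> < s \<Longrightarrow> V \<xi> = L"
        have "V \<xi> = wave_profile \<gamma> S y \<xi>" if "\<xi> < s" "\<xi> \<notin> D" for \<xi>
          using split[OF that] y0(4)[of \<xi>] \<open>y0 = 1\<close> that c y L' by (auto simp: wave_profile_def wave_1[OF \<gamma>])
        moreover have "left_wave_before \<gamma> S y s" using y L' d(2) by (simp add: left_wave_before_def)
        ultimately show ?thesis using y L' c by (intro exI[of _ y]) auto
      next
        assume "left_speed \<gamma> R = d"
        thus ?thesis using shock_lax(1)[OF \<gamma> LR(1) y(1)] y(2,3) by simp
      next
        assume "velocity L + sound_speed \<gamma> L = s"
        thus ?thesis using L(3) a by simp
      qed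
    qed
  qed
qed

text \<open>
  The preceding lemma does not reach the contact itself, where \<open>s = u\<close>; but no fan ends there, so the
  solution is constant just before it.
\<close>

lemma left_structure_contact:
  assumes pat: "wave_pattern \<gamma> D V" and lim: "(V \<longlongrightarrow> S) at_bot" and S: "is_state S"
    and L: "is_state L" "(V \<longlongrightarrow> L) (at_left s)" "s = velocity L"
  shows "\<exists>y>0. L = wave \<gamma> S y \<and> (\<forall>\<xi><s. \<xi> \<notin> D \<longrightarrow> V \<xi> = wave_profile \<gamma> S y \<xi>)"
proof -
  have fin: "finite D" using pat by (simp add: wave_pattern_def)
  obtain d where d: "d < s" "{d<..<s} \<inter> D = {}"
  proof (cases "D \<inter> {..<s} = {}")
    case True
    moreover have "{s - 1<..<s} \<subseteq> {..<s}" by auto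
    ultimately have "{s - 1<..<s} \<inter> D = {}" by blast
    thus ?thesis using that[of "s - 1"] by simp
  next
    case False
    have "Max (D \<inter> {..<s}) \<in> D \<inter> {..<s}" using fin False by (intro Max_in) auto
    moreover have "\<xi> \<le> Max (D \<inter> {..<s})" if "\<xi> \<in> D" "\<xi> < s" for \<xi> using fin that by (intro Max_ge) auto
    ultimately show ?thesis using that[of "Max (D \<inter> {..<s})"] by fastforce
  qed
  obtain R where R: "is_state R" "(V \<longlongrightarrow> R) (at_right d)" using wave_pattern_limits[OF pat] by metis
  note a = sound_speed_pos[OF \<gamma> L(1)]
  have V: "V \<xi> = L" if "d < \<xi>" "\<xi> < s" for \<xi>
    by (rule gap_cases[OF pat d R L(1,2)]) (use a L(3) that in auto)
  define m where "m = (d + s) / 2"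
  have m: "d < m" "m < s" using d(1) by (auto simp: m_def)
  have "(V \<longlongrightarrow> L) (at_left m)"
    by (rule Lim_transform_eventually[OF tendsto_const])
      (use V m in \<open>auto simp: eventually_at_left_field intro!: exI[of _ d]\<close>)
  from left_structure[OF pat lim S L(1) this] obtain y where
    y: "0 < y" "L = wave \<gamma> S y" "left_wave_before \<gamma> S y m"
      "\<And>\<xi>. \<xi> < m \<Longrightarrow> \<xi> \<notin> D \<Longrightarrow> V \<xi> = wave_profile \<gamma> S y \<xi>" using m L(3) by auto
  have "V \<xi> = wave_profile \<gamma> S y \<xi>" if "\<xi> < s" "\<xi> \<notin> D" for \<xi>
    using y that V[of \<xi>] m wave_profile_after[OF S y(1,3), of \<xi>] by (cases "\<xi> < m") auto
  thus ?thesis using y by blast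
qed

end

section \<open>The classical Riemann problem\<close>

text \<open>
  The two half profiles are separated at the contact, which moves with the common velocity.
\<close>

definition riemann_profile :: "real \<Rightarrow> state \<Rightarrow> state \<Rightarrow> real \<Rightarrow> real \<Rightarrow> real \<Rightarrow> state" where
  "riemann_profile \<gamma> UL UR y z \<xi> =
     (if \<xi> < velocity (wave \<gamma> UL y) then wave_profile \<gamma> UL y \<xi>
      else mirror (wave_profile \<gamma> (mirror UR) z (- \<xi>)))"

text \<open>
  The waves of strengths \<open>y\<close> and \<open>z\<close> from the left and from the right lead to states that a contact can
  separate.
\<close>

definition waves_meet :: "real \<Rightarrow> state \<Rightarrow> state \<Rightarrow> real \<Rightarrow> real \<Rightarrow> bool" where
  "waves_meet \<gamma> UL UR y z \<longleftrightarrow> 0 < y \<and> 0 < z \<and>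
     velocity (wave \<gamma> UL y) = - velocity (wave \<gamma> (mirror UR) z) \<and>
     pressure (wave \<gamma> UL y) = pressure (wave \<gamma> (mirror UR) z)"

context
  fixes \<gamma> :: real
  assumes \<gamma>: "1 < \<gamma>"
begin

text \<open>
  A larger \<open>y\<close> means larger pressure and smaller velocity at the contact, but seen from the right
  larger pressure means larger velocity.
\<close>

lemma waves_meet_unique:
  assumes S: "is_state UL" "is_state UR" and m: "waves_meet \<gamma> UL UR y z" "waves_meet \<gamma> UL UR y' z'"
  shows "y = y'" "z = z'"
proof -
  have no_less: False if m: "waves_meet \<gamma> UL UR y z" "waves_meet \<gamma> UL UR y' z'" and "y < y'" for y z y' z'
  proof -
    let ?R = "mirror UR"
    have R: "is_state ?R" using S by simp
    have "pressure (wave \<gamma> ?R z) < pressure (wave \<gamma> ?R z')"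
      "velocity (wave \<gamma> ?R z) < velocity (wave \<gamma> ?R z')"
      using pressure_wave_strict_mono[OF \<gamma> S(1), of y y'] velocity_wave_strict_antimono[OF \<gamma> S(1), of y y']
        m \<open>y < y'\<close> by (auto simp: waves_meet_def)
    thus False
      using pressure_wave_strict_mono[OF \<gamma> R, of z' z] velocity_wave_strict_antimono[OF \<gamma> R, of z z'] m
      by (cases z z' rule: linorder_cases) (auto simp: waves_meet_def)
  qed
  show y: "y = y'" using no_less[OF m] no_less[OF m(2,1)] by (meson linorder_neqE)
  have "wave \<gamma> (mirror UR) z = wave \<gamma> (mirror UR) z' \<longrightarrow> z = z'"
    using wave_inject[OF \<gamma>, of "mirror UR" z z'] S m by (auto simp: waves_meet_def)
  moreover have "pressure (wave \<gamma> (mirror UR) z) = pressure (wave \<gamma> (mirror UR) z')"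
    using m y by (simp add: waves_meet_def)
  ultimately show "z = z'"
    using pressure_wave_strict_mono[OF \<gamma>, of "mirror UR" z z'] pressure_wave_strict_mono[OF \<gamma>, of "mirror UR" z' z] S m
    by (cases z z' rule: linorder_cases) (auto simp: waves_meet_def)
qed

text \<open>
  The contact is located at the supremum of the positions at which the gas is faster than the
  position. Shocks of the first family leave the gas behind them faster than themselves, and by
  reflection those of the third family find it slower, so only a contact can sit there.
\<close>

lemma crp_structure:
  assumes crp: "crp_solution \<gamma> UL UR V" and S: "is_state UL" "is_state UR"
  obtains y z where "waves_meet \<gamma> UL UR y z" "finite {\<xi>. V \<xi> \<noteq> riemann_profile \<gamma> UL UR y z \<xi>}"
proof -
  obtain D where pat: "wave_pattern \<gamma> D V" and lim: "(V \<longlongrightarrow> UL) at_bot" "(V \<longlongrightarrow> UR) at_top"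
    using crp_solution_wave_pattern[OF \<gamma> crp] .
  have fin: "finite D" using pat by (simp add: wave_pattern_def)
  define E where "E = {\<xi>. \<xi> \<notin> D \<and> \<xi> < velocity (V \<xi>)}"
  have "\<forall>\<^sub>F \<xi> in at_top. velocity (V \<xi>) < velocity UR + 1"
    by (rule order_tendstoD(2)[OF state_tendsto(1)[OF lim(2) S(2)]]) simp
  hence "\<forall>\<^sub>F \<xi> in at_top. velocity (V \<xi>) < velocity UR + 1 \<and> velocity UR + 1 \<le> \<xi>"
    by (intro eventually_conj eventually_ge_at_top)
  hence "\<forall>\<^sub>F \<xi> in at_top. velocity (V \<xi>) < \<xi>" by (rule eventually_mono) simp
  then obtain N where N: "\<And>\<xi>. N \<le> \<xi> \<Longrightarrow> velocity (V \<xi>) < \<xi>" by (auto simp: eventually_at_top_linorder)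
  have "\<xi> \<le> N" if "\<xi> \<in> E" for \<xi> using N[of \<xi>] that unfolding E_def by (cases "N \<le> \<xi>") auto
  hence bdd: "bdd_above E" by (rule bdd_aboveI)
  have "\<forall>\<^sub>F \<xi> in at_bot. velocity UL - 1 < velocity (V \<xi>)"
    by (rule order_tendstoD(1)[OF state_tendsto(1)[OF lim(1) S(1)]]) simp
  moreover have "\<forall>\<^sub>F \<xi> in at_bot. \<xi> < velocity UL - 1" by (rule eventually_gt_at_bot)
  moreover have "\<forall>\<^sub>F \<xi> in at_bot. \<forall>d\<in>D. \<xi> < d"
    using fin by (intro eventually_ball_finite ballI eventually_gt_at_bot)
  ultimately have "\<forall>\<^sub>F \<xi> in at_bot. \<xi> \<in> E" by eventually_elim (auto simp: E_def)
  hence ne: "E \<noteq> {}" using eventually_happens'[OF trivial_limit_at_bot_linorder] by blast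
  define s where "s = Sup E"
  obtain L R where LR: "is_state L" "is_state R" "(V \<longlongrightarrow> L) (at_left s)" "(V \<longlongrightarrow> R) (at_right s)"
      "admissible_jump \<gamma> s L R" "s \<notin> D \<Longrightarrow> L = V s" using wave_pattern_limits[OF pat] by metis
  have uR: "velocity R \<le> s"
  proof (rule ccontr)
    assume "\<not> velocity R \<le> s"
    hence mid: "s < (s + velocity R) / 2" "(s + velocity R) / 2 < velocity R" by auto
    have "\<forall>\<^sub>F \<xi> in at_right s. (s + velocity R) / 2 < velocity (V \<xi>)"
      by (rule order_tendstoD(1)[OF state_tendsto(1)[OF LR(4,2)] mid(2)])
    moreover have "\<forall>\<^sub>F \<xi> in at_right s. \<xi> < (s + velocity R) / 2"
      by (rule order_tendstoD(2)[OF tendsto_ident_at mid(1)])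
    moreover have "\<forall>\<^sub>F \<xi> in at_right s. s < \<xi>" by (rule eventually_at_right_less)
    moreover have "\<forall>\<^sub>F \<xi> in at_right s. \<forall>d\<in>D. \<xi> \<noteq> d"
      using fin by (intro eventually_ball_finite ballI eventually_neq_at_within)
    ultimately have "\<forall>\<^sub>F \<xi> in at_right s. \<xi> \<in> E \<and> s < \<xi>" by eventually_elim (auto simp: E_def)
    then obtain \<xi> where "\<xi> \<in> E" "s < \<xi>" using eventually_happens'[OF trivial_limit_at_right_real] by blast
    thus False using cSup_upper[OF _ bdd] unfolding s_def by fastforce
  qed
  have uL: "s \<le> velocity L"
  proof (rule ccontr)
    assume c: "\<not> s \<le> velocity L"
    hence mid: "(s + velocity L) / 2 < s" "velocity L < (s + velocity L) / 2" by auto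
    have "\<forall>\<^sub>F \<xi> in at_left s. velocity (V \<xi>) < (s + velocity L) / 2"
      by (rule order_tendstoD(2)[OF state_tendsto(1)[OF LR(3,1)] mid(2)])
    moreover have "\<forall>\<^sub>F \<xi> in at_left s. (s + velocity L) / 2 < \<xi>"
      by (rule order_tendstoD(1)[OF tendsto_ident_at mid(1)])
    ultimately have "\<forall>\<^sub>F \<xi> in at_left s. velocity (V \<xi>) < \<xi>" by eventually_elim simp
    then obtain b where b: "b < s" "\<And>\<xi>. b < \<xi> \<Longrightarrow> \<xi> < s \<Longrightarrow> velocity (V \<xi>) < \<xi>"
      by (auto simp: eventually_at_left_field)
    have "\<xi> \<le> b" if \<xi>: "\<xi> \<in> E" for \<xi>
    proof (rule ccontr)
      assume "\<not> \<xi> \<le> b"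
      moreover have "\<xi> \<le> s" using cSup_upper[OF \<xi> bdd] by (simp add: s_def)
      moreover have "\<xi> \<noteq> s" using LR(6) c \<xi> by (auto simp: E_def)
      ultimately show False using b(2)[of \<xi>] \<xi> by (auto simp: E_def)
    qed
    hence "s \<le> b" unfolding s_def by (intro cSup_least ne)
    thus False using b(1) by simp
  qed
  \<comment> \<open>A shock at \<open>s\<close> would contradict one of the two bounds by the Lax inequalities.\<close>
  have contact: "velocity L = s \<and> velocity R = s \<and> pressure R = pressure L"
  proof (rule admissible_jump_cases[OF \<gamma> LR(1,2,5)])
    assume "R = L" thus ?thesis using uL uR by simp
  next
    fix y assume "1 < y" "s = velocity L - sound_speed \<gamma> L * y" "R = wave \<gamma> L y"
    thus ?thesis using shock_lax(2)[OF \<gamma> LR(1), of y] uR by simp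
  next
    fix y assume "1 < y" "- s = velocity (mirror R) - sound_speed \<gamma> (mirror R) * y" "mirror L = wave \<gamma> (mirror R) y"
    moreover have "is_state (mirror R)" using LR(2) by simp
    ultimately have "- s < velocity (mirror L)" using shock_lax(2)[OF \<gamma>, of "mirror R" y] by simp
    thus ?thesis using uL by simp
  qed auto
  obtain y where y: "0 < y" "L = wave \<gamma> UL y" "\<And>\<xi>. \<xi> < s \<Longrightarrow> \<xi> \<notin> D \<Longrightarrow> V \<xi> = wave_profile \<gamma> UL y \<xi>"
    using left_structure_contact[OF \<gamma> pat lim(1) S(1) LR(1,3)] contact by auto
  let ?W = "\<lambda>\<xi>. mirror (V (- \<xi>))"
  have "(V \<longlongrightarrow> UR) (filtermap uminus at_bot)" using lim(2) by (simp add: at_top_mirror)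
  hence limW: "(?W \<longlongrightarrow> mirror UR) at_bot" by (intro tendsto_mirror) (simp add: filterlim_filtermap)
  have "(?W \<longlongrightarrow> mirror R) (at_left (- s))"
    unfolding at_left_minus[of "- s"] filterlim_filtermap minus_minus by (rule tendsto_mirror[OF LR(4)])
  hence "\<exists>z>0. mirror R = wave \<gamma> (mirror UR) z \<and>
      (\<forall>\<zeta>< - s. \<zeta> \<notin> uminus ` D \<longrightarrow> ?W \<zeta> = wave_profile \<gamma> (mirror UR) z \<zeta>)"
    by (intro left_structure_contact[OF \<gamma> wave_pattern_mirror[OF \<gamma> pat] limW])
      (use S LR(2) contact in simp_all)
  then obtain z where z: "0 < z" "mirror R = wave \<gamma> (mirror UR) z"
     "\<And>\<zeta>. \<zeta> < - s \<Longrightarrow> \<zeta> \<notin> uminus ` D \<Longrightarrow> ?W \<zeta> = wave_profile \<gamma> (mirror UR) z \<zeta>"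
    by (elim exE conjE) simp
  have "waves_meet \<gamma> UL UR y z"
    using contact y(1,2) z(1) unfolding waves_meet_def z(2)[symmetric] by simp
  moreover have "V \<xi> = riemann_profile \<gamma> UL UR y z \<xi>" if "\<xi> \<notin> insert s D" for \<xi>
  proof (cases "\<xi> < s")
    case True
    thus ?thesis using y contact that by (auto simp: riemann_profile_def)
  next
    case False
    hence "- \<xi> < - s" "- \<xi> \<notin> uminus ` D" using that by auto
    hence "mirror (?W (- \<xi>)) = mirror (wave_profile \<gamma> (mirror UR) z (- \<xi>))"
      by (intro arg_cong[of _ _ mirror] z(3))
    hence "V \<xi> = mirror (wave_profile \<gamma> (mirror UR) z (- \<xi>))" by (simp only: mirror_simps minus_minus)
    thus ?thesis using False contact y(2) by (simp add: riemann_profile_def)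
  qed
  hence "{\<xi>. V \<xi> \<noteq> riemann_profile \<gamma> UL UR y z \<xi>} \<subseteq> insert s D" by blast
  hence "finite {\<xi>. V \<xi> \<noteq> riemann_profile \<gamma> UL UR y z \<xi>}" using fin finite_subset by blast
  ultimately show ?thesis using that by blast
qed

text \<open>
  Since \<open>u\<^sub>- > 0\<close>, the position \<open>0\<close> lies to the left of the contact.
\<close>

lemma crp_left_half:
  assumes crp: "crp_solution \<gamma> S Um V" and S: "is_state S" "is_state Um"
    and lim: "(V \<longlongrightarrow> Um) (at_left 0)" and pos: "0 < velocity Um"
  obtains y where "0 < y" "Um = wave \<gamma> S y" "left_wave_before \<gamma> S y 0"
    "finite {\<xi>. \<xi> < 0 \<and> V \<xi> \<noteq> wave_profile \<gamma> S y \<xi>}"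
proof -
  obtain D where pat: "wave_pattern \<gamma> D V" and l: "(V \<longlongrightarrow> S) at_bot"
    using crp_solution_wave_pattern[OF \<gamma> crp] .
  from left_structure[OF \<gamma> pat l S(1) S(2) lim pos] obtain y where
    y: "0 < y" "Um = wave \<gamma> S y" "left_wave_before \<gamma> S y 0"
      "\<And>\<xi>. \<xi> < 0 \<Longrightarrow> \<xi> \<notin> D \<Longrightarrow> V \<xi> = wave_profile \<gamma> S y \<xi>" by blast
  have "{\<xi>. \<xi> < 0 \<and> V \<xi> \<noteq> wave_profile \<gamma> S y \<xi>} \<subseteq> D" using y(4) by blast
  hence "finite {\<xi>. \<xi> < 0 \<and> V \<xi> \<noteq> wave_profile \<gamma> S y \<xi>}"
    using pat finite_subset unfolding wave_pattern_def by blast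
  thus ?thesis using that y by blast
qed

text \<open>
  A shock of the first family into a state with \<open>u \<le> a\<close>, or such a fan into a state with \<open>u < a\<close>,
  would occupy negative positions, where the solution is constant.
\<close>

lemma crp_right_half:
  assumes crp: "crp_solution \<gamma> S UR V" and S: "is_state S" "is_state UR"
    and const: "\<And>\<xi>. \<xi> < 0 \<Longrightarrow> V \<xi> = S"
  obtains y z where "waves_meet \<gamma> S UR y z" "finite {\<xi>. V \<xi> \<noteq> riemann_profile \<gamma> S UR y z \<xi>}"
    "velocity S \<le> sound_speed \<gamma> S \<Longrightarrow> y \<le> 1" "velocity S < sound_speed \<gamma> S \<Longrightarrow> y = 1"
proof -
  obtain y z where m: "waves_meet \<gamma> S UR y z" and fin: "finite {\<xi>. V \<xi> \<noteq> riemann_profile \<gamma> S UR y z \<xi>}"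
    using crp_structure[OF crp S] .
  have y: "0 < y" using m by (simp add: waves_meet_def)
  let ?u = "velocity (wave \<gamma> S y)"
  have ex: "\<exists>\<xi>. a < \<xi> \<and> \<xi> < 0 \<and> \<xi> < ?u \<and> wave_profile \<gamma> S y \<xi> = S" if "a < 0" "a < ?u" for a
  proof -
    have "infinite {a<..<min 0 ?u}" using that by (intro infinite_Ioo) auto
    from infinite_imp_nonempty[OF Diff_infinite_finite[OF fin this]]
    obtain \<xi> where \<xi>: "a < \<xi>" "\<xi> < 0" "\<xi> < ?u" "V \<xi> = riemann_profile \<gamma> S UR y z \<xi>" by auto
    thus ?thesis using const[of \<xi>] by (auto simp: riemann_profile_def)
  qed
  have le: "y \<le> 1" if sub: "velocity S \<le> sound_speed \<gamma> S"
  proof (rule ccontr)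
    assume "\<not> y \<le> 1"
    hence y1: "1 < y" by simp
    note lax = shock_lax[OF \<gamma> S(1) y1]
    obtain \<xi> where "velocity S - sound_speed \<gamma> S * y < \<xi>" "wave_profile \<gamma> S y \<xi> = S"
      using ex[of "velocity S - sound_speed \<gamma> S * y"] lax(2,3) sub by force
    hence "wave \<gamma> S y = wave \<gamma> S 1" using y1 by (simp add: wave_profile_def wave_1[OF \<gamma>])
    thus False using wave_inject[OF \<gamma> S(1) y, of 1] y1 by simp
  qed
  have "y = 1" if sub: "velocity S < sound_speed \<gamma> S"
  proof (rule ccontr)
    assume "y \<noteq> 1"
    hence y1: "y < 1" using le sub by simp
    let ?c = "left_speed \<gamma> S"
    have "?c < ?u" using velocity_wave_strict_antimono[OF \<gamma> S(1) y y1] sound_speed_pos[OF \<gamma> S(1)]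
      by (simp add: wave_1[OF \<gamma>])
    then obtain \<xi> where \<xi>: "?c < \<xi>" "wave_profile \<gamma> S y \<xi> = S" using ex[of ?c] sub by auto
    have "fan_param \<gamma> S \<xi> < fan_param \<gamma> S ?c" using fan_param_less_iff[OF \<gamma> S(1)] \<xi>(1) by simp
    also have "fan_param \<gamma> S ?c = 1" using fan_param_char_speed[OF \<gamma> S(1), of 1] by (simp add: wave_1[OF \<gamma>])
    finally have lt: "max y (min 1 (fan_param \<gamma> S \<xi>)) < 1" using y1 by simp
    have "wave \<gamma> S (max y (min 1 (fan_param \<gamma> S \<xi>))) = wave \<gamma> S 1"
      using \<xi>(2) y1 by (simp add: wave_profile_def wave_1[OF \<gamma>])
    hence "max y (min 1 (fan_param \<gamma> S \<xi>)) = 1" by (rule wave_inject[OF \<gamma> S(1), rotated 2]) (use y in auto)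
    thus False using lt by simp
  qed
  thus ?thesis using that m fin le by blast
qed

end

section \<open>Heat addition\<close>

text \<open>
  The quantity \<open>1 / M\<^sup>2\<close>, in which the heating relations are polynomial.
\<close>

definition char_ratio :: "real \<Rightarrow> state \<Rightarrow> real" where
  "char_ratio \<gamma> s = (sound_speed \<gamma> s / velocity s)\<^sup>2"

text \<open>
  The energy balance for \<open>q = u\<^sub>+ / u\<^sub>-\<close> and \<open>z = 1 / M\<^sub>-\<^sup>2\<close>, after elimination of density and pressure.
  Its roots are \<open>q = (\<gamma> + z \<plusminus> I) / (\<gamma> + 1)\<close>, the smaller one being \<open>\<phi>\<close>.
\<close>

definition heat_balance :: "real \<Rightarrow> real \<Rightarrow> real \<Rightarrow> real \<Rightarrow> bool" where
  "heat_balance \<gamma> k z q \<longleftrightarrow> (\<gamma> + 1) * q\<^sup>2 - 2 * (\<gamma> + z) * q + (1 + k) * (\<gamma> - 1 + 2 * z) = 0"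

text \<open>
  The values \<open>1 / M\<^sub>*\<^sup>2\<close> and \<open>1 / M\<^sub>*\<^sub>*\<^sup>2\<close> are the roots of the radicand of \<open>I\<close> in \<open>z = 1 / M\<^sup>2\<close>. The second one
  is positive only for \<open>k (\<gamma>\<^sup>2 - 1) < 1\<close>; then \<open>M\<^sub>*\<^sub>*\<close> is finite.
\<close>

definition z_star :: "real \<Rightarrow> real \<Rightarrow> real" where
  "z_star \<gamma> k = 1 + k * (\<gamma> + 1) + (\<gamma> + 1) * sqrt (k * (k + 1))"

definition z_star_star :: "real \<Rightarrow> real \<Rightarrow> real" where
  "z_star_star \<gamma> k = 1 + k * (\<gamma> + 1) - (\<gamma> + 1) * sqrt (k * (k + 1))"

context
  fixes \<gamma> :: real
  assumes \<gamma>: "1 < \<gamma>"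
begin

lemma char_ratio_pos: "is_state s \<Longrightarrow> 0 < velocity s \<Longrightarrow> 0 < char_ratio \<gamma> s"
  using sound_speed_pos[OF \<gamma>, of s] by (simp add: char_ratio_def)

lemma char_ratio_gt_1_iff:
  assumes "is_state s" "0 < velocity s"
  shows "1 < char_ratio \<gamma> s \<longleftrightarrow> velocity s < sound_speed \<gamma> s" "char_ratio \<gamma> s < 1 \<longleftrightarrow> sound_speed \<gamma> s < velocity s"
proof -
  have r: "0 < sound_speed \<gamma> s / velocity s" using sound_speed_pos[OF \<gamma> assms(1)] assms(2) by simp
  have "1 < char_ratio \<gamma> s \<longleftrightarrow> 1 < sound_speed \<gamma> s / velocity s"
    unfolding char_ratio_def using r by (metis less_imp_le one_less_power pos2 power_le_one not_le)
  thus "1 < char_ratio \<gamma> s \<longleftrightarrow> velocity s < sound_speed \<gamma> s" using assms by simp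
  have "char_ratio \<gamma> s < 1 \<longleftrightarrow> sound_speed \<gamma> s / velocity s < 1"
    unfolding char_ratio_def using r by (simp add: power_less_one_iff)
  thus "char_ratio \<gamma> s < 1 \<longleftrightarrow> sound_speed \<gamma> s < velocity s" using assms by simp
qed

lemma velocity_le_sound_speed_iff:
  assumes "is_state s" "0 < velocity s"
  shows "velocity s \<le> sound_speed \<gamma> s \<longleftrightarrow> density s * (velocity s)\<^sup>2 \<le> \<gamma> * pressure s"
proof -
  have "velocity s \<le> sound_speed \<gamma> s \<longleftrightarrow> (velocity s)\<^sup>2 \<le> (sound_speed \<gamma> s)\<^sup>2"
    using assms sound_speed_pos[OF \<gamma> assms(1)] by (simp add: power_mono_iff)
  also have "\<dots> \<longleftrightarrow> density s * (velocity s)\<^sup>2 \<le> \<gamma> * pressure s"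
    unfolding sound_speed_squared[OF \<gamma> assms(1)] using assms(1)
    by (simp add: is_state_def pos_le_divide_eq mult.commute)
  finally show ?thesis .
qed

lemma sound_speed_le_velocity_iff:
  assumes "is_state s" "0 < velocity s"
  shows "sound_speed \<gamma> s \<le> velocity s \<longleftrightarrow> \<gamma> * pressure s \<le> density s * (velocity s)\<^sup>2"
proof -
  have "sound_speed \<gamma> s \<le> velocity s \<longleftrightarrow> (sound_speed \<gamma> s)\<^sup>2 \<le> (velocity s)\<^sup>2"
    using assms sound_speed_pos[OF \<gamma> assms(1)] by (simp add: power_mono_iff)
  also have "\<dots> \<longleftrightarrow> \<gamma> * pressure s \<le> density s * (velocity s)\<^sup>2"
    unfolding sound_speed_squared[OF \<gamma> assms(1)] using assms(1)
    by (simp add: is_state_def pos_divide_le_eq mult.commute)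
  finally show ?thesis .
qed

text \<open>
  The sign of \<open>M\<^sub>+ - 1\<close> tells on which side of the vertex of the quadratic its root \<open>q\<close> lies.
\<close>

lemma heating_jump_ratio:
  assumes S: "is_state Um" "is_state Up" and pos: "0 < velocity Um" and heat: "heating_jump \<gamma> k Um Up"
    and z: "z = char_ratio \<gamma> Um" and q: "q = velocity Up / velocity Um"
  shows "0 < q" "density Up = density Um / q" "velocity Up = q * velocity Um"
    "pressure Up = pressure Um * (1 + \<gamma> * (1 - q) / z)" "heat_balance \<gamma> k z q"
    "velocity Up \<le> sound_speed \<gamma> Up \<longleftrightarrow> (\<gamma> + 1) * q \<le> \<gamma> + z"
    "sound_speed \<gamma> Up \<le> velocity Up \<longleftrightarrow> \<gamma> + z \<le> (\<gamma> + 1) * q"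
proof -
  let ?r = "density Um" and ?u = "velocity Um" and ?p = "pressure Um"
  let ?R = "density Up" and ?U = "velocity Up" and ?P = "pressure Up"
  have st: "0 < ?r" "0 < ?p" "0 < ?R" "0 < ?P" using S by (auto simp: is_state_def)
  have h: "?r * ?u = ?R * ?U" "?r * ?u\<^sup>2 + ?p = ?R * ?U\<^sup>2 + ?P"
    "(1/2 * ?u\<^sup>2 + enthalpy \<gamma> Um) * (1 + k) = 1/2 * ?U\<^sup>2 + enthalpy \<gamma> Up"
    using heat by (auto simp: heating_jump_def)
  have "0 < ?R * ?U" using h(1) st pos by (metis mult_pos_pos)
  hence U: "0 < ?U" using st by (simp add: zero_less_mult_iff)
  show q0: "0 < q" and vq: "?U = q * ?u" using U pos q by simp_all
  have "?r * ?u = ?R * q * ?u" using h(1) vq by simp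
  hence rq: "?r = ?R * q" using pos by simp
  show R: "?R = ?r / q" using rq q0 by simp
  have z0: "0 < z" using char_ratio_pos[OF S(1) pos] z by simp
  have "z * ?u\<^sup>2 = (sound_speed \<gamma> Um)\<^sup>2" using pos by (simp add: z char_ratio_def power_divide)
  hence zu: "z * ?u\<^sup>2 = \<gamma> * ?p / ?r" using sound_speed_squared[OF \<gamma> S(1)] by simp
  hence zr: "?r * ?u\<^sup>2 = \<gamma> * ?p / z" using st z0 by (simp add: field_simps)
  have "?R * ?U\<^sup>2 = (?r * ?u\<^sup>2) * q" unfolding vq rq by (simp add: power2_eq_square)
  hence RU: "?R * ?U\<^sup>2 = \<gamma> * ?p / z * q" using zr by simp
  have "?P = ?r * ?u\<^sup>2 + ?p - ?R * ?U\<^sup>2" using h(2) by simp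
  hence P: "?P = \<gamma> * ?p / z * (1 - q) + ?p" unfolding RU zr by (simp add: right_diff_distrib)
  thus "?P = ?p * (1 + \<gamma> * (1 - q) / z)" by (simp add: distrib_left mult_ac)
  have e1: "(\<gamma> - 1) * enthalpy \<gamma> Um = z * ?u\<^sup>2"
    using \<gamma> zu by (simp add: enthalpy_def)
  have "?P = ?r * ?u\<^sup>2 * (1 - q) + ?p" using P zr by simp
  moreover have "\<gamma> * ?p = z * ?u\<^sup>2 * ?r" using zu st by simp
  ultimately have "\<gamma> * ?P = ?r * (?u\<^sup>2 * (\<gamma> * (1 - q) + z))" by algebra
  hence e2: "(\<gamma> - 1) * enthalpy \<gamma> Up = q * (?u\<^sup>2 * (\<gamma> * (1 - q) + z))"
    using \<gamma> st q0 R by (simp add: enthalpy_def)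
  have "((\<gamma> - 1) * ?u\<^sup>2 + 2 * ((\<gamma> - 1) * enthalpy \<gamma> Um)) * (1 + k) =
     (\<gamma> - 1) * ?U\<^sup>2 + 2 * ((\<gamma> - 1) * enthalpy \<gamma> Up)"
    using h(3) by algebra
  hence "?u\<^sup>2 * ((\<gamma> + 1) * q\<^sup>2 - 2 * (\<gamma> + z) * q + (1 + k) * (\<gamma> - 1 + 2 * z)) = 0"
    unfolding e1 e2 vq by algebra
  thus "heat_balance \<gamma> k z q" using pos by (simp add: heat_balance_def)
  have gP: "\<gamma> * ?P = \<gamma> * ?p / z * (\<gamma> * (1 - q) + z)" unfolding P using z0 by (simp add: field_simps)
  have c: "0 < \<gamma> * ?p / z" using \<gamma> st z0 by simp
  have le: "q \<le> \<gamma> * (1 - q) + z \<longleftrightarrow> (\<gamma> + 1) * q \<le> \<gamma> + z"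
    and ge: "\<gamma> * (1 - q) + z \<le> q \<longleftrightarrow> \<gamma> + z \<le> (\<gamma> + 1) * q" by (simp_all add: algebra_simps)
  show "?U \<le> sound_speed \<gamma> Up \<longleftrightarrow> (\<gamma> + 1) * q \<le> \<gamma> + z"
    unfolding velocity_le_sound_speed_iff[OF S(2) U] RU gP le[symmetric] using c by (rule mult_le_cancel_left_pos)
  show "sound_speed \<gamma> Up \<le> ?U \<longleftrightarrow> \<gamma> + z \<le> (\<gamma> + 1) * q"
    unfolding sound_speed_le_velocity_iff[OF S(2) U] RU gP ge[symmetric] using c by (rule mult_le_cancel_left_pos)
qed

lemma heat_discriminant:
  assumes "0 < k"
  shows "(\<gamma> + z)\<^sup>2 - (\<gamma> + 1) * (1 + k) * (\<gamma> - 1 + 2 * z) = (z - z_star \<gamma> k) * (z - z_star_star \<gamma> k)"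
proof -
  define w where "w = sqrt (k * (k + 1))"
  have "w\<^sup>2 = k * (k + 1)" using assms by (simp add: w_def)
  thus ?thesis unfolding z_star_def z_star_star_def w_def[symmetric] by algebra
qed

lemma heat_balance_discriminant:
  assumes "0 < k" "heat_balance \<gamma> k z q"
  shows "((\<gamma> + 1) * q - (\<gamma> + z))\<^sup>2 = (z - z_star \<gamma> k) * (z - z_star_star \<gamma> k)"
  using assms(2) unfolding heat_balance_def heat_discriminant[OF assms(1), symmetric] by algebra

lemma z_star_bounds:
  assumes "0 < k"
  shows "1 + k * (\<gamma> + 1) < z_star \<gamma> k" "1 < z_star \<gamma> k" "z_star_star \<gamma> k < 1"
proof -
  have "sqrt (k\<^sup>2) < sqrt (k * (k + 1))"
    using assms by (intro real_sqrt_less_mono) (simp add: power2_eq_square algebra_simps)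
  hence "k < sqrt (k * (k + 1))" using assms by simp
  hence "(\<gamma> + 1) * k < (\<gamma> + 1) * sqrt (k * (k + 1))" using \<gamma> by simp
  thus "z_star_star \<gamma> k < 1" by (simp add: z_star_star_def mult.commute)
  have "0 < (\<gamma> + 1) * sqrt (k * (k + 1))" "0 < k * (\<gamma> + 1)" using assms \<gamma> by simp_all
  thus "1 + k * (\<gamma> + 1) < z_star \<gamma> k" "1 < z_star \<gamma> k" by (simp_all add: z_star_def)
qed

lemma z_star_mult:
  assumes "0 < k" shows "z_star \<gamma> k * z_star_star \<gamma> k = 1 - k * (\<gamma>\<^sup>2 - 1)"
proof -
  define w where "w = sqrt (k * (k + 1))"
  have "w\<^sup>2 = k * (k + 1)" using assms by (simp add: w_def)
  thus ?thesis unfolding z_star_def z_star_star_def w_def[symmetric] by algebra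
qed

text \<open>
  The discriminant is negative between \<open>z\<^sub>*\<^sub>*\<close> and \<open>z\<^sub>*\<close>, in particular at \<open>z = 1\<close>: no stationary flow
  can take up the heat if \<open>M\<^sub>-\<close> is too close to \<open>1\<close>.
\<close>

lemma choking:
  assumes "0 < k" "heat_balance \<gamma> k z q"
  shows "z \<noteq> 1" "1 < z \<Longrightarrow> z_star \<gamma> k \<le> z" "z < 1 \<Longrightarrow> z \<le> z_star_star \<gamma> k"
proof -
  note b = z_star_bounds[OF assms(1)]
  have n: "0 \<le> (z - z_star \<gamma> k) * (z - z_star_star \<gamma> k)"
    unfolding heat_balance_discriminant[OF assms, symmetric] by simp
  show "z \<noteq> 1" using n b(2,3) by (auto simp: zero_le_mult_iff)
  show "z_star \<gamma> k \<le> z" if "1 < z" using n b(3) that by (auto simp: zero_le_mult_iff)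
  show "z \<le> z_star_star \<gamma> k" if "z < 1" using n b(2) that by (auto simp: zero_le_mult_iff)
qed

text \<open>
  The flow behind the source is sonic only for a double root.
\<close>

lemma unchoked:
  assumes "0 < k" "heat_balance \<gamma> k z q" "z_star \<gamma> k < z"
  shows "(\<gamma> + 1) * q \<noteq> \<gamma> + z"
proof
  assume "(\<gamma> + 1) * q = \<gamma> + z"
  hence "(z - z_star \<gamma> k) * (z - z_star_star \<gamma> k) = 0"
    using heat_balance_discriminant[OF assms(1,2)] by simp
  thus False using assms(3) z_star_bounds[OF assms(1)] by auto
qed

lemma heat_balance_branch_unique:
  assumes "heat_balance \<gamma> k z q" "heat_balance \<gamma> k z q'"
    and "((\<gamma> + 1) * q \<le> \<gamma> + z \<and> (\<gamma> + 1) * q' \<le> \<gamma> + z) \<or> (\<gamma> + z \<le> (\<gamma> + 1) * q \<and> \<gamma> + z \<le> (\<gamma> + 1) * q')"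
  shows "q = q'"
proof -
  have "(q - q') * ((\<gamma> + 1) * q + (\<gamma> + 1) * q' - 2 * (\<gamma> + z)) = 0"
    using assms(1,2) unfolding heat_balance_def by algebra
  hence "q = q' \<or> (\<gamma> + 1) * q + (\<gamma> + 1) * q' = 2 * (\<gamma> + z)" by auto
  thus ?thesis
  proof
    assume "(\<gamma> + 1) * q + (\<gamma> + 1) * q' = 2 * (\<gamma> + z)"
    hence "(\<gamma> + 1) * q = (\<gamma> + 1) * q'" using assms(3) by argo
    thus ?thesis using \<gamma> by simp
  qed
qed

text \<open>
  The quadratic is positive at \<open>1 + k\<close>, a point to the left of its vertex.
\<close>

lemma subsonic_ratio_gt:
  assumes k: "0 < k" and q: "heat_balance \<gamma> k z q" "(\<gamma> + 1) * q \<le> \<gamma> + z" and z: "z_star \<gamma> k \<le> z"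
  shows "1 + k < q"
proof (rule ccontr)
  assume "\<not> 1 + k < q"
  hence "0 \<le> 1 + k - q" by simp
  moreover have "(\<gamma> + 1) * (1 + k) + (\<gamma> + 1) * q - 2 * (\<gamma> + z) \<le> 0"
    using q(2) z z_star_bounds(1)[OF k] by (simp add: algebra_simps)
  ultimately have "(1 + k - q) * ((\<gamma> + 1) * (1 + k) + (\<gamma> + 1) * q - 2 * (\<gamma> + z)) \<le> 0"
    by (rule mult_nonneg_nonpos)
  moreover have "(1 + k - q) * ((\<gamma> + 1) * (1 + k) + (\<gamma> + 1) * q - 2 * (\<gamma> + z)) = (\<gamma> + 1) * k * (1 + k)"
    using q(1) unfolding heat_balance_def by algebra
  moreover have "0 < (\<gamma> + 1) * k * (1 + k)" using k \<gamma> by simp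
  ultimately show False by simp
qed

text \<open>
  In \<open>z\<close> the quadratic is affine with slope \<open>2 (1 + k - q)\<close>, which is negative at the smaller root \<open>q\<close>.
  So for larger \<open>z\<close> it is negative at the old root, that is, the smaller root has decreased. The second
  inequality compares the pressure ratios \<open>p\<^sub>+ / p\<^sub>-\<close>.
\<close>

lemma subsonic_ratio_strict_antimono:
  assumes k: "0 < k" and q: "heat_balance \<gamma> k z q" "(\<gamma> + 1) * q \<le> \<gamma> + z"
    and q': "heat_balance \<gamma> k z' q'" "(\<gamma> + 1) * q' \<le> \<gamma> + z'" and z: "z_star \<gamma> k \<le> z" "z < z'"
  shows "q' < q" "1 + \<gamma> * (1 - q) / z < 1 + \<gamma> * (1 - q') / z'"
proof -
  have gt: "1 + k < q" "1 + k < q'" using subsonic_ratio_gt[OF k] q q' z by simp_all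
  show lt: "q' < q"
  proof (rule ccontr)
    assume "\<not> q' < q"
    hence "q - q' \<le> 0" by simp
    moreover have "(\<gamma> + 1) * q + (\<gamma> + 1) * q' - 2 * (\<gamma> + z') \<le> 0" using q(2) q'(2) z by simp
    ultimately have "0 \<le> (q - q') * ((\<gamma> + 1) * q + (\<gamma> + 1) * q' - 2 * (\<gamma> + z'))" by (rule mult_nonpos_nonpos)
    moreover have "(q - q') * ((\<gamma> + 1) * q + (\<gamma> + 1) * q' - 2 * (\<gamma> + z')) = 2 * (z' - z) * (1 + k - q)"
      using q(1) q'(1) unfolding heat_balance_def by algebra
    moreover have "2 * (z' - z) * (1 + k - q) < 0" using z gt(1) by (intro mult_pos_neg) auto
    ultimately show False by simp
  qed
  have zp: "0 < z" using z z_star_bounds(2)[OF k] by simp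
  have "(q' - 1) / z' < (q - 1) / z" using lt gt k z zp by (intro frac_less) auto
  hence "\<gamma> * ((q' - 1) / z') < \<gamma> * ((q - 1) / z)" using \<gamma> by (intro mult_strict_left_mono) auto
  moreover have "\<gamma> * (1 - x) / w = - (\<gamma> * ((x - 1) / w))" for x w :: real
    by (simp add: minus_divide_left right_diff_distrib)
  ultimately show "1 + \<gamma> * (1 - q) / z < 1 + \<gamma> * (1 - q') / z'" by simp
qed

lemma heating_jump_regime:
  assumes k: "0 < k" and S: "is_state Um" "is_state Up" and pos: "0 < velocity Um" and heat: "heating_jump \<gamma> k Um Up"
  obtains (subsonic) "velocity Um < sound_speed \<gamma> Um" "z_star \<gamma> k \<le> char_ratio \<gamma> Um" "velocity Up \<le> sound_speed \<gamma> Up"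
    | (supersonic) "sound_speed \<gamma> Um < velocity Um" "char_ratio \<gamma> Um \<le> z_star_star \<gamma> k" "sound_speed \<gamma> Up \<le> velocity Up"
proof -
  note h = heating_jump_ratio[OF S pos heat refl refl]
  note c = choking[OF k h(5)]
  have br: "velocity Um < sound_speed \<gamma> Um \<Longrightarrow> velocity Up \<le> sound_speed \<gamma> Up"
    "sound_speed \<gamma> Um < velocity Um \<Longrightarrow> sound_speed \<gamma> Up \<le> velocity Up"
    using heat sound_speed_pos[OF \<gamma> S(1)] sound_speed_pos[OF \<gamma> S(2)]
    by (auto simp: heating_jump_def mach_def)
  show ?thesis
  proof (cases "1 < char_ratio \<gamma> Um")
    case True
    thus ?thesis using subsonic br(1) c(2) char_ratio_gt_1_iff(1)[OF S(1) pos] by blast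
  next
    case False
    hence "char_ratio \<gamma> Um < 1" using c(1) by simp
    thus ?thesis using supersonic br(2) c(3) char_ratio_gt_1_iff(2)[OF S(1) pos] by blast
  qed
qed

lemma heating_jump_unique:
  assumes k: "0 < k" and S: "is_state Um" "is_state Up" "is_state Up'" and pos: "0 < velocity Um"
    and heat: "heating_jump \<gamma> k Um Up" "heating_jump \<gamma> k Um Up'"
  shows "Up = Up'"
proof -
  note h = heating_jump_ratio[OF S(1,2) pos heat(1) refl refl]
  note h' = heating_jump_ratio[OF S(1,3) pos heat(2) refl refl]
  have "(velocity Up \<le> sound_speed \<gamma> Up \<and> velocity Up' \<le> sound_speed \<gamma> Up') \<or>
    (sound_speed \<gamma> Up \<le> velocity Up \<and> sound_speed \<gamma> Up' \<le> velocity Up')"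
    by (rule heating_jump_regime[OF k S(1,2) pos heat(1)]; rule heating_jump_regime[OF k S(1,3) pos heat(2)]) auto
  hence "velocity Up / velocity Um = velocity Up' / velocity Um"
    using heat_balance_branch_unique[OF h(5) h'(5)] h(6,7) h'(6,7) by blast
  hence "velocity Up = velocity Up'" using pos by simp
  thus ?thesis using h(2,4) h'(2,4) by (intro state_eqI) simp_all
qed

end

section \<open>Shocks ahead of a choked flow and the function Y\<close>

text \<open>
  Ratio of the sound speeds behind and ahead of a shock of relative Mach number \<open>y\<close>.
\<close>

definition shock_sound :: "real \<Rightarrow> real \<Rightarrow> real" where
  "shock_sound \<gamma> y = sqrt (f2 \<gamma> y 0 * f3 \<gamma> y 0)"

text \<open>
  Loss of velocity across such a shock, in units of the sound speed ahead. It is also the velocity gained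
  across a shock of the third family.
\<close>

definition shock_drop :: "real \<Rightarrow> real \<Rightarrow> real" where
  "shock_drop \<gamma> y = 2 / (\<gamma> + 1) * (y - 1 / y)"

text \<open>
  The Mach number ahead of the left shock for which the Mach number behind it is \<open>M\<^sub>*\<close>. Solving
  \<open>M\<^sub>* = f5 M\<^sub>1 (M\<^sub>1 - y)\<close> for \<open>M\<^sub>1\<close> is explicit, and this replaces the implicit function \<open>f6\<close>.
\<close>

definition incident_mach :: "real \<Rightarrow> real \<Rightarrow> real \<Rightarrow> real" where
  "incident_mach \<gamma> k y = shock_sound \<gamma> y / sqrt (z_star \<gamma> k) + shock_drop \<gamma> y"

text \<open>
  The velocity gained across a shock of the third family with pressure ratio \<open>P\<close> in units of the sound
  speed ahead, in the form used in \<open>X_fun\<close>; it is meaningful and monotone for all \<open>P > 0\<close>.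
\<close>

definition back_shock_velocity :: "real \<Rightarrow> real \<Rightarrow> real" where
  "back_shock_velocity \<gamma> P = sqrt (2 / (\<gamma> - 1) / \<gamma>) * ((P - 1) / sqrt (1 + (\<gamma> + 1) / (\<gamma> - 1) * P))"

text \<open>
  The velocity ratio \<open>\<phi>(M\<^sub>*)\<close> and the pressure ratio \<open>\<psi>(M\<^sub>*)\<close>, at which the flow behind the source
  is sonic.
\<close>

definition q_star :: "real \<Rightarrow> real \<Rightarrow> real" where
  "q_star \<gamma> k = (\<gamma> + z_star \<gamma> k) / (\<gamma> + 1)"

definition p_star :: "real \<Rightarrow> real \<Rightarrow> real" where
  "p_star \<gamma> k = 1 + \<gamma> * (1 - q_star \<gamma> k) / z_star \<gamma> k"

text \<open>
  The function \<open>Y\<close> in the parameter \<open>y\<close>, so that no inverse function is involved in its continuity.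
\<close>

definition Y_shock :: "real \<Rightarrow> real \<Rightarrow> real \<Rightarrow> real" where
  "Y_shock \<gamma> k y = q_star \<gamma> k * (shock_sound \<gamma> y / sqrt (z_star \<gamma> k)) - incident_mach \<gamma> k y
     - back_shock_velocity \<gamma> (f2 \<gamma> y 0 * p_star \<gamma> k)"

context
  fixes \<gamma> :: real
  assumes \<gamma>: "1 < \<gamma>"
begin

lemma shock_drop_strict_mono: "0 < x \<Longrightarrow> x < y \<Longrightarrow> shock_drop \<gamma> x < shock_drop \<gamma> y"
proof -
  assume "0 < x" "x < y"
  moreover from this have "1 / y < 1 / x" by (simp add: frac_less2)
  ultimately show ?thesis using \<gamma> unfolding shock_drop_def by (intro mult_strict_left_mono) auto
qed

lemma shock_drop_1 [simp]: "shock_drop \<gamma> 1 = 0" by (simp add: shock_drop_def)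

lemma shock_sound_1 [simp]: "shock_sound \<gamma> 1 = 1"
  using f2_1[OF \<gamma>] f3_1[OF \<gamma>] by (simp add: shock_sound_def)

lemma shock_sound_strict_mono: "1 \<le> x \<Longrightarrow> x < y \<Longrightarrow> shock_sound \<gamma> x < shock_sound \<gamma> y"
  unfolding shock_sound_def using f2_f3_strict_mono[OF \<gamma>] by simp

lemma shock_sound_pos: "1 \<le> y \<Longrightarrow> 0 < shock_sound \<gamma> y"
  using shock_sound_strict_mono[of 1 y] by (cases "y = 1") auto

lemma velocity_behind_shock: "1 < y \<Longrightarrow> velocity (wave \<gamma> S y) = velocity S - sound_speed \<gamma> S * shock_drop \<gamma> y"
  by (simp add: velocity_wave shock_drop_def mult.assoc)

lemma sound_speed_behind_shock:
  "is_state S \<Longrightarrow> 1 < y \<Longrightarrow> sound_speed \<gamma> (wave \<gamma> S y) = sound_speed \<gamma> S * shock_sound \<gamma> y"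
  by (simp add: sound_speed_wave[OF \<gamma>] shock_sound_def)

lemma incident_mach_strict_mono:
  assumes "0 < k" "1 \<le> x" "x < y" shows "incident_mach \<gamma> k x < incident_mach \<gamma> k y"
proof -
  have "0 < sqrt (z_star \<gamma> k)" using z_star_bounds(2)[OF \<gamma> assms(1)] by simp
  hence "shock_sound \<gamma> x / sqrt (z_star \<gamma> k) < shock_sound \<gamma> y / sqrt (z_star \<gamma> k)"
    using shock_sound_strict_mono assms by (intro divide_strict_right_mono) auto
  thus ?thesis using shock_drop_strict_mono[of x y] assms by (simp add: incident_mach_def)
qed

text \<open>
  Unless \<open>z\<^sub>*\<^sub>* = 0\<close>, the radicand in \<open>M_star\<close> is \<open>z\<^sub>*\<^sub>* / (z\<^sub>* z\<^sub>*\<^sub>*)\<close>.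
\<close>

lemma M_star_eq: assumes "0 < k" shows "M_star \<gamma> k = 1 / sqrt (z_star \<gamma> k)"
proof -
  note zm = z_star_mult[OF \<gamma> assms] and zp = z_star_bounds(2)[OF \<gamma> assms]
  have "M_star \<gamma> k = sqrt (1 / z_star \<gamma> k)"
  proof (cases "k * (\<gamma>\<^sup>2 - 1) = 1")
    case True
    hence "z_star_star \<gamma> k = 0" using zm zp by auto
    hence "z_star \<gamma> k = 2 * (k * (\<gamma> + 1) + 1)" by (simp add: z_star_def z_star_star_def)
    thus ?thesis using True by (simp add: M_star_def)
  next
    case False
    hence ne: "z_star_star \<gamma> k \<noteq> 0" using zm by auto
    have "k * (\<gamma> + 1) + 1 - (\<gamma> + 1) * sqrt (k * (k + 1)) = z_star_star \<gamma> k" by (simp add: z_star_star_def)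
    hence "M_star \<gamma> k = sqrt (z_star_star \<gamma> k / (z_star \<gamma> k * z_star_star \<gamma> k))"
      unfolding zm using False by (simp add: M_star_def)
    thus ?thesis using ne by simp
  qed
  thus ?thesis by (simp add: real_sqrt_divide)
qed

lemma M_star_star_eq:
  assumes "0 < k" "k * (\<gamma>\<^sup>2 - 1) < 1"
  shows "0 < z_star_star \<gamma> k" "M_star_star \<gamma> k = ereal (1 / sqrt (z_star_star \<gamma> k))"
proof -
  note zm = z_star_mult[OF \<gamma> assms(1)] and zp = z_star_bounds(2)[OF \<gamma> assms(1)]
  have "0 < z_star \<gamma> k * z_star_star \<gamma> k" using zm assms by simp
  thus "0 < z_star_star \<gamma> k" using zp by (simp add: zero_less_mult_iff)
  have "k * (\<gamma> + 1) + 1 + (\<gamma> + 1) * sqrt (k * (k + 1)) = z_star \<gamma> k" by (simp add: z_star_def)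
  hence "M_star_star \<gamma> k = ereal (sqrt (z_star \<gamma> k / (z_star \<gamma> k * z_star_star \<gamma> k)))"
    unfolding zm using assms by (simp add: M_star_star_def)
  thus "M_star_star \<gamma> k = ereal (1 / sqrt (z_star_star \<gamma> k))" using zp by (simp add: real_sqrt_divide)
qed

lemma f5_behind_shock:
  assumes "1 \<le> y" shows "f5 \<gamma> M (M - y) = (M - shock_drop \<gamma> y) / shock_sound \<gamma> y"
proof -
  have g: "\<gamma> + 1 \<noteq> 0" "0 < y" using \<gamma> assms by auto
  have num: "((\<gamma> - 1) * M + 2 * (M - y)) * y + 2 = ((\<gamma> + 1) * y) * (M - shock_drop \<gamma> y)"
  proof -
    have "G * y * (2 / G * (y - 1 / y)) = 2 * y * y - 2" if "G \<noteq> 0" for G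
      using that g(2) by (simp add: field_simps)
    from this[OF g(1)] have "(\<gamma> + 1) * y * shock_drop \<gamma> y = 2 * y * y - 2"
      unfolding shock_drop_def .
    thus ?thesis by algebra
  qed
  have "2 * \<gamma> * (\<gamma> - 1) * y ^ 4 + (6 * \<gamma> - \<gamma>\<^sup>2 - 1) * y\<^sup>2 - 2 * (\<gamma> - 1)
      = ((\<gamma> + 1) * y)\<^sup>2 * (f2 \<gamma> y 0 * f3 \<gamma> y 0)"
  proof -
    have "(G * y)\<^sup>2 * ((A * y\<^sup>2 + B - C / y\<^sup>2) / G\<^sup>2) = A * y ^ 4 + B * y\<^sup>2 - C" if "G \<noteq> 0" for A B C G :: real
      using that g(2) by (simp add: field_simps power2_eq_square power4_eq_xxxx)
    from this[OF g(1)] show ?thesis unfolding f2_f3[OF \<gamma> g(2)] by simp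
  qed
  hence "sqrt (2 * \<gamma> * (\<gamma> - 1) * y ^ 4 + (6 * \<gamma> - \<gamma>\<^sup>2 - 1) * y\<^sup>2 - 2 * (\<gamma> - 1))
      = ((\<gamma> + 1) * y) * shock_sound \<gamma> y"
    using \<gamma> g by (simp add: real_sqrt_mult shock_sound_def)
  moreover have "M - (M - y) = y" by simp
  ultimately have "f5 \<gamma> M (M - y) = ((\<gamma> + 1) * y) * (M - shock_drop \<gamma> y) / (((\<gamma> + 1) * y) * shock_sound \<gamma> y)"
    by (simp only: f5_def num)
  also have "\<dots> = (M - shock_drop \<gamma> y) / shock_sound \<gamma> y"
  proof (rule mult_divide_mult_cancel_left)
    show "(\<gamma> + 1) * y \<noteq> 0" using g by simp
  qed
  finally show ?thesis .
qed

lemma f6_incident_mach: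
  assumes k: "0 < k" and y: "1 \<le> y"
  shows "f6 \<gamma> (incident_mach \<gamma> k y) (M_star \<gamma> k) = incident_mach \<gamma> k y - y"
proof -
  have zp: "0 < sqrt (z_star \<gamma> k)" using z_star_bounds(2)[OF \<gamma> k] by simp
  have eq: "M_star \<gamma> k = f5 \<gamma> M (M - x) \<longleftrightarrow> M = incident_mach \<gamma> k x" if "1 \<le> x" for M x
    using zp shock_sound_pos[OF that]
    by (auto simp: f5_behind_shock[OF that] M_star_eq[OF k] incident_mach_def field_simps)
  let ?M = "incident_mach \<gamma> k y"
  show ?thesis unfolding f6_def
  proof (rule the_equality)
    show "M_star \<gamma> k = f5 \<gamma> ?M (?M - y) \<and> 1 \<le> ?M - (?M - y)" using eq[OF y] y by simp
  next
    fix s assume s: "M_star \<gamma> k = f5 \<gamma> ?M s \<and> 1 \<le> ?M - s"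
    have "?M = incident_mach \<gamma> k (?M - s)" using eq[of "?M - s" ?M] s by simp
    hence "y = ?M - s" using incident_mach_strict_mono[OF k, of y "?M - s"]
        incident_mach_strict_mono[OF k, of "?M - s" y] s y by (cases y "?M - s" rule: linorder_cases) auto
    thus "s = ?M - y" by simp
  qed
qed

lemma q_star_eq: "(\<gamma> + 1) * q_star \<gamma> k = \<gamma> + z_star \<gamma> k"
  using \<gamma> by (simp add: q_star_def)

lemma p_star_eq:
  assumes k: "0 < k"
  shows "p_star \<gamma> k = (\<gamma> + z_star \<gamma> k) / (z_star \<gamma> k * (\<gamma> + 1))"
proof -
  note zp = z_star_bounds(2)[OF \<gamma> k]
  have "p_star \<gamma> k * z_star \<gamma> k = z_star \<gamma> k + \<gamma> * (1 - q_star \<gamma> k)"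
    using zp by (simp add: p_star_def distrib_right)
  hence "p_star \<gamma> k * (z_star \<gamma> k * (\<gamma> + 1)) = \<gamma> + z_star \<gamma> k"
    using q_star_eq[of k] by algebra
  moreover have "z_star \<gamma> k * (\<gamma> + 1) \<noteq> 0" using zp \<gamma> by simp
  ultimately show ?thesis by (simp only: eq_divide_eq) simp
qed

lemma phi_psi_star:
  assumes k: "0 < k"
  shows "phi_fun \<gamma> k (M_star \<gamma> k) = q_star \<gamma> k" "psi_fun \<gamma> k (M_star \<gamma> k) = p_star \<gamma> k"
proof -
  have zp: "0 < z_star \<gamma> k" using z_star_bounds(2)[OF \<gamma> k] by simp
  have M: "(M_star \<gamma> k)\<^sup>2 = 1 / z_star \<gamma> k" using zp by (simp add: M_star_eq[OF k] power_divide)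
  have "(\<gamma> + z)\<^sup>2 - 2 * (\<gamma> + 1) * (z + (\<gamma> - 1) / 2) * (1 + k) =
     (\<gamma> + z)\<^sup>2 - (\<gamma> + 1) * (1 + k) * (\<gamma> - 1 + 2 * z)" for z by (simp add: field_simps)
  hence I: "I_fun \<gamma> k (M_star \<gamma> k) = 0" using zp
    by (simp add: I_fun_def M heat_discriminant[OF \<gamma> k])
  show "phi_fun \<gamma> k (M_star \<gamma> k) = q_star \<gamma> k" using zp by (simp add: phi_fun_def I M q_star_def)
  show "psi_fun \<gamma> k (M_star \<gamma> k) = p_star \<gamma> k" using zp
    by (simp add: psi_fun_def I M p_star_eq[OF k])
qed

lemma Y_fun_incident_mach:
  assumes k: "0 < k" and y: "1 \<le> y"
  shows "Y_fun \<gamma> k (incident_mach \<gamma> k y) = Y_shock \<gamma> k y"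
proof -
  let ?M = "incident_mach \<gamma> k y"
  have zp: "0 < sqrt (z_star \<gamma> k)" using z_star_bounds(2)[OF \<gamma> k] by simp
  have "0 \<le> shock_drop \<gamma> y" using shock_drop_strict_mono[of 1 y] y by (cases "y = 1") auto
  hence M: "0 < ?M" using shock_sound_pos[OF y] zp by (simp add: incident_mach_def add_pos_nonneg)
  have f23: "f2 \<gamma> ?M (?M - y) = f2 \<gamma> y 0" "f3 \<gamma> ?M (?M - y) = f3 \<gamma> y 0" by (simp_all add: f2_def f3_def)
  have "?M * f4 \<gamma> ?M (?M - y) = ?M - y + y * f3 \<gamma> y 0"
    using M by (simp add: f4_def f23 field_simps)
  also have "\<dots> = shock_sound \<gamma> y / sqrt (z_star \<gamma> k)"
    using shock_velocity[OF \<gamma>, of y] y by (simp add: incident_mach_def shock_drop_def)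
  finally have f4: "?M * f4 \<gamma> ?M (?M - y) = shock_sound \<gamma> y / sqrt (z_star \<gamma> k)" .
  have "?M * (f4 \<gamma> ?M (?M - y) * q_star \<gamma> k - 1) = q_star \<gamma> k * (?M * f4 \<gamma> ?M (?M - y)) - ?M"
    by (simp add: algebra_simps)
  thus ?thesis
    by (simp add: Y_fun_def X_fun_def Let_def f6_incident_mach[OF k y] phi_psi_star[OF k] f23 f4
        Y_shock_def back_shock_velocity_def mult.assoc)
qed

lemma back_shock_velocity_f2:
  assumes "0 < z" shows "back_shock_velocity \<gamma> (f2 \<gamma> z 0) = shock_drop \<gamma> z"
proof -
  have g: "0 < \<gamma> - 1" "0 < \<gamma>" "0 < \<gamma> + 1" using \<gamma> by auto
  have a: "1 + (\<gamma> + 1) / (\<gamma> - 1) * f2 \<gamma> z 0 = 2 * \<gamma> / (\<gamma> - 1) * z\<^sup>2"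
  proof -
    have "(\<gamma> + 1) / (\<gamma> - 1) * f2 \<gamma> z 0 = (2 * \<gamma> * z\<^sup>2 - (\<gamma> - 1)) / (\<gamma> - 1)"
      using g by (simp add: f2_def)
    also have "\<dots> = 2 * \<gamma> * z\<^sup>2 / (\<gamma> - 1) - (\<gamma> - 1) / (\<gamma> - 1)" by (rule diff_divide_distrib)
    also have "\<dots> = 2 * \<gamma> / (\<gamma> - 1) * z\<^sup>2 - 1" using g by (subst divide_self) auto
    finally show ?thesis by simp
  qed
  have b: "f2 \<gamma> z 0 - 1 = \<gamma> * z * shock_drop \<gamma> z"
  proof -
    have "G * (\<gamma> * z * (2 / G * (z - 1 / z))) = 2 * \<gamma> * z\<^sup>2 - 2 * \<gamma>" if "G \<noteq> 0" for G
      using that assms by (simp add: field_simps power2_eq_square)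
    from this[of "\<gamma> + 1"] have "(\<gamma> + 1) * (\<gamma> * z * shock_drop \<gamma> z) = 2 * \<gamma> * z\<^sup>2 - 2 * \<gamma>"
      unfolding shock_drop_def using g by fastforce
    moreover have "(\<gamma> + 1) * f2 \<gamma> z 0 = 2 * \<gamma> * z\<^sup>2 - \<gamma> + 1" using g by (simp add: f2_def)
    ultimately have "(\<gamma> + 1) * (f2 \<gamma> z 0 - 1) = (\<gamma> + 1) * (\<gamma> * z * shock_drop \<gamma> z)" by algebra
    thus ?thesis using g by simp
  qed
  have "2 / (\<gamma> - 1) / \<gamma> = (2 * \<gamma> / (\<gamma> - 1)) / \<gamma>\<^sup>2" using g by (simp add: power2_eq_square)
  hence c: "sqrt (2 / (\<gamma> - 1) / \<gamma>) = sqrt (2 * \<gamma> / (\<gamma> - 1)) / \<gamma>"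
    using g by (simp only: real_sqrt_divide real_sqrt_abs)
  define w where "w = sqrt (2 * \<gamma> / (\<gamma> - 1))"
  have w: "0 < w" using g by (simp add: w_def)
  have "sqrt (2 * \<gamma> / (\<gamma> - 1) * z\<^sup>2) = w * z"
    unfolding real_sqrt_mult[of "2 * \<gamma> / (\<gamma> - 1)" "z\<^sup>2"] w_def using assms by simp
  thus ?thesis unfolding back_shock_velocity_def a b c w_def[symmetric] using w g assms by simp
qed

lemma back_shock_velocity_strict_mono:
  assumes "0 < P" "P < P'" shows "back_shock_velocity \<gamma> P < back_shock_velocity \<gamma> P'"
proof -
  define z where "z = (\<lambda>P. sqrt (((\<gamma> + 1) * P + (\<gamma> - 1)) / (2 * \<gamma>)))"
  have pos: "0 < z P" and inv: "f2 \<gamma> (z P) 0 = P" if "0 < P" for P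
  proof -
    have n: "0 < ((\<gamma> + 1) * P + (\<gamma> - 1)) / (2 * \<gamma>)" using that \<gamma> by (intro divide_pos_pos add_pos_pos) auto
    thus "0 < z P" by (simp add: z_def)
    have "(z P)\<^sup>2 = ((\<gamma> + 1) * P + (\<gamma> - 1)) / (2 * \<gamma>)" using n by (simp add: z_def)
    thus "f2 \<gamma> (z P) 0 = P" using \<gamma> by (simp add: f2_def field_simps)
  qed
  have "z P < z P'" using assms \<gamma> by (simp add: z_def divide_strict_right_mono)
  thus ?thesis using back_shock_velocity_f2[OF pos] inv assms shock_drop_strict_mono[OF pos] by (metis less_trans)
qed

text \<open>
  A standing shock ahead of the source preserves mass, momentum and energy flux and therefore takes
  \<open>M\<^sub>*\<^sub>*\<close> to \<open>M\<^sub>*\<close>; this is the identity \<open>2 \<gamma> = (\<gamma> - 1) (z\<^sub>* + z\<^sub>*\<^sub>*) + 2 z\<^sub>* z\<^sub>*\<^sub>*\<close>. For a larger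
  incoming Mach number \<open>m\<close>, or a shock that moves to the left (\<open>m < y\<close>), the Mach number behind it
  is smaller.
\<close>

lemma standing_shock_chokes:
  assumes k: "0 < k" and y: "1 < y" and m: "0 < m" "m < y" "1 / m\<^sup>2 \<le> z_star_star \<gamma> k"
    and v: "0 < m - shock_drop \<gamma> y"
  shows "z_star \<gamma> k < (shock_sound \<gamma> y / (m - shock_drop \<gamma> y))\<^sup>2"
proof -
  let ?a = "z_star \<gamma> k" and ?b = "z_star_star \<gamma> k" and ?v = "m - shock_drop \<gamma> y"
  note zp = z_star_bounds(2)[OF \<gamma> k]
  have f: "0 < f3 \<gamma> y 0" "0 < f2 \<gamma> y 0" using f3_pos[OF \<gamma>] f2_gt_1[OF \<gamma> y] y by auto
  have "?a + ?b = 2 + 2 * (k * (\<gamma> + 1))" by (simp add: z_star_def z_star_star_def)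
  hence id: "2 * \<gamma> = (\<gamma> - 1) * (?a + ?b) + 2 * (?a * ?b)"
    unfolding z_star_mult[OF \<gamma> k] by (simp add: algebra_simps power2_eq_square)
  have "1 \<le> ?b * m\<^sup>2" using m by (simp add: pos_divide_le_eq)
  moreover have "m\<^sup>2 \<le> y\<^sup>2" using m by (simp add: power_mono)
  moreover have "0 < ?b" using m by (smt (verit) zero_less_divide_1_iff zero_less_power)
  ultimately have "1 \<le> ?b * y\<^sup>2" by (meson mult_left_mono order.trans less_imp_le)
  hence "0 \<le> (?b * y\<^sup>2 - 1) * ((\<gamma> - 1) + 2 * ?a)" using zp \<gamma> by (intro mult_nonneg_nonneg) auto
  also have "\<dots> = y\<^sup>2 * ((\<gamma> - 1) * ?b + 2 * (?a * ?b)) - (\<gamma> - 1) - 2 * ?a" by (simp add: algebra_simps)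
  also have "(\<gamma> - 1) * ?b + 2 * (?a * ?b) = 2 * \<gamma> - (\<gamma> - 1) * ?a" using id by (simp add: algebra_simps)
  finally have "?a * ((\<gamma> - 1) * y\<^sup>2 + 2) \<le> 2 * \<gamma> * y\<^sup>2 - \<gamma> + 1" by (simp add: algebra_simps)
  hence "(?a * ((\<gamma> - 1) * y\<^sup>2 + 2)) / (\<gamma> + 1) \<le> (2 * \<gamma> * y\<^sup>2 - \<gamma> + 1) / (\<gamma> + 1)"
    using \<gamma> by (intro divide_right_mono) auto
  moreover have "(?a * ((\<gamma> - 1) * y\<^sup>2 + 2)) / (\<gamma> + 1) = ?a * (y\<^sup>2 * f3 \<gamma> y 0)"
    using y by (simp add: f3_def)
  moreover have "(2 * \<gamma> * y\<^sup>2 - \<gamma> + 1) / (\<gamma> + 1) = f2 \<gamma> y 0" by (simp add: f2_def)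
  ultimately have le: "?a * (y\<^sup>2 * f3 \<gamma> y 0) \<le> f2 \<gamma> y 0" by (simp only:)
  have "?v < y * f3 \<gamma> y 0" using shock_velocity[OF \<gamma>, of y] y m by (simp add: shock_drop_def)
  hence "?v\<^sup>2 < (y * f3 \<gamma> y 0)\<^sup>2" using v by (intro power_strict_mono) auto
  hence "?a * ?v\<^sup>2 < ?a * (y * f3 \<gamma> y 0)\<^sup>2" using zp by simp
  also have "\<dots> = ?a * (y\<^sup>2 * f3 \<gamma> y 0) * f3 \<gamma> y 0" by (simp add: power2_eq_square)
  also have "\<dots> \<le> f2 \<gamma> y 0 * f3 \<gamma> y 0" using le f by (intro mult_right_mono) auto
  also have "\<dots> = (shock_sound \<gamma> y)\<^sup>2" using f by (simp add: shock_sound_def)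
  finally show ?thesis using v by (simp add: power_divide pos_less_divide_eq)
qed

text \<open>
  With \<open>\<sigma>\<close> the shock speed, the Rankine-Hugoniot relations give \<open>[\<rho> u\<^sup>2 + p] = \<sigma> [\<rho> u] = \<sigma>\<^sup>2 [\<rho>] \<ge> 0\<close>,
  and ahead of the shock the momentum flux, in units of the pressure, is \<open>1 + \<gamma> m\<^sup>2\<close>.
\<close>

lemma momentum_flux_rises:
  assumes y: "1 < y" and m: "1 < m"
  shows "1 + \<gamma> < f2 \<gamma> y 0 + \<gamma> * (m - shock_drop \<gamma> y)\<^sup>2 / f3 \<gamma> y 0"
proof -
  let ?f = "f3 \<gamma> y 0"
  have f: "0 < ?f" using f3_pos[OF \<gamma>] y by simp
  have y2: "0 < y\<^sup>2" "1 < y\<^sup>2" using y by (simp_all add: one_less_power)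
  have "(\<gamma> - 1) * y\<^sup>2 + 2 < (\<gamma> + 1) * y\<^sup>2" using y2 by (simp add: algebra_simps)
  hence f1: "?f < 1" using y2 \<gamma> by (simp add: f3_def)
  have v: "m - shock_drop \<gamma> y = (m - y) + y * ?f" using shock_velocity[OF \<gamma>, of y] y by (simp add: shock_drop_def)
  have "(m - y)\<^sup>2 * 1 \<le> (m - y)\<^sup>2 * (1 / ?f)" using f f1 by (intro mult_left_mono) (auto simp: field_simps)
  moreover have "(m - shock_drop \<gamma> y)\<^sup>2 / ?f = (m - y)\<^sup>2 * (1 / ?f) + 2 * (m - y) * y + y\<^sup>2 * ?f"
    unfolding v using f by (simp add: field_simps power2_eq_square)
  ultimately have "m\<^sup>2 - y\<^sup>2 + y\<^sup>2 * ?f \<le> (m - shock_drop \<gamma> y)\<^sup>2 / ?f"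
    by (simp add: power2_eq_square algebra_simps)
  hence "\<gamma> * (m\<^sup>2 - y\<^sup>2 + y\<^sup>2 * ?f) \<le> \<gamma> * ((m - shock_drop \<gamma> y)\<^sup>2 / ?f)"
    using \<gamma> by (intro mult_left_mono) auto
  moreover have "f2 \<gamma> y 0 + \<gamma> * (y\<^sup>2 * ?f) = 1 + \<gamma> * y\<^sup>2"
  proof -
    have "(\<gamma> + 1) * f2 \<gamma> y 0 = 2 * \<gamma> * y\<^sup>2 - \<gamma> + 1" using \<gamma> by (simp add: f2_def)
    moreover have "(\<gamma> + 1) * (y\<^sup>2 * ?f) = (\<gamma> - 1) * y\<^sup>2 + 2" using y2 \<gamma> by (simp add: f3_def)
    ultimately have "(\<gamma> + 1) * (f2 \<gamma> y 0 + \<gamma> * (y\<^sup>2 * ?f)) = (\<gamma> + 1) * (1 + \<gamma> * y\<^sup>2)" by algebra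
    thus ?thesis using \<gamma> by simp
  qed
  moreover have "\<gamma> < \<gamma> * m\<^sup>2" using \<gamma> m by (simp add: one_less_power)
  ultimately show ?thesis by (simp add: algebra_simps)
qed

lemma heat_balance_star: "0 < k \<Longrightarrow> heat_balance \<gamma> k (z_star \<gamma> k) (q_star \<gamma> k)"
proof -
  note q = q_star_eq[of k]
  assume k: "0 < k"
  have "(\<gamma> + z_star \<gamma> k)\<^sup>2 - (\<gamma> + 1) * (1 + k) * (\<gamma> - 1 + 2 * z_star \<gamma> k) = 0"
    unfolding heat_discriminant[OF \<gamma> k] by simp
  hence "(\<gamma> + 1) * ((\<gamma> + 1) * (q_star \<gamma> k)\<^sup>2 - 2 * (\<gamma> + z_star \<gamma> k) * q_star \<gamma> k
      + (1 + k) * (\<gamma> - 1 + 2 * z_star \<gamma> k)) = 0"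
    using q by algebra
  thus "heat_balance \<gamma> k (z_star \<gamma> k) (q_star \<gamma> k)" using \<gamma> by (simp add: heat_balance_def)
qed

lemma p_star_pos: "0 < k \<Longrightarrow> 0 < p_star \<gamma> k"
proof -
  assume k: "0 < k"
  show ?thesis unfolding p_star_eq[OF k] using z_star_bounds(2)[OF \<gamma> k] \<gamma> by simp
qed

lemma continuous_on_shock_functions:
  "continuous_on {1..} (shock_sound \<gamma>)" "continuous_on {1..} (incident_mach \<gamma> k)"
proof -
  show s: "continuous_on {1..} (shock_sound \<gamma>)"
    unfolding shock_sound_def f2_def f3_def using \<gamma> by (intro continuous_intros) auto
  have "continuous_on {1..} (shock_drop \<gamma>)"
    unfolding shock_drop_def by (intro continuous_intros) auto
  thus "continuous_on {1..} (incident_mach \<gamma> k)"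
    unfolding incident_mach_def divide_inverse by (intro continuous_intros s)
qed

lemma continuous_on_Y_shock: assumes k: "0 < k" shows "continuous_on {1..} (Y_shock \<gamma> k)"
proof -
  have "0 < f2 \<gamma> y 0" if "1 \<le> y" for y using f2_gt_1[OF \<gamma>, of y] f2_1[OF \<gamma>] that by (cases "y = 1") auto
  hence pos: "0 < 1 + (\<gamma> + 1) / (\<gamma> - 1) * (f2 \<gamma> y 0 * p_star \<gamma> k)" if "1 \<le> y" for y
    using that p_star_pos[OF k] \<gamma> by (intro add_pos_pos mult_pos_pos divide_pos_pos) auto
  have f: "continuous_on {1..} (\<lambda>y. f2 \<gamma> y 0)" unfolding f2_def using \<gamma> by (intro continuous_intros) auto
  have "continuous_on {1..} (\<lambda>y. back_shock_velocity \<gamma> (f2 \<gamma> y 0 * p_star \<gamma> k))"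
    unfolding back_shock_velocity_def
    by (intro continuous_intros f) (use pos in force)
  moreover have "continuous_on {1..} (\<lambda>y. q_star \<gamma> k * (shock_sound \<gamma> y * inverse (sqrt (z_star \<gamma> k))))"
    by (intro continuous_intros continuous_on_shock_functions)
  ultimately show ?thesis unfolding Y_shock_def divide_inverse
    by (intro continuous_on_diff continuous_on_shock_functions)
qed

text \<open>
  Equality holds for \<open>k (\<gamma>\<^sup>2 - 1) = 1\<close>, when \<open>z\<^sub>*\<^sub>* = 0\<close>.
\<close>

lemma z_star_le: assumes k: "0 < k" "k * (\<gamma>\<^sup>2 - 1) \<le> 1" shows "z_star \<gamma> k \<le> 2 * \<gamma> / (\<gamma> - 1)"
proof (rule ccontr)
  let ?Z = "2 * \<gamma> / (\<gamma> - 1)"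
  assume "\<not> z_star \<gamma> k \<le> ?Z"
  hence lt: "?Z < z_star \<gamma> k" by simp
  have "k * (\<gamma> + 1) * (\<gamma> - 1) \<le> 1" using k(2) by (simp add: power2_eq_square algebra_simps)
  hence "k * (\<gamma> + 1) \<le> 1 / (\<gamma> - 1)" using \<gamma> by (simp add: pos_le_divide_eq)
  moreover have Z: "?Z = 2 + 2 / (\<gamma> - 1)" using \<gamma> by (simp add: field_simps)
  ultimately have "2 * (1 + k * (\<gamma> + 1)) \<le> ?Z" by simp
  moreover have "z_star \<gamma> k + z_star_star \<gamma> k = 2 * (1 + k * (\<gamma> + 1))" by (simp add: z_star_def z_star_star_def)
  ultimately have s: "z_star \<gamma> k + z_star_star \<gamma> k \<le> ?Z" by simp
  have "0 \<le> z_star \<gamma> k * z_star_star \<gamma> k" unfolding z_star_mult[OF \<gamma> k(1)] using k(2) by simp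
  hence "0 \<le> z_star_star \<gamma> k" using z_star_bounds(2)[OF \<gamma> k(1)] by (simp add: zero_le_mult_iff)
  thus False using s lt by simp
qed

text \<open>
  For a strong shock \<open>u\<^sub>+\<close> stays below \<open>u\<^sub>1\<close> while \<open>p\<^sub>+\<close> exceeds \<open>p\<^sub>1\<close>, so both terms of \<open>Y\<close> are
  nonpositive. For the velocities this requires \<open>z\<^sub>*\<close> not to exceed \<open>2 \<gamma> / (\<gamma> - 1)\<close>, which is where
  \<open>k (\<gamma>\<^sup>2 - 1) \<le> 1\<close> enters.
\<close>

lemma Y_shock_eventually_nonpos:
  assumes k: "0 < k" "k * (\<gamma>\<^sup>2 - 1) \<le> 1" and b: "1 \<le> b"
  shows "\<exists>y>b. Y_shock \<gamma> k y \<le> 0"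
proof -
  let ?z = "z_star \<gamma> k"
  note zp = z_star_bounds(2)[OF \<gamma> k(1)] and pp = p_star_pos[OF k(1)]
  define T where "T = 3 + 2 / (\<gamma> - 1) + 1 / p_star \<gamma> k + b\<^sup>2"
  define y where "y = sqrt T"
  have parts: "0 < 2 / (\<gamma> - 1)" "0 < 1 / p_star \<gamma> k" "0 < b\<^sup>2" using \<gamma> pp b by simp_all
  have T: "b\<^sup>2 < T" "1 < T" "1 / p_star \<gamma> k \<le> T" "3 + 2 / (\<gamma> - 1) \<le> T" using parts unfolding T_def by linarith+
  have yb: "b < y" unfolding y_def by (rule real_less_rsqrt) (rule T(1))
  have y2: "y\<^sup>2 = T" using T by (simp add: y_def)
  have y1: "1 < y" using yb b by simp
  \<comment> \<open>Because of the summand \<open>1 / p_star\<close> in \<open>T\<close> the pressure behind the source exceeds the initial one.\<close>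
  have "(\<gamma> + 1) * T \<le> 2 * \<gamma> * T - \<gamma> + 1"
  proof -
    have "(\<gamma> - 1) * 1 \<le> (\<gamma> - 1) * T" using T \<gamma> by (intro mult_left_mono) auto
    thus ?thesis by (simp add: algebra_simps)
  qed
  hence "T \<le> f2 \<gamma> y 0" using \<gamma> y2 by (simp add: f2_def pos_le_divide_eq mult.commute)
  hence "1 / p_star \<gamma> k \<le> f2 \<gamma> y 0" using T by simp
  hence P: "1 \<le> f2 \<gamma> y 0 * p_star \<gamma> k" using pp by (simp add: pos_divide_le_eq)
  have "0 \<le> back_shock_velocity \<gamma> (f2 \<gamma> y 0 * p_star \<gamma> k)"
    unfolding back_shock_velocity_def using P \<gamma> by (intro mult_nonneg_nonneg divide_nonneg_nonneg) auto
  \<comment> \<open>The bound \<open>z\<^sub>* \<le> 2 \<gamma> / (\<gamma> - 1)\<close> becomes \<open>2 \<gamma> (\<gamma> - 1) (z\<^sub>* - 1)\<^sup>2 \<le> (\<gamma> + 1)\<^sup>2 z\<^sub>*\<close>, which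
     controls the velocity for strong shocks, where the sound speed grows like \<open>sqrt (2 \<gamma> (\<gamma> - 1)) y / (\<gamma> + 1)\<close>.\<close>
  moreover have "(q_star \<gamma> k - 1) * (shock_sound \<gamma> y / sqrt ?z) \<le> shock_drop \<gamma> y"
  proof -
    have "0 \<le> (2 * \<gamma> / (\<gamma> - 1) - ?z) * (?z - (\<gamma> - 1) / (2 * \<gamma>))"
    proof (intro mult_nonneg_nonneg)
      have "(\<gamma> - 1) / (2 * \<gamma>) \<le> 1" using \<gamma> by simp
      thus "0 \<le> ?z - (\<gamma> - 1) / (2 * \<gamma>)" using zp by simp
    qed (use z_star_le[OF k] in simp)
    hence "0 \<le> (2 * \<gamma> * (\<gamma> - 1)) * ((2 * \<gamma> / (\<gamma> - 1) - ?z) * (?z - (\<gamma> - 1) / (2 * \<gamma>)))"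
      using \<gamma> by simp
    also have "\<dots> = (2 * \<gamma> - (\<gamma> - 1) * ?z) * (2 * \<gamma> * ?z - (\<gamma> - 1))"
    proof -
      have cancel: "G * (x - c / G) = G * x - c" "G * (c / G - x) = c - G * x" if "G \<noteq> 0" for G x c :: real
        using that by (simp_all add: right_diff_distrib)
      have "(2 * \<gamma> * (\<gamma> - 1)) * ((2 * \<gamma> / (\<gamma> - 1) - ?z) * (?z - (\<gamma> - 1) / (2 * \<gamma>))) =
        ((\<gamma> - 1) * (2 * \<gamma> / (\<gamma> - 1) - ?z)) * (2 * \<gamma> * (?z - (\<gamma> - 1) / (2 * \<gamma>)))" by simp
      also have "(\<gamma> - 1) * (2 * \<gamma> / (\<gamma> - 1) - ?z) = 2 * \<gamma> - (\<gamma> - 1) * ?z"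
        using \<gamma> by (intro cancel) simp
      also have "2 * \<gamma> * (?z - (\<gamma> - 1) / (2 * \<gamma>)) = 2 * \<gamma> * ?z - (\<gamma> - 1)"
        using \<gamma> by (intro cancel) simp
      finally show ?thesis .
    qed
    finally have zz: "(?z - 1)\<^sup>2 * (2 * \<gamma> * (\<gamma> - 1)) \<le> (\<gamma> + 1)\<^sup>2 * ?z"
      by (simp add: power2_eq_square algebra_simps)
    have cc: "(\<gamma> + 1)\<^sup>2 * (shock_sound \<gamma> y)\<^sup>2 \<le> 2 * \<gamma> * ((\<gamma> - 1) * T + 2)"
    proof -
      have "(shock_sound \<gamma> y)\<^sup>2 = f2 \<gamma> y 0 * f3 \<gamma> y 0"
        using f2_gt_1[OF \<gamma> y1] f3_pos[OF \<gamma>, of y] y1 by (simp add: shock_sound_def)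
      also have "\<dots> = (2 * \<gamma> * T - \<gamma> + 1) / T * ((\<gamma> - 1) * T + 2) / (\<gamma> + 1)\<^sup>2"
        by (simp add: f2_def f3_def y2) (simp add: power2_eq_square mult_ac)
      finally have "(\<gamma> + 1)\<^sup>2 * (shock_sound \<gamma> y)\<^sup>2 = (2 * \<gamma> * T - \<gamma> + 1) / T * ((\<gamma> - 1) * T + 2)"
        using \<gamma> by simp
      also have "\<dots> \<le> 2 * \<gamma> * ((\<gamma> - 1) * T + 2)"
      proof (rule mult_right_mono)
        show "(2 * \<gamma> * T - \<gamma> + 1) / T \<le> 2 * \<gamma>" using T \<gamma> by (simp add: pos_divide_le_eq)
        show "0 \<le> (\<gamma> - 1) * T + 2" using T \<gamma> by simp
      qed
      finally show ?thesis .
    qed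
    have dd: "((\<gamma> - 1) * T + 2) \<le> 4 * (\<gamma> - 1) * (y - 1 / y)\<^sup>2"
    proof -
      have "T - 2 \<le> (y - 1 / y)\<^sup>2"
        using y1 y2 by (simp add: power2_diff)
      hence "(\<gamma> - 1) * (4 * (T - 2)) \<le> (\<gamma> - 1) * (4 * (y - 1 / y)\<^sup>2)" using \<gamma> by simp
      moreover have "(\<gamma> - 1) * (3 + 2 / (\<gamma> - 1)) \<le> (\<gamma> - 1) * T" using T(4) \<gamma> by (intro mult_left_mono) auto
      moreover have "G * (3 + 2 / G) = 3 * G + 2" if "G \<noteq> 0" for G :: real
        using that by (simp add: distrib_left)
      from this[of "\<gamma> - 1"] have "(\<gamma> - 1) * (3 + 2 / (\<gamma> - 1)) = 3 * (\<gamma> - 1) + 2" using \<gamma> by simp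
      ultimately show ?thesis using \<gamma> by (simp add: algebra_simps)
    qed
    have "((?z - 1) * ((\<gamma> + 1) * shock_sound \<gamma> y))\<^sup>2 = (?z - 1)\<^sup>2 * ((\<gamma> + 1)\<^sup>2 * (shock_sound \<gamma> y)\<^sup>2)"
      by (simp add: power_mult_distrib)
    also have "\<dots> \<le> (?z - 1)\<^sup>2 * (2 * \<gamma> * ((\<gamma> - 1) * T + 2))" using cc by (intro mult_left_mono) auto
    also have "\<dots> \<le> (?z - 1)\<^sup>2 * (2 * \<gamma> * (4 * (\<gamma> - 1) * (y - 1 / y)\<^sup>2))" using dd \<gamma> by (intro mult_left_mono) auto
    also have "\<dots> = (?z - 1)\<^sup>2 * (2 * \<gamma> * (\<gamma> - 1)) * (4 * (y - 1 / y)\<^sup>2)" by simp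
    also have "\<dots> \<le> (\<gamma> + 1)\<^sup>2 * ?z * (4 * (y - 1 / y)\<^sup>2)" using zz by (intro mult_right_mono) auto
    also have "\<dots> = ((\<gamma> + 1) * (sqrt ?z * (2 * (y - 1 / y))))\<^sup>2"
      unfolding power_mult_distrib using zp by simp
    finally have "(?z - 1) * ((\<gamma> + 1) * shock_sound \<gamma> y) \<le> (\<gamma> + 1) * (sqrt ?z * (2 * (y - 1 / y)))"
    proof (rule power2_le_imp_le)
      have "1 / y \<le> 1" using y1 by simp
      hence "1 / y \<le> y" using y1 by linarith
      thus "0 \<le> (\<gamma> + 1) * (sqrt ?z * (2 * (y - 1 / y)))" using zp \<gamma> by simp
    qed
    hence main: "(?z - 1) * shock_sound \<gamma> y \<le> sqrt ?z * (2 * (y - 1 / y))" using \<gamma> by simp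
    have "q_star \<gamma> k - 1 = (?z - 1) / (\<gamma> + 1)" using \<gamma> by (simp add: q_star_def field_simps)
    hence "(q_star \<gamma> k - 1) * (shock_sound \<gamma> y / sqrt ?z) = ((?z - 1) * shock_sound \<gamma> y) / ((\<gamma> + 1) * sqrt ?z)"
      by simp
    also have "\<dots> \<le> (sqrt ?z * (2 * (y - 1 / y))) / ((\<gamma> + 1) * sqrt ?z)"
      using main zp \<gamma> by (intro divide_right_mono) auto
    also have "\<dots> = shock_drop \<gamma> y" using zp by (simp add: shock_drop_def)
    finally show ?thesis .
  qed
  hence "q_star \<gamma> k * (shock_sound \<gamma> y / sqrt ?z) - shock_sound \<gamma> y / sqrt ?z \<le> shock_drop \<gamma> y"
    by (simp only: left_diff_distrib mult_1)
  ultimately have "Y_shock \<gamma> k y \<le> 0" unfolding Y_shock_def incident_mach_def by linarith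
  thus ?thesis using yb by blast
qed

end

section \<open>Uniqueness in the double CRPs frame\<close>

definition double_crp_profile ::
    "real \<Rightarrow> state \<Rightarrow> state \<Rightarrow> real \<Rightarrow> real \<Rightarrow> real \<Rightarrow> real \<Rightarrow> state" where
  "double_crp_profile \<gamma> U1 Up y r z \<xi> =
     (if \<xi> < 0 then wave_profile \<gamma> U1 y \<xi> else riemann_profile \<gamma> Up U1 r z \<xi>)"

text \<open>
  A solution expressed by finitely many parameters: the strength \<open>y\<close> of the left wave, and the strengths
  \<open>r\<close> and \<open>z\<close> of the waves of the first and third family to the right of the source.
\<close>

definition double_crp_data ::
    "real \<Rightarrow> real \<Rightarrow> state \<Rightarrow> state \<Rightarrow> state \<Rightarrow> real \<Rightarrow> real \<Rightarrow> real \<Rightarrow> bool" where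
  "double_crp_data \<gamma> k U1 Um Up y r z \<longleftrightarrow>
     is_state Um \<and> is_state Up \<and> 0 < velocity Um \<and> heating_jump \<gamma> k Um Up \<and>
     0 < y \<and> Um = wave \<gamma> U1 y \<and> left_wave_before \<gamma> U1 y 0 \<and> waves_meet \<gamma> Up U1 r z \<and>
     (velocity Up \<le> sound_speed \<gamma> Up \<longrightarrow> r \<le> 1) \<and> (velocity Up < sound_speed \<gamma> Up \<longrightarrow> r = 1)"

context
  fixes \<gamma> :: real
  assumes \<gamma>: "1 < \<gamma>"
begin

lemma double_crp_solutionE:
  assumes sol: "double_crp_solution \<gamma> k U1 U" and k: "0 < k" and S: "is_state U1"
  obtains Um Up y r z where "double_crp_data \<gamma> k U1 Um Up y r z"
    "\<forall>t>0. finite {x. U x t \<noteq> double_crp_profile \<gamma> U1 Up y r z (x / t)}"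
  using sol[unfolded double_crp_solution_def, THEN conjunct2]
proof (elim exE conjE)
  fix Um Up Q VL VR
  assume st: "is_state Um" "is_state Up"
    and lim: "\<forall>t>0. ((\<lambda>x. U x t) \<longlongrightarrow> Um) (at_left 0) \<and> ((\<lambda>x. U x t) \<longlongrightarrow> Up) (at_right 0)"
    and Q: "0 < Q" "k = Q / (density Um * velocity Um * (1/2 * (velocity Um)\<^sup>2 + enthalpy \<gamma> Um))"
    and heat: "heating_jump \<gamma> k Um Up"
    and L: "crp_solution \<gamma> U1 Um VL" "\<forall>t>0. \<forall>x<0. U x t = VL (x / t)"
    and R: "crp_solution \<gamma> Up U1 VR" "\<forall>\<xi><0. VR \<xi> = Up"
       "\<forall>t>0. \<forall>x>0. U x t = VR (x / t)"
  have "0 < enthalpy \<gamma> Um" using st(1) \<gamma> by (simp add: enthalpy_def is_state_def)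
  hence e: "0 < 1/2 * (velocity Um)\<^sup>2 + enthalpy \<gamma> Um" by (simp add: add_nonneg_pos)
  have "0 < density Um * velocity Um * (1/2 * (velocity Um)\<^sup>2 + enthalpy \<gamma> Um)"
    using k Q by (simp add: zero_less_divide_iff)
  hence "0 < density Um * velocity Um" using e by (simp only: zero_less_mult_pos2)
  hence pos: "0 < velocity Um" using st(1) by (simp add: is_state_def zero_less_mult_iff)
  have limL: "(VL \<longlongrightarrow> Um) (at_left 0)"
  proof (rule Lim_transform_eventually[OF lim[rule_format, THEN conjunct1, of 1]])
    have "\<forall>\<^sub>F x in at_left 0. x < (0::real)" by (simp add: eventually_at_filter)
    thus "\<forall>\<^sub>F x in at_left 0. U x 1 = VL x" by (rule eventually_mono) (use L(2) in simp)
  qed simp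
  obtain y where y: "0 < y" "Um = wave \<gamma> U1 y" "left_wave_before \<gamma> U1 y 0"
    "finite {\<xi>. \<xi> < 0 \<and> VL \<xi> \<noteq> wave_profile \<gamma> U1 y \<xi>}"
    using crp_left_half[OF \<gamma> L(1) S st(1) limL pos] .
  obtain r z where rz: "waves_meet \<gamma> Up U1 r z" "finite {\<xi>. VR \<xi> \<noteq> riemann_profile \<gamma> Up U1 r z \<xi>}"
    "velocity Up \<le> sound_speed \<gamma> Up \<Longrightarrow> r \<le> 1" "velocity Up < sound_speed \<gamma> Up \<Longrightarrow> r = 1"
    using crp_right_half[OF \<gamma> R(1) st(2) S] R(2) by blast
  have "finite {x. U x t \<noteq> double_crp_profile \<gamma> U1 Up y r z (x / t)}" if t: "0 < t" for t
  proof -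
    let ?E = "{\<xi>. \<xi> < 0 \<and> VL \<xi> \<noteq> wave_profile \<gamma> U1 y \<xi>} \<union> {\<xi>. VR \<xi> \<noteq> riemann_profile \<gamma> Up U1 r z \<xi>}"
    have "x \<in> insert 0 ((\<lambda>\<xi>. \<xi> * t) ` ?E)" if "U x t \<noteq> double_crp_profile \<gamma> U1 Up y r z (x / t)" for x
    proof (cases "x = 0")
      case False
      have "x / t \<in> ?E"
      proof (cases "x < 0")
        case True
        hence "x / t < 0" using t by (simp add: divide_neg_pos)
        thus ?thesis using that L(2) t True by (simp add: double_crp_profile_def)
      next
        case False
        hence "0 < x" using \<open>x \<noteq> 0\<close> by simp
        moreover from this have "\<not> x / t < 0" using t by (simp add: not_less)
        ultimately show ?thesis using that R(3) t by (simp add: double_crp_profile_def)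
      qed
      moreover have "x = x / t * t" using t by simp
      ultimately show ?thesis by blast
    qed simp
    hence "{x. U x t \<noteq> double_crp_profile \<gamma> U1 Up y r z (x / t)} \<subseteq> insert 0 ((\<lambda>\<xi>. \<xi> * t) ` ?E)" by blast
    thus ?thesis by (rule finite_subset) (use y(4) rz(2) in simp)
  qed
  moreover have "double_crp_data \<gamma> k U1 Um Up y r z"
    unfolding double_crp_data_def using st pos heat y rz by simp
  ultimately show ?thesis using that by blast
qed

lemma char_ratio_strict_mono:
  assumes S: "is_state S" and y: "0 < y" "y < y'" and pos: "0 < velocity (wave \<gamma> S y')"
  shows "char_ratio \<gamma> (wave \<gamma> S y) < char_ratio \<gamma> (wave \<gamma> S y')"
proof -
  have a: "0 < sound_speed \<gamma> (wave \<gamma> S y)" using sound_speed_pos[OF \<gamma> is_state_wave[OF \<gamma> S y(1)]] .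
  have v: "velocity (wave \<gamma> S y') < velocity (wave \<gamma> S y)" using velocity_wave_strict_antimono[OF \<gamma> S y] .
  have "sound_speed \<gamma> (wave \<gamma> S y) / velocity (wave \<gamma> S y) < sound_speed \<gamma> (wave \<gamma> S y') / velocity (wave \<gamma> S y')"
    using a v pos sound_speed_wave_strict_mono[OF \<gamma> S y] by (intro frac_less) auto
  thus ?thesis unfolding char_ratio_def using a v pos by (intro power_strict_mono) auto
qed

text \<open>
  Sonic flow behind the source occurs only in the choked case \<open>M\<^sub>- = M\<^sub>*\<close>.
\<close>

lemma strictly_subsonic_behind:
  assumes k: "0 < k" and S: "is_state Um" "is_state Up" "0 < velocity Um" "heating_jump \<gamma> k Um Up"
    and z: "z_star \<gamma> k < char_ratio \<gamma> Um" and le: "velocity Up \<le> sound_speed \<gamma> Up"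
  shows "velocity Up < sound_speed \<gamma> Up"
proof -
  note h = heating_jump_ratio[OF \<gamma> S refl refl]
  have "(\<gamma> + 1) * (velocity Up / velocity Um) < \<gamma> + char_ratio \<gamma> Um"
    using h(6) le unchoked[OF \<gamma> k h(5) z] by linarith
  thus ?thesis using h(7) by linarith
qed

text \<open>
  A stronger left wave (\<open>y'\<close>) would lead to a contact with larger pressure and smaller velocity. The
  weaker one may be choked and followed by a rarefaction, which only increases the difference; the
  stronger one is never choked.
\<close>

lemma subsonic_left_waves_not_less:
  assumes k: "0 < k" and S: "is_state U1"
    and D: "double_crp_data \<gamma> k U1 Um Up y r z" and sub: "velocity Um < sound_speed \<gamma> Um"
    and D': "double_crp_data \<gamma> k U1 Um' Up' y' r' z'" and sub': "velocity Um' < sound_speed \<gamma> Um'"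
    and y: "y < y'"
  shows False
proof -
  have st: "is_state Um" "is_state Up" "0 < velocity Um" "heating_jump \<gamma> k Um Up"
    and d: "0 < y" "Um = wave \<gamma> U1 y" "waves_meet \<gamma> Up U1 r z" "velocity Up \<le> sound_speed \<gamma> Up \<Longrightarrow> r \<le> 1"
    using D by (auto simp: double_crp_data_def)
  have st': "is_state Um'" "is_state Up'" "0 < velocity Um'" "heating_jump \<gamma> k Um' Up'"
    and d': "Um' = wave \<gamma> U1 y'" "waves_meet \<gamma> Up' U1 r' z'" "velocity Up' < sound_speed \<gamma> Up' \<Longrightarrow> r' = 1"
    using D' by (auto simp: double_crp_data_def)
  have r: "z_star \<gamma> k \<le> char_ratio \<gamma> Um" "velocity Up \<le> sound_speed \<gamma> Up"
    by (rule heating_jump_regime[OF \<gamma> k st]; use sub in simp)+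
  have r': "velocity Up' \<le> sound_speed \<gamma> Up'"
    by (rule heating_jump_regime[OF \<gamma> k st']; use sub' in simp)
  have lt: "char_ratio \<gamma> Um < char_ratio \<gamma> Um'"
    using char_ratio_strict_mono[OF S d(1) y] st'(3) unfolding d(2) d'(1) by simp
  note h = heating_jump_ratio[OF \<gamma> st refl refl] and h' = heating_jump_ratio[OF \<gamma> st' refl refl]
  have "z_star \<gamma> k < char_ratio \<gamma> Um'" using r(1) lt by simp
  hence "r' = 1" using strictly_subsonic_behind[OF k st' _ r'] d'(3) by simp
  note mono = subsonic_ratio_strict_antimono[OF \<gamma> k h(5) _ h'(5) _ r(1) lt]
  have q: "velocity Up' / velocity Um' < velocity Up / velocity Um"
    and p: "1 + \<gamma> * (1 - velocity Up / velocity Um) / char_ratio \<gamma> Um <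
      1 + \<gamma> * (1 - velocity Up' / velocity Um') / char_ratio \<gamma> Um'"
    using mono h(6) h'(6) r(2) r' by auto
  have vm: "velocity Um' < velocity Um" "pressure Um < pressure Um'"
    using velocity_wave_strict_antimono[OF \<gamma> S d(1) y] pressure_wave_strict_mono[OF \<gamma> S d(1) y]
    unfolding d(2) d'(1) by auto
  have "velocity Up' < velocity Up"
    using mult_strict_mono[OF q vm(1)] h(1) st'(3) h(3) h'(3) by simp
  moreover have "pressure Up < pressure Up'"
  proof -
    have pos: "0 < pressure Um" "0 < pressure Up" using st by (auto simp: is_state_def)
    hence "0 < 1 + \<gamma> * (1 - velocity Up / velocity Um) / char_ratio \<gamma> Um"
      using h(4) by (simp add: zero_less_mult_iff)
    thus ?thesis unfolding h(4) h'(4) using vm(2) p pos by (intro mult_strict_mono) auto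
  qed
  moreover have "velocity Up \<le> velocity (wave \<gamma> Up r)" "pressure (wave \<gamma> Up r) \<le> pressure Up"
  proof -
    have r1: "0 < r" "r \<le> 1" using d(3,4) r(2) by (auto simp: waves_meet_def)
    have "velocity (wave \<gamma> Up 1) \<le> velocity (wave \<gamma> Up r) \<and> pressure (wave \<gamma> Up r) \<le> pressure (wave \<gamma> Up 1)"
      using velocity_wave_strict_antimono[OF \<gamma> st(2) r1(1), of 1]
        pressure_wave_strict_mono[OF \<gamma> st(2) r1(1), of 1] r1(2) by (cases "r = 1") auto
    thus "velocity Up \<le> velocity (wave \<gamma> Up r)" "pressure (wave \<gamma> Up r) \<le> pressure Up"
      by (simp_all add: wave_1[OF \<gamma>])
  qed
  ultimately have lt2: "velocity (wave \<gamma> (mirror U1) z) < velocity (wave \<gamma> (mirror U1) z')"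
    "pressure (wave \<gamma> (mirror U1) z) < pressure (wave \<gamma> (mirror U1) z')" "0 < z" "0 < z'"
    using d(3) d'(2) \<open>r' = 1\<close> by (auto simp: waves_meet_def wave_1[OF \<gamma>])
  have "is_state (mirror U1)" using S by simp
  from velocity_wave_strict_antimono[OF \<gamma> this, of z z'] pressure_wave_strict_mono[OF \<gamma> this, of z' z]
  show False using lt2 by (cases z z' rule: linorder_cases) auto
qed

text \<open>
  Behind a left wave of nonpositive speed the flow is at most sonic.
\<close>

lemma supersonic_no_left_wave:
  assumes S: "is_state U1" and D: "double_crp_data \<gamma> k U1 Um Up y r z" and sup: "sound_speed \<gamma> Um < velocity Um"
  shows "y = 1" "Um = U1"
proof -
  have d: "0 < y" "Um = wave \<gamma> U1 y" "left_wave_before \<gamma> U1 y 0"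
    using D by (auto simp: double_crp_data_def)
  show "y = 1" using d(3) sup shock_lax(1)[OF \<gamma> S, of y] unfolding left_wave_before_def d(2) by auto
  thus "Um = U1" using d(2) by (simp add: wave_1[OF \<gamma>])
qed

text \<open>
  Here \<open>M\<^sub>1 \<ge> M\<^sub>*\<^sub>*\<close>, so that a purely supersonic flow is possible, and a subsonic solution exists in
  addition. In the latter the left wave and, by the momentum balance, the right wave are shocks, so it
  satisfies the shock relation that underlies \<open>Y\<close>, but with \<open>M\<^sub>- < M\<^sub>*\<close>. Weakening the left shock until
  \<open>M\<^sub>- = M\<^sub>*\<close> increases \<open>u\<^sub>+\<close> and decreases \<open>p\<^sub>+\<close>, which gives \<open>Y M\<^sub>1 > 0\<close>.
\<close>

lemma subsonic_supersonic_coexistence: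
  assumes k: "0 < k" "k * (\<gamma>\<^sup>2 - 1) < 1" and S: "is_state U1" and sup: "sound_speed \<gamma> U1 < velocity U1"
    and ratio: "char_ratio \<gamma> U1 \<le> z_star_star \<gamma> k"
    and D: "double_crp_data \<gamma> k U1 Um Up y r z" and sub: "velocity Um < sound_speed \<gamma> Um"
  shows "\<exists>M\<ge>M_star \<gamma> k. Y_fun \<gamma> k M = 0 \<and> M_star_star \<gamma> k < ereal M"
proof -
  have st: "is_state Um" "is_state Up" "0 < velocity Um" "heating_jump \<gamma> k Um Up"
    and d: "0 < y" "Um = wave \<gamma> U1 y" "left_wave_before \<gamma> U1 y 0" "waves_meet \<gamma> Up U1 r z"
      "velocity Up < sound_speed \<gamma> Up \<Longrightarrow> r = 1"
    using D by (auto simp: double_crp_data_def)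
  define a where "a = sound_speed \<gamma> U1"
  define m where "m = velocity U1 / a"
  define c where "c = shock_sound \<gamma> y"
  define v where "v = m - shock_drop \<gamma> y"
  have a: "0 < a" using sound_speed_pos[OF \<gamma> S] by (simp add: a_def)
  have u1: "velocity U1 = a * m" using a by (simp add: m_def)
  have m1: "1 < m" using sup a by (simp add: m_def a_def)
  have mr: "1 / m\<^sup>2 \<le> z_star_star \<gamma> k" using ratio a by (simp add: char_ratio_def m_def power_divide a_def)
  have y1: "1 < y"
  proof (rule ccontr)
    assume "\<not> 1 < y"
    hence "velocity U1 \<le> velocity Um \<and> sound_speed \<gamma> Um \<le> sound_speed \<gamma> U1"
      using velocity_wave_strict_antimono[OF \<gamma> S d(1), of 1] sound_speed_wave_strict_mono[OF \<gamma> S d(1), of 1]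
      unfolding d(2) by (cases "y = 1") (auto simp: wave_1[OF \<gamma>])
    thus False using sup sub by simp
  qed
  have my: "m < y"
  proof -
    have "a * m < a * y" using d(3) y1 u1 by (auto simp: left_wave_before_def a_def)
    thus ?thesis using a by simp
  qed
  have vel: "velocity Um = a * v" unfolding d(2) velocity_behind_shock[OF \<gamma> y1]
    by (simp add: u1 v_def a_def algebra_simps)
  have snd: "sound_speed \<gamma> Um = a * c" unfolding d(2) using sound_speed_behind_shock[OF \<gamma> S y1]
    by (simp add: c_def a_def)
  have v: "0 < v" using st(3) vel a by (simp add: zero_less_mult_iff)
  have zUm: "char_ratio \<gamma> Um = (c / v)\<^sup>2" using a by (simp add: char_ratio_def vel snd)
  have zlt: "z_star \<gamma> k < char_ratio \<gamma> Um"
    unfolding zUm c_def v_def using v m1 my mr by (intro standing_shock_chokes[OF \<gamma> k(1) y1]) (auto simp: v_def)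
  have le: "velocity Up \<le> sound_speed \<gamma> Up"
    by (rule heating_jump_regime[OF \<gamma> k(1) st]; use sub in simp)
  have lt: "velocity Up < sound_speed \<gamma> Up" by (rule strictly_subsonic_behind[OF k(1) st zlt le])
  hence r1: "r = 1" using d(5) by simp
  note h = heating_jump_ratio[OF \<gamma> st refl refl]
  define q where "q = velocity Up / velocity Um"
  define pr where "pr = 1 + \<gamma> * (1 - q) / char_ratio \<gamma> Um"
  have q: "heat_balance \<gamma> k (char_ratio \<gamma> Um) q" "(\<gamma> + 1) * q \<le> \<gamma> + char_ratio \<gamma> Um" "0 < q"
    using h(1,5,6) le by (simp_all add: q_def)
  have velp: "velocity Up = a * (q * v)"
  proof -
    have "velocity Up = q * velocity Um" using h(3) by (simp only: q_def)
    thus ?thesis unfolding vel by (simp add: mult_ac)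
  qed
  have f: "0 < f3 \<gamma> y 0" "0 < f2 \<gamma> y 0" using f3_pos[OF \<gamma>] f2_gt_1[OF \<gamma> y1] y1 by auto
  have pm: "pressure Um = pressure U1 * f2 \<gamma> y 0" "density Um = density U1 / f3 \<gamma> y 0"
    unfolding d(2) using y1 by (simp_all add: pressure_wave density_wave)
  have pp: "pressure Up = pressure U1 * (f2 \<gamma> y 0 * pr)" using h(4) pm by (simp add: pr_def q_def)
  have p1: "0 < pressure U1" "0 < density U1" "0 < pressure Up" using S st by (auto simp: is_state_def)
  \<comment> \<open>The left shock raises the momentum flux, and since \<open>M\<^sub>+ < 1\<close> more than the fraction
     \<open>1 / (1 + \<gamma>)\<close> of it is pressure behind the source.\<close>
  have above: "pressure U1 < pressure Up"
  proof -
    have "density U1 * a\<^sup>2 = \<gamma> * pressure U1" using p1 by (simp add: a_def sound_speed_squared[OF \<gamma> S])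
    hence "density Um * (velocity Um)\<^sup>2 = \<gamma> * pressure U1 * v\<^sup>2 / f3 \<gamma> y 0"
      unfolding pm vel by (simp add: power_mult_distrib)
    hence "density Um * (velocity Um)\<^sup>2 + pressure Um = pressure U1 * (f2 \<gamma> y 0 + \<gamma> * v\<^sup>2 / f3 \<gamma> y 0)"
      unfolding pm(1) by (simp add: distrib_left mult_ac)
    hence "pressure U1 * (1 + \<gamma>) < density Um * (velocity Um)\<^sup>2 + pressure Um"
      using momentum_flux_rises[OF \<gamma> y1 m1] p1 by (simp add: v_def)
    also have "\<dots> = density Up * (velocity Up)\<^sup>2 + pressure Up"
      using st(4) by (simp add: heating_jump_def)
    also have "\<dots> \<le> \<gamma> * pressure Up + pressure Up"
      using velocity_le_sound_speed_iff[OF \<gamma> st(2)] le h(1) st(3) by (simp add: zero_less_divide_iff)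
    finally have "pressure U1 * (1 + \<gamma>) < pressure Up * (1 + \<gamma>)" by (simp add: algebra_simps)
    thus ?thesis using \<gamma> by simp
  qed
  \<comment> \<open>So the right wave is a shock, and the formula for shocks in \<open>X_fun\<close> applies.\<close>
  have meet: "0 < z" "velocity Up = - velocity (wave \<gamma> (mirror U1) z)" "pressure Up = pressure (wave \<gamma> (mirror U1) z)"
    using d(4) r1 by (simp_all add: waves_meet_def wave_1[OF \<gamma>])
  have z1: "1 < z"
  proof (rule ccontr)
    assume "\<not> 1 < z"
    hence "pressure (wave \<gamma> (mirror U1) z) \<le> pressure (wave \<gamma> (mirror U1) 1)"
      using pressure_wave_strict_mono[OF \<gamma>, of "mirror U1" z 1] S meet(1) by (cases "z = 1") auto
    thus False using above meet(3) by (simp add: wave_1[OF \<gamma>])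
  qed
  have "velocity Up = a * m + a * shock_drop \<gamma> z"
    using meet(2) velocity_behind_shock[OF \<gamma> z1, of "mirror U1"] u1 by (simp add: a_def)
  hence "a * (q * v) = a * (m + shock_drop \<gamma> z)" using velp by (simp add: distrib_left)
  hence qv: "q * v = m + shock_drop \<gamma> z" using a by simp
  have "f2 \<gamma> y 0 * pr = f2 \<gamma> z 0" using meet(3) z1 pp p1 by (simp add: pressure_wave)
  hence sol: "q * v - m = back_shock_velocity \<gamma> (f2 \<gamma> y 0 * pr)"
    using back_shock_velocity_f2[OF \<gamma> meet(1)] qv by simp
  \<comment> \<open>The weaker left shock, of strength \<open>ys\<close>, behind which the Mach number is exactly \<open>M\<^sub>*\<close>.\<close>
  note zs = z_star_bounds(2)[OF \<gamma> k(1)]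
  have sz: "0 < sqrt (z_star \<gamma> k)" using zs by simp
  have c: "0 < c" using shock_sound_pos[OF \<gamma>, of y] y1 by (simp add: c_def)
  have "sqrt (z_star \<gamma> k) < c / v" using zlt zUm c v by (simp add: real_less_lsqrt)
  hence vc: "v < c / sqrt (z_star \<gamma> k)" using v sz by (simp add: field_simps)
  hence my': "m < incident_mach \<gamma> k y" by (simp add: incident_mach_def c_def v_def)
  have one: "incident_mach \<gamma> k 1 < m"
  proof -
    have "1 / sqrt (z_star \<gamma> k) < 1" using zs by simp
    thus ?thesis using m1 by (simp add: incident_mach_def shock_sound_1[OF \<gamma>] shock_drop_1[OF \<gamma>])
  qed
  have ex: "\<exists>x\<ge>1. x \<le> y \<and> incident_mach \<gamma> k x = m"
    by (rule IVT') (use one my' y1 in \<open>auto intro: continuous_on_subset[OF continuous_on_shock_functions(2)[OF \<gamma>]]\<close>)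
  then obtain ys where ys: "1 \<le> ys" "ys \<le> y" "incident_mach \<gamma> k ys = m" by blast
  have ysy: "ys < y" using ys my' by (cases "ys = y") auto
  have vs: "shock_sound \<gamma> ys / sqrt (z_star \<gamma> k) = m - shock_drop \<gamma> ys"
    using ys(3) by (simp add: incident_mach_def)
  have vless: "v < m - shock_drop \<gamma> ys" using shock_drop_strict_mono[OF \<gamma>, of ys y] ys ysy by (simp add: v_def)
  note qs = q_star_eq[OF \<gamma>, of k]
  have cmp: "q < q_star \<gamma> k" "p_star \<gamma> k < pr"
    using subsonic_ratio_strict_antimono[OF \<gamma> k(1) heat_balance_star[OF \<gamma> k(1)] _ q(1,2) order_refl zlt] qs
    by (simp_all add: p_star_def pr_def)
  have "q * v < q_star \<gamma> k * (m - shock_drop \<gamma> ys)"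
    using cmp(1) vless q(3) v by (intro mult_strict_mono) auto
  moreover have "back_shock_velocity \<gamma> (f2 \<gamma> ys 0 * p_star \<gamma> k) < back_shock_velocity \<gamma> (f2 \<gamma> y 0 * pr)"
  proof (rule back_shock_velocity_strict_mono[OF \<gamma>])
    have ps: "0 < p_star \<gamma> k" by (rule p_star_pos[OF \<gamma> k(1)])
    have fs: "0 < f2 \<gamma> ys 0" using f2_gt_1[OF \<gamma>, of ys] f2_1[OF \<gamma>] ys by (cases "ys = 1") auto
    show "0 < f2 \<gamma> ys 0 * p_star \<gamma> k" using ps fs by simp
    show "f2 \<gamma> ys 0 * p_star \<gamma> k < f2 \<gamma> y 0 * pr"
      using f2_strict_mono[OF \<gamma>, of ys y] ys ysy cmp(2) ps fs by (intro mult_strict_mono) auto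
  qed
  ultimately have Ypos: "0 < Y_shock \<gamma> k ys" using sol by (simp add: Y_shock_def vs ys(3))
  obtain yl where yl: "ys < yl" "Y_shock \<gamma> k yl \<le> 0"
    using Y_shock_eventually_nonpos[OF \<gamma> k(1) _ ys(1)] k(2) by auto
  have "\<exists>x\<ge>ys. x \<le> yl \<and> Y_shock \<gamma> k x = 0"
    by (rule IVT2') (use Ypos yl ys in \<open>auto intro: continuous_on_subset[OF continuous_on_Y_shock[OF \<gamma> k(1)]]\<close>)
  then obtain y0 where y0: "ys \<le> y0" "Y_shock \<gamma> k y0 = 0" by blast
  have "ys < y0" using y0 Ypos by (cases "ys = y0") auto
  hence big: "m < incident_mach \<gamma> k y0" using incident_mach_strict_mono[OF \<gamma> k(1) ys(1)] ys(3) by auto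
  have "Y_fun \<gamma> k (incident_mach \<gamma> k y0) = 0" using Y_fun_incident_mach[OF \<gamma> k(1)] y0 ys by simp
  moreover have "M_star \<gamma> k \<le> incident_mach \<gamma> k y0"
    using one big by (simp add: M_star_eq[OF \<gamma> k(1)] incident_mach_def shock_sound_1[OF \<gamma>] shock_drop_1[OF \<gamma>])
  moreover have "M_star_star \<gamma> k < ereal (incident_mach \<gamma> k y0)"
  proof -
    note b = M_star_star_eq[OF \<gamma> k]
    have "1 \<le> z_star_star \<gamma> k * m\<^sup>2" using mr m1 by (simp add: pos_divide_le_eq)
    hence "sqrt 1 \<le> sqrt (z_star_star \<gamma> k * m\<^sup>2)" by (rule real_sqrt_le_mono)
    hence "1 / sqrt (z_star_star \<gamma> k) \<le> m" using b(1) m1 by (simp add: real_sqrt_mult field_simps)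
    thus ?thesis using b(2) big by simp
  qed
  ultimately show ?thesis by blast
qed

lemma double_crp_data_unique:
  assumes k: "0 < k" and S: "is_state U1"
    and Y: "k * (\<gamma>\<^sup>2 - 1) < 1 \<Longrightarrow> \<forall>M\<ge>M_star \<gamma> k. Y_fun \<gamma> k M = 0 \<longrightarrow> ereal M \<le> M_star_star \<gamma> k"
    and D: "double_crp_data \<gamma> k U1 Um Up y r z" and D': "double_crp_data \<gamma> k U1 Um' Up' y' r' z'"
  shows "Up = Up' \<and> y = y' \<and> r = r' \<and> z = z'"
proof -
  have no_coexistence: False
    if D: "double_crp_data \<gamma> k U1 Um Up y r z" and sub: "velocity Um < sound_speed \<gamma> Um"
      and D': "double_crp_data \<gamma> k U1 Um' Up' y' r' z'" and sup: "sound_speed \<gamma> Um' < velocity Um'"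
      and ratio: "char_ratio \<gamma> Um' \<le> z_star_star \<gamma> k" for Um Up y r z Um' Up' y' r' z'
  proof -
    have eq: "Um' = U1" by (rule supersonic_no_left_wave(2)[OF S D' sup])
    have "0 < char_ratio \<gamma> U1" using char_ratio_pos[OF \<gamma> S] D' unfolding eq by (simp add: double_crp_data_def)
    hence "0 < z_star \<gamma> k * z_star_star \<gamma> k" using ratio z_star_bounds(2)[OF \<gamma> k] unfolding eq by simp
    hence k1: "k * (\<gamma>\<^sup>2 - 1) < 1" unfolding z_star_mult[OF \<gamma> k] by simp
    show False using subsonic_supersonic_coexistence[OF k k1 S _ _ D sub] sup ratio Y[OF k1] unfolding eq
      by (meson not_le)
  qed
  have st: "is_state Um" "is_state Up" "0 < velocity Um" "heating_jump \<gamma> k Um Up"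
    and d: "Um = wave \<gamma> U1 y" "waves_meet \<gamma> Up U1 r z"
    using D by (auto simp: double_crp_data_def)
  have st': "is_state Um'" "is_state Up'" "0 < velocity Um'" "heating_jump \<gamma> k Um' Up'"
    and d': "Um' = wave \<gamma> U1 y'" "waves_meet \<gamma> Up' U1 r' z'"
    using D' by (auto simp: double_crp_data_def)
  have y: "y = y'"
  proof (rule heating_jump_regime[OF \<gamma> k st])
    assume sub: "velocity Um < sound_speed \<gamma> Um"
    show ?thesis
    proof (rule heating_jump_regime[OF \<gamma> k st'])
      assume sub': "velocity Um' < sound_speed \<gamma> Um'"
      show ?thesis using subsonic_left_waves_not_less[OF k S D sub D' sub'] subsonic_left_waves_not_less[OF k S D' sub' D sub]
        by (meson linorder_neqE)
    next
      assume "sound_speed \<gamma> Um' < velocity Um'" "char_ratio \<gamma> Um' \<le> z_star_star \<gamma> k"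
      thus ?thesis using no_coexistence[OF D sub D'] by blast
    qed
  next
    assume sup: "sound_speed \<gamma> Um < velocity Um" "char_ratio \<gamma> Um \<le> z_star_star \<gamma> k"
    show ?thesis
    proof (rule heating_jump_regime[OF \<gamma> k st'])
      assume "velocity Um' < sound_speed \<gamma> Um'"
      thus ?thesis using no_coexistence[OF D' _ D sup] by blast
    next
      assume "sound_speed \<gamma> Um' < velocity Um'"
      thus ?thesis using supersonic_no_left_wave(1)[OF S D sup(1)] supersonic_no_left_wave(1)[OF S D'] by simp
    qed
  qed
  have "Um' = Um" using y d(1) d'(1) by simp
  hence Up: "Up = Up'" using heating_jump_unique[OF \<gamma> k st(1,2) st'(2) st(3,4)] st'(4) by simp
  thus ?thesis using y waves_meet_unique[OF \<gamma> st(2) S d(2)] d'(2) by auto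
qed

lemma unique_double_crp_solutionI:
  assumes k: "0 < k" and S: "is_state U1"
    and Y: "k * (\<gamma>\<^sup>2 - 1) < 1 \<Longrightarrow> \<forall>M\<ge>M_star \<gamma> k. Y_fun \<gamma> k M = 0 \<longrightarrow> ereal M \<le> M_star_star \<gamma> k"
  shows "unique_double_crp_solution \<gamma> k U1"
  unfolding unique_double_crp_solution_def
proof (intro allI impI)
  fix U W and t :: real
  assume U: "double_crp_solution \<gamma> k U1 U" and W: "double_crp_solution \<gamma> k U1 W" and t: "0 \<le> t"
  show "finite {x. U x t \<noteq> W x t}"
  proof (cases "t = 0")
    case True
    thus ?thesis using U W by (simp add: double_crp_solution_def)
  next
    case False
    obtain Um Up y r z where 1: "double_crp_data \<gamma> k U1 Um Up y r z"
      "\<forall>t>0. finite {x. U x t \<noteq> double_crp_profile \<gamma> U1 Up y r z (x / t)}"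
      by (rule double_crp_solutionE[OF U k S])
    obtain Um' Up' y' r' z' where 2: "double_crp_data \<gamma> k U1 Um' Up' y' r' z'"
      "\<forall>t>0. finite {x. W x t \<noteq> double_crp_profile \<gamma> U1 Up' y' r' z' (x / t)}"
      by (rule double_crp_solutionE[OF W k S])
    have eq: "Up' = Up" "y' = y" "r' = r" "z' = z" using double_crp_data_unique[OF k S Y 1(1) 2(1)] by simp_all
    have "{x. U x t \<noteq> W x t} \<subseteq> {x. U x t \<noteq> double_crp_profile \<gamma> U1 Up y r z (x / t)}
        \<union> {x. W x t \<noteq> double_crp_profile \<gamma> U1 Up y r z (x / t)}" by auto
    thus ?thesis by (rule finite_subset) (use 1(2) 2(2) eq t False in simp)
  qed
qed

end

theorem theorem4p2:
  fixes \<gamma> k :: real and U1 :: state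
  assumes "1 < \<gamma>" and "\<gamma> < 3" and "k > 0"
    and "is_state U1" and "velocity U1 > 0"
  shows "(k * (\<gamma>\<^sup>2 - 1) \<ge> 1 \<longrightarrow> unique_double_crp_solution \<gamma> k U1) \<and>
         (k * (\<gamma>\<^sup>2 - 1) < 1 \<longrightarrow>
            (\<forall>M\<ge>M_star \<gamma> k. Y_fun \<gamma> k M = 0 \<longrightarrow> ereal M \<le> M_star_star \<gamma> k) \<longrightarrow>
            unique_double_crp_solution \<gamma> k U1)"
  using unique_double_crp_solutionI[OF assms(1,3,4)] by (meson not_le)

end
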